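(* Let $G = (V,E)$ be a countable graph of bounded degree and let $A$ be its adjacency operator on $\ell^2(V)$. (1) If $v, w \in V$ are two vertices such that there exists an automorphism of $G$ mapping $v$ to $w$, then the vertex spectral measures $\mu_v$ and $\mu_w$ are equal. (2) If the group of automorphisms of $G$ is transitive on $V$, then all vertex spectral measures $\mu_v$ ($v \in V$) are equal, and all vertices of $G$ are dominant.
   Context: A graph $G=(V,E)$ has a (nonempty) countable (finite or infinite) vertex set $V$ and edge set $E$, a set of unordered pairs $\{v,w\}$ of distinct vertices; it has bounded degree if there is a constant bounding the number of edges incident to every vertex. The adjacency operator $A$ is the bounded self-adjoint operator on the complex Hilbert space $\ell^2(V)$ given by $(A\xi)(v)=\sum_{w:\{v,w\}\in E}\xi(w)$. $\Sigma(A)$ is its spectrum. For $\xi\in\ell^2(V)$, the local spectral measure $\mu_\xi$ of $A$ at $\xi$ is the finite positive Borel measure on $\Sigma(A)$ with $\int_{\Sigma(A)} f\,d\mu_\xi=\langle f(A)\xi\mid\xi\rangle$ for all continuous $f:\Sigma(A)\to\mathbf{C}$. For $v\in V$, $\delta_v\in\ell^2(V)$ is the characteristic function of $\{v\}$, and $\mu_v:=\mu_{\delta_v}$ is the vertex spectral measure at $v$. A vertex $v$ is dominant if for every $\eta\in\ell^2(V)$ the measure $\mu_\eta$ is absolutely continuous with respect to $\mu_v$. *)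

theory Defs
  imports "HOL-Analysis.Analysis" "HOL-Computational_Algebra.Polynomial"
begin

section \<open>Graphs\<close>

definition countable_graph :: "'a set \<Rightarrow> 'a set set \<Rightarrow> bool" where
  "countable_graph V E \<longleftrightarrow>
     V \<noteq> {} \<and> countable V \<and> E \<subseteq> {{v, w} |v w. v \<in> V \<and> w \<in> V \<and> v \<noteq> w}"

definition bounded_degree :: "'a set \<Rightarrow> 'a set set \<Rightarrow> bool" where
  "bounded_degree V E \<longleftrightarrow>
     (\<exists>d::nat. \<forall>v\<in>V. finite {e \<in> E. v \<in> e} \<and> card {e \<in> E. v \<in> e} \<le> d)"

text \<open>Only the values of \<open>\<phi>\<close> on \<open>V\<close> matter.\<close>

definition graph_automorphism :: "'a set \<Rightarrow> 'a set set \<Rightarrow> ('a \<Rightarrow> 'a) \<Rightarrow> bool" where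
  "graph_automorphism V E \<phi> \<longleftrightarrow>
     bij_betw \<phi> V V \<and> (\<forall>v\<in>V. \<forall>w\<in>V. {v, w} \<in> E \<longleftrightarrow> {\<phi> v, \<phi> w} \<in> E)"

definition vertex_transitive :: "'a set \<Rightarrow> 'a set set \<Rightarrow> bool" where
  "vertex_transitive V E \<longleftrightarrow>
     (\<forall>v\<in>V. \<forall>w\<in>V. \<exists>\<phi>. graph_automorphism V E \<phi> \<and> \<phi> v = w)"


section \<open>The Hilbert space of square-summable functions and its operators\<close>

text \<open>Elements of the space over \<open>V\<close> are functions on the whole type that vanish
  off \<open>V\<close>, so that equality of vectors is equality of functions.\<close>

definition ell2 :: "'a set \<Rightarrow> ('a \<Rightarrow> complex) set" where
  "ell2 V = {\<xi>. (\<forall>v. v \<notin> V \<longrightarrow> \<xi> v = 0) \<and> (\<lambda>v. (cmod (\<xi> v))\<^sup>2) summable_on V}"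

definition ell2_inner :: "'a set \<Rightarrow> ('a \<Rightarrow> complex) \<Rightarrow> ('a \<Rightarrow> complex) \<Rightarrow> complex" where
  "ell2_inner V \<xi> \<eta> = (\<Sum>\<^sub>\<infinity>v\<in>V. \<xi> v * cnj (\<eta> v))"

definition ell2_norm :: "'a set \<Rightarrow> ('a \<Rightarrow> complex) \<Rightarrow> real" where
  "ell2_norm V \<xi> = sqrt (\<Sum>\<^sub>\<infinity>v\<in>V. (cmod (\<xi> v))\<^sup>2)"

definition delta :: "'a \<Rightarrow> 'a \<Rightarrow> complex" where
  "delta v = (\<lambda>w. if w = v then 1 else 0)"

type_synonym 'a operator = "('a \<Rightarrow> complex) \<Rightarrow> ('a \<Rightarrow> complex)"

definition bounded_operator :: "'a set \<Rightarrow> 'a operator \<Rightarrow> bool" where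
  "bounded_operator V T \<longleftrightarrow>
     (\<forall>\<xi>\<in>ell2 V. T \<xi> \<in> ell2 V) \<and>
     (\<forall>\<xi>\<in>ell2 V. \<forall>\<eta>\<in>ell2 V. T (\<lambda>v. \<xi> v + \<eta> v) = (\<lambda>v. T \<xi> v + T \<eta> v)) \<and>
     (\<forall>c. \<forall>\<xi>\<in>ell2 V. T (\<lambda>v. c * \<xi> v) = (\<lambda>v. c * T \<xi> v)) \<and>
     (\<exists>C. \<forall>\<xi>\<in>ell2 V. ell2_norm V (T \<xi>) \<le> C * ell2_norm V \<xi>)"

definition operator_norm :: "'a set \<Rightarrow> 'a operator \<Rightarrow> real" where
  "operator_norm V T = (SUP \<xi>\<in>{\<xi> \<in> ell2 V. ell2_norm V \<xi> \<le> 1}. ell2_norm V (T \<xi>))"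

definition spectrum :: "'a set \<Rightarrow> 'a operator \<Rightarrow> complex set" where
  "spectrum V A = {z. \<not> (\<exists>B. bounded_operator V B \<and>
     (\<forall>\<xi>\<in>ell2 V. B (\<lambda>v. A \<xi> v - z * \<xi> v) = \<xi> \<and>
                  (\<lambda>v. A (B \<xi>) v - z * B \<xi> v) = \<xi>))}"


section \<open>Continuous functional calculus and local spectral measures\<close>

definition poly_operator :: "'a operator \<Rightarrow> complex poly \<Rightarrow> 'a operator" where
  "poly_operator A p = (\<lambda>\<xi> v. \<Sum>i\<le>degree p. coeff p i * (A ^^ i) \<xi> v)"

text \<open>For a bounded self-adjoint \<open>A\<close>, whose spectrum is a compact subset of the real line,
  and \<open>f\<close> continuous on the spectrum, \<open>f(A)\<close> is the operator-norm limit of \<open>p\<^sub>n(A)\<close> for every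
  sequence of polynomials \<open>p\<^sub>n\<close> that converges to \<open>f\<close> uniformly on the spectrum. Extensionality
  makes the operator unique as a function on the whole type.\<close>

definition functional_calculus ::
    "'a set \<Rightarrow> 'a operator \<Rightarrow> (complex \<Rightarrow> complex) \<Rightarrow> 'a operator" where
  "functional_calculus V A f =
     (THE T. bounded_operator V T \<and> T \<in> extensional (ell2 V) \<and>
        (\<forall>p. uniform_limit (spectrum V A) (\<lambda>n. poly (p n)) f sequentially \<longrightarrow>
             (\<lambda>n. operator_norm V (\<lambda>\<xi> v. poly_operator A (p n) \<xi> v - T \<xi> v))
               \<longlonglongrightarrow> 0))"

definition local_spectral_measure ::
    "'a set \<Rightarrow> 'a operator \<Rightarrow> ('a \<Rightarrow> complex) \<Rightarrow> complex measure" where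
  "local_spectral_measure V A \<xi> =
     (THE \<mu>. sets \<mu> = sets (restrict_space borel (spectrum V A)) \<and> finite_measure \<mu> \<and>
        (\<forall>f. continuous_on (spectrum V A) f \<longrightarrow>
             (\<integral>x. f x \<partial>\<mu>) = ell2_inner V (functional_calculus V A f \<xi>) \<xi>))"


section \<open>The adjacency operator\<close>

text \<open>For \<open>v \<notin> V\<close> the sum is empty, since all edges lie in \<open>V\<close>.\<close>

definition adjacency_operator :: "'a set set \<Rightarrow> 'a operator" where
  "adjacency_operator E = (\<lambda>\<xi> v. \<Sum>w | {v, w} \<in> E. \<xi> w)"

definition vertex_spectral_measure :: "'a set \<Rightarrow> 'a set set \<Rightarrow> 'a \<Rightarrow> complex measure" where
  "vertex_spectral_measure V E v = local_spectral_measure V (adjacency_operator E) (delta v)"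

text \<open>\<open>absolutely_continuous M N\<close> means that \<open>N\<close> is absolutely continuous with respect
  to \<open>M\<close>.\<close>

definition dominant :: "'a set \<Rightarrow> 'a set set \<Rightarrow> 'a \<Rightarrow> bool" where
  "dominant V E v \<longleftrightarrow>
     (\<forall>\<eta>\<in>ell2 V. absolutely_continuous (vertex_spectral_measure V E v)
                    (local_spectral_measure V (adjacency_operator E) \<eta>))"

end

(* A vertex measure mu_v is determined by the moments <A^i delta_v, delta_v>, and these are invariant
   under automorphisms because an automorphism commutes with A. If all vertex measures agree, a Borel
   set that is null for one of them is null for the local measure of every finitely supported vector,
   and, these being dense, for that of every vector.

   The measures exist because p |-> p(A) is isometric from the polynomials on the spectrum (sup norm)
   into the bounded operators: with M = ||p(A)||, the operator p(A)^* p(A) - M^2 is not bounded below,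
   so one of its linear factors A - z is not, which gives a point z of the spectrum with |p(z)| = M.
   This yields f(A) for continuous f, and f |-> <f(A) xi, xi> is positive since
   <f(A) xi, xi> = ||sqrt(f)(A) xi||^2 for f >= 0. *)

theory Submission
  imports Defs "HOL-Probability.Helly_Selection" "HOL-Computational_Algebra.Fundamental_Theorem_Algebra"
begin

section \<open>The Hilbert space of square-summable functions\<close>

text \<open>Both \<open>functional_calculus\<close> and \<open>local_spectral_measure\<close> are
  definite descriptions, which are of use only once existence and uniqueness are proved; this is why
  a spectral theorem for a single operator has to be built before two vertices can be compared.
  Uniqueness of f(A) rests on having at least one approximating sequence of polynomials, hence on a
  Weierstrass theorem on the spectrum, and that in turn on the spectrum being real. Reality also
  makes \<open>map_poly cnj p * p\<close> equal to |p|^2 on the spectrum and lets the measures be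
  found on the line. Since \<open>ell2 V\<close> is a set of functions and not a type, limits and
  completeness are expressed by explicit predicates, and equations for A - z are solved as
  fixed-point equations of contractions. The square root serves a second time in the proof of
  dominance: it turns <h(A) xi, xi> into a squared norm, for which the triangle inequality in xi is
  available, so that the measure of a sum of vectors is bounded by the measures of the summands up
  to a constant factor.\<close>

lemma ell2_norm_nonneg [simp]: "0 \<le> ell2_norm V \<xi>"
  by (simp add: ell2_norm_def infsum_nonneg)

lemma ell2_norm_square: "(ell2_norm V \<xi>)\<^sup>2 = (\<Sum>\<^sub>\<infinity>v\<in>V. (cmod (\<xi> v))\<^sup>2)"
  by (simp add: ell2_norm_def infsum_nonneg)

lemma ell2_off: "\<xi> \<in> ell2 V \<Longrightarrow> v \<notin> V \<Longrightarrow> \<xi> v = 0"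
  by (simp add: ell2_def)

lemma L2_set_le_ell2_norm:
  assumes "\<xi> \<in> ell2 V" "finite F" "F \<subseteq> V"
  shows "L2_set (\<lambda>v. cmod (\<xi> v)) F \<le> ell2_norm V \<xi>"
  unfolding L2_set_def ell2_norm_def
  by (intro real_sqrt_le_mono finite_sum_le_infsum) (use assms in \<open>auto simp: ell2_def\<close>)

text \<open>Reduces membership in the space and a norm bound to finite subsets, where the
  inequalities for \<open>L2_set\<close> apply. The triangle inequality, completeness and
  boundedness of the adjacency operator all go through it.\<close>

lemma ell2_bounded_partial_sums:
  assumes "\<And>v. v \<notin> V \<Longrightarrow> \<xi> v = 0"
    and "\<And>F. finite F \<Longrightarrow> F \<subseteq> V \<Longrightarrow> L2_set (\<lambda>v. cmod (\<xi> v)) F \<le> C"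
  shows "\<xi> \<in> ell2 V" and "ell2_norm V \<xi> \<le> C"
proof -
  have C: "0 \<le> C" using assms(2)[of "{}"] by simp
  have le: "(\<Sum>v\<in>F. (cmod (\<xi> v))\<^sup>2) \<le> C\<^sup>2" if "finite F" "F \<subseteq> V" for F
    using assms(2)[OF that] C by (simp add: L2_set_def sqrt_le_D)
  have summ: "(\<lambda>v. (cmod (\<xi> v))\<^sup>2) summable_on V"
    by (rule nonneg_bounded_partial_sums_imp_summable_on[where C = "C\<^sup>2"])
       (auto simp: eventually_finite_subsets_at_top intro!: exI[of _ "{}"] le)
  then show "\<xi> \<in> ell2 V" using assms(1) by (simp add: ell2_def)
  show "ell2_norm V \<xi> \<le> C"
    unfolding ell2_norm_def
    by (intro real_le_lsqrt infsum_le_finite_sums summ) (use C le in auto)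
qed

lemma ell2_add:
  assumes "\<xi> \<in> ell2 V" "\<eta> \<in> ell2 V"
  shows [simp]: "(\<lambda>v. \<xi> v + \<eta> v) \<in> ell2 V"
    and "ell2_norm V (\<lambda>v. \<xi> v + \<eta> v) \<le> ell2_norm V \<xi> + ell2_norm V \<eta>"
proof -
  have "L2_set (\<lambda>v. cmod (\<xi> v + \<eta> v)) F \<le> ell2_norm V \<xi> + ell2_norm V \<eta>"
    if "finite F" "F \<subseteq> V" for F
  proof -
    have "L2_set (\<lambda>v. cmod (\<xi> v + \<eta> v)) F \<le> L2_set (\<lambda>v. cmod (\<xi> v) + cmod (\<eta> v)) F"
      by (intro L2_set_mono) (auto simp: norm_triangle_ineq)
    also have "\<dots> \<le> L2_set (\<lambda>v. cmod (\<xi> v)) F + L2_set (\<lambda>v. cmod (\<eta> v)) F"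
      by (rule L2_set_triangle_ineq)
    also have "\<dots> \<le> ell2_norm V \<xi> + ell2_norm V \<eta>"
      by (intro add_mono L2_set_le_ell2_norm assms that)
    finally show ?thesis .
  qed
  note bound = this
  show "(\<lambda>v. \<xi> v + \<eta> v) \<in> ell2 V"
    "ell2_norm V (\<lambda>v. \<xi> v + \<eta> v) \<le> ell2_norm V \<xi> + ell2_norm V \<eta>"
    using ell2_bounded_partial_sums[OF _ bound] assms by (auto simp: ell2_off)
qed

lemma ell2_norm_scale [simp]: "ell2_norm V (\<lambda>v. c * \<xi> v) = cmod c * ell2_norm V \<xi>"
  by (simp add: ell2_norm_def norm_mult power_mult_distrib infsum_cmult_right' real_sqrt_mult)

lemma ell2_scale [simp]: "\<xi> \<in> ell2 V \<Longrightarrow> (\<lambda>v. c * \<xi> v) \<in> ell2 V"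
  by (simp add: ell2_def norm_mult power_mult_distrib summable_on_cmult_right)

lemma ell2_uminus [simp]: "\<xi> \<in> ell2 V \<Longrightarrow> (\<lambda>v. - \<xi> v) \<in> ell2 V"
  by (simp add: ell2_def)

lemma ell2_norm_uminus [simp]: "ell2_norm V (\<lambda>v. - \<xi> v) = ell2_norm V \<xi>"
  by (simp add: ell2_norm_def)

lemma ell2_diff:
  assumes "\<xi> \<in> ell2 V" "\<eta> \<in> ell2 V"
  shows [simp]: "(\<lambda>v. \<xi> v - \<eta> v) \<in> ell2 V"
    and "ell2_norm V (\<lambda>v. \<xi> v - \<eta> v) \<le> ell2_norm V \<xi> + ell2_norm V \<eta>"
  using ell2_add[OF assms(1) ell2_uminus[OF assms(2)]] by simp_all

lemma ell2_norm_minus_commute: "ell2_norm V (\<lambda>v. \<xi> v - \<eta> v) = ell2_norm V (\<lambda>v. \<eta> v - \<xi> v)"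
  by (simp add: ell2_norm_def norm_minus_commute)

lemma ell2_norm_triangle_diff:
  assumes "\<xi> \<in> ell2 V" "\<eta> \<in> ell2 V" "\<zeta> \<in> ell2 V"
  shows "ell2_norm V (\<lambda>v. \<xi> v - \<zeta> v)
         \<le> ell2_norm V (\<lambda>v. \<xi> v - \<eta> v) + ell2_norm V (\<lambda>v. \<eta> v - \<zeta> v)"
  using ell2_add(2)[of "\<lambda>v. \<xi> v - \<eta> v" V "\<lambda>v. \<eta> v - \<zeta> v"] assms by simp

lemma ell2_norm_le_add_diff:
  assumes "\<xi> \<in> ell2 V" "\<eta> \<in> ell2 V"
  shows "ell2_norm V \<xi> \<le> ell2_norm V \<eta> + ell2_norm V (\<lambda>v. \<xi> v - \<eta> v)"
  using ell2_add(2)[of \<eta> V "\<lambda>v. \<xi> v - \<eta> v"] assms by simp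

lemma ell2_zero [simp]: "(\<lambda>v. 0) \<in> ell2 V" and ell2_norm_zero [simp]: "ell2_norm V (\<lambda>v. 0) = 0"
  by (simp_all add: ell2_def ell2_norm_def)

lemma ell2_sum:
  assumes "\<And>i. i \<in> I \<Longrightarrow> \<xi> i \<in> ell2 V"
  shows [simp]: "(\<lambda>v. \<Sum>i\<in>I. \<xi> i v) \<in> ell2 V"
    and "ell2_norm V (\<lambda>v. \<Sum>i\<in>I. \<xi> i v) \<le> (\<Sum>i\<in>I. ell2_norm V (\<xi> i))"
proof -
  have "(\<lambda>v. \<Sum>i\<in>I. \<xi> i v) \<in> ell2 V \<and>
    ell2_norm V (\<lambda>v. \<Sum>i\<in>I. \<xi> i v) \<le> (\<Sum>i\<in>I. ell2_norm V (\<xi> i))"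
    using assms
  proof (induction I rule: infinite_finite_induct)
    case (insert i I)
    then have "\<xi> i \<in> ell2 V" "(\<lambda>v. \<Sum>i\<in>I. \<xi> i v) \<in> ell2 V"
      "ell2_norm V (\<lambda>v. \<Sum>i\<in>I. \<xi> i v) \<le> (\<Sum>i\<in>I. ell2_norm V (\<xi> i))" by auto
    then show ?case
      using insert.hyps ell2_add[of "\<xi> i" V "\<lambda>v. \<Sum>i\<in>I. \<xi> i v"] by simp
  qed auto
  then show "(\<lambda>v. \<Sum>i\<in>I. \<xi> i v) \<in> ell2 V"
    "ell2_norm V (\<lambda>v. \<Sum>i\<in>I. \<xi> i v) \<le> (\<Sum>i\<in>I. ell2_norm V (\<xi> i))" by auto
qed

lemma cmod_le_ell2_norm:
  assumes "\<xi> \<in> ell2 V"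
  shows "cmod (\<xi> v) \<le> ell2_norm V \<xi>"
proof (cases "v \<in> V")
  case True
  then show ?thesis using L2_set_le_ell2_norm[OF assms, of "{v}"] by simp
next
  case False
  then show ?thesis using ell2_off[OF assms] by simp
qed

lemma ell2_norm_eq_0: "\<xi> \<in> ell2 V \<Longrightarrow> ell2_norm V \<xi> = 0 \<Longrightarrow> \<xi> = (\<lambda>v. 0)"
  by (metis cmod_le_ell2_norm norm_le_zero_iff)

lemma ell2_eqI:
  assumes "\<xi> \<in> ell2 V" "\<eta> \<in> ell2 V" "ell2_norm V (\<lambda>v. \<xi> v - \<eta> v) \<le> 0"
  shows "\<xi> = \<eta>"
  using ell2_norm_eq_0[of "\<lambda>v. \<xi> v - \<eta> v" V] assms ell2_norm_nonneg[of V "\<lambda>v. \<xi> v - \<eta> v"]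
  by (auto simp: fun_eq_iff)

subsection \<open>Completeness\<close>

text \<open>Membership of the terms and of the limit in \<open>ell2 V\<close> is not built in; the
  lemmas that need it carry it as separate hypotheses.\<close>

definition ell2_converges :: "'a set \<Rightarrow> (nat \<Rightarrow> 'a \<Rightarrow> complex) \<Rightarrow> ('a \<Rightarrow> complex) \<Rightarrow> bool" where
  "ell2_converges V X \<xi> \<longleftrightarrow> (\<lambda>n. ell2_norm V (\<lambda>v. X n v - \<xi> v)) \<longlonglongrightarrow> 0"

text \<open>Every coordinate sequence is Cauchy, which yields a pointwise limit. On a finite subset
  the Cauchy bound survives letting one index tend to infinity, and since the resulting bound is
  uniform in the subset, it holds for the full norm.\<close>

lemma ell2_complete:
  assumes X: "\<And>n. X n \<in> ell2 V"
    and Cauchy: "\<And>e. e > 0 \<Longrightarrow> \<exists>M. \<forall>m\<ge>M. \<forall>n\<ge>M. ell2_norm V (\<lambda>v. X m v - X n v) \<le> e"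
  obtains \<xi> where "\<xi> \<in> ell2 V" "ell2_converges V X \<xi>"
proof -
  have "Cauchy (\<lambda>n. X n v)" for v
  proof (rule metric_CauchyI)
    fix e :: real assume "e > 0"
    then obtain M where M: "\<forall>m\<ge>M. \<forall>n\<ge>M. ell2_norm V (\<lambda>v. X m v - X n v) \<le> e/2"
      using Cauchy[of "e/2"] by auto
    show "\<exists>M. \<forall>m\<ge>M. \<forall>n\<ge>M. dist (X m v) (X n v) < e"
    proof (intro exI allI impI)
      fix m n assume mn: "M \<le> m" "M \<le> n"
      have "dist (X m v) (X n v) \<le> ell2_norm V (\<lambda>v. X m v - X n v)"
        using cmod_le_ell2_norm[of "\<lambda>v. X m v - X n v" V v] X by (simp add: dist_norm)
      also have "\<dots> < e" using M mn \<open>e > 0\<close> by fastforce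
      finally show "dist (X m v) (X n v) < e" .
    qed
  qed
  then have lim: "(\<lambda>n. X n v) \<longlonglongrightarrow> lim (\<lambda>n. X n v)" for v
    by (simp add: Cauchy_convergent_iff convergent_LIMSEQ_iff)
  define \<xi> where "\<xi> v = lim (\<lambda>n. X n v)" for v
  have \<xi>: "(\<lambda>n. X n v) \<longlonglongrightarrow> \<xi> v" for v using lim by (simp add: \<xi>_def)
  have off: "\<xi> v = 0" if "v \<notin> V" for v
    using \<xi>[of v] ell2_off[OF X that] by (simp add: LIMSEQ_const_iff)
  have near: "(\<lambda>v. X n v - \<xi> v) \<in> ell2 V \<and> ell2_norm V (\<lambda>v. X n v - \<xi> v) \<le> e"
    if M: "\<forall>m\<ge>M. \<forall>n\<ge>M. ell2_norm V (\<lambda>v. X m v - X n v) \<le> e" and n: "n \<ge> M" for e M n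
  proof -
    have "L2_set (\<lambda>v. cmod (X n v - \<xi> v)) F \<le> e" if F: "finite F" "F \<subseteq> V" for F
    proof (rule LIMSEQ_le_const2)
      show "(\<lambda>m. L2_set (\<lambda>v. cmod (X n v - X m v)) F) \<longlonglongrightarrow> L2_set (\<lambda>v. cmod (X n v - \<xi> v)) F"
        unfolding L2_set_def by (intro tendsto_intros \<xi>)
      show "\<exists>N. \<forall>m\<ge>N. L2_set (\<lambda>v. cmod (X n v - X m v)) F \<le> e"
        using L2_set_le_ell2_norm[OF ell2_diff(1)[OF X X] F] M n by (meson order_trans)
    qed
    moreover have "X n v - \<xi> v = 0" if "v \<notin> V" for v
      using off[OF that] ell2_off[OF X that] by simp
    ultimately show ?thesis
      using ell2_bounded_partial_sums[of V "\<lambda>v. X n v - \<xi> v" e] by blast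
  qed
  obtain M where "\<forall>m\<ge>M. \<forall>n\<ge>M. ell2_norm V (\<lambda>v. X m v - X n v) \<le> 1"
    using Cauchy[of 1] by auto
  from near[OF this order_refl] have "(\<lambda>v. X M v - \<xi> v) \<in> ell2 V" by simp
  from ell2_diff(1)[OF X[of M] this] have \<xi>_in: "\<xi> \<in> ell2 V" by simp
  have "ell2_converges V X \<xi>"
    unfolding ell2_converges_def
  proof (rule LIMSEQ_I)
    fix e :: real assume "e > 0"
    then obtain M where "\<forall>m\<ge>M. \<forall>n\<ge>M. ell2_norm V (\<lambda>v. X m v - X n v) \<le> e/2"
      using Cauchy[of "e/2"] by auto
    from near[OF this] have "\<forall>n\<ge>M. ell2_norm V (\<lambda>v. X n v - \<xi> v) < e"
      using \<open>e > 0\<close> by fastforce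
    then show "\<exists>no. \<forall>n\<ge>no. norm (ell2_norm V (\<lambda>v. X n v - \<xi> v) - 0) < e" by auto
  qed
  with \<xi>_in show ?thesis by (rule that)
qed

section \<open>Limits in norm and the contraction principle\<close>

lemma ell2_converges_le:
  assumes "\<And>n. ell2_norm V (\<lambda>v. X n v - \<xi> v) \<le> b n" "b \<longlonglongrightarrow> 0"
  shows "ell2_converges V X \<xi>"
  unfolding ell2_converges_def
  by (rule tendsto_sandwich[OF _ _ tendsto_const assms(2)]) (auto simp: assms(1))

lemma ell2_converges_unique:
  assumes "ell2_converges V X \<xi>" "ell2_converges V X \<eta>"
    and "\<And>n. X n \<in> ell2 V" "\<xi> \<in> ell2 V" "\<eta> \<in> ell2 V"
  shows "\<xi> = \<eta>"
proof (rule ell2_eqI)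
  have "(\<lambda>n. ell2_norm V (\<lambda>v. X n v - \<xi> v) + ell2_norm V (\<lambda>v. X n v - \<eta> v)) \<longlonglongrightarrow> 0 + 0"
    using assms(1,2) unfolding ell2_converges_def by (rule tendsto_add)
  moreover have "ell2_norm V (\<lambda>v. \<xi> v - \<eta> v)
      \<le> ell2_norm V (\<lambda>v. X n v - \<xi> v) + ell2_norm V (\<lambda>v. X n v - \<eta> v)" for n
    using ell2_norm_triangle_diff[OF assms(4,3,5), of n] by (simp add: ell2_norm_minus_commute)
  ultimately show "ell2_norm V (\<lambda>v. \<xi> v - \<eta> v) \<le> 0"
    using LIMSEQ_le_const by fastforce
qed (use assms in auto)

lemma ell2_converges_add:
  assumes "ell2_converges V X \<xi>" "ell2_converges V Y \<eta>"
    and "\<And>n. X n \<in> ell2 V" "\<And>n. Y n \<in> ell2 V" "\<xi> \<in> ell2 V" "\<eta> \<in> ell2 V"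
  shows "ell2_converges V (\<lambda>n v. X n v + Y n v) (\<lambda>v. \<xi> v + \<eta> v)"
proof (rule ell2_converges_le)
  fix n
  show "ell2_norm V (\<lambda>v. X n v + Y n v - (\<xi> v + \<eta> v))
    \<le> ell2_norm V (\<lambda>v. X n v - \<xi> v) + ell2_norm V (\<lambda>v. Y n v - \<eta> v)"
    using ell2_add(2)[of "\<lambda>v. X n v - \<xi> v" V "\<lambda>v. Y n v - \<eta> v"] assms(3-6)
    by (simp add: algebra_simps)
  show "(\<lambda>n. ell2_norm V (\<lambda>v. X n v - \<xi> v) + ell2_norm V (\<lambda>v. Y n v - \<eta> v)) \<longlonglongrightarrow> 0"
    using tendsto_add[of _ 0 _ _ 0] assms(1,2) unfolding ell2_converges_def by fastforce
qed

lemma ell2_converges_scale: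
  assumes "ell2_converges V X \<xi>"
  shows "ell2_converges V (\<lambda>n v. c * X n v) (\<lambda>v. c * \<xi> v)"
  using tendsto_mult_right_zero[of _ _ "cmod c"] assms
  unfolding ell2_converges_def by (simp flip: right_diff_distrib)

lemma ell2_converges_norm:
  assumes "ell2_converges V X \<xi>" "\<And>n. X n \<in> ell2 V" "\<xi> \<in> ell2 V"
  shows "(\<lambda>n. ell2_norm V (X n)) \<longlonglongrightarrow> ell2_norm V \<xi>"
proof (rule LIM_zero_cancel, rule Lim_null_comparison)
  have "\<bar>ell2_norm V (X n) - ell2_norm V \<xi>\<bar> \<le> ell2_norm V (\<lambda>v. X n v - \<xi> v)" for n
    using ell2_norm_le_add_diff[OF assms(2)[of n] assms(3)]
      ell2_norm_le_add_diff[OF assms(3) assms(2)[of n]] ell2_norm_minus_commute[of V "X n" \<xi>]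
    by linarith
  then show "\<forall>\<^sub>F n in sequentially. norm (ell2_norm V (X n) - ell2_norm V \<xi>)
      \<le> ell2_norm V (\<lambda>v. X n v - \<xi> v)" by simp
qed (use assms in \<open>simp add: ell2_converges_def\<close>)

text \<open>Plays the role of the Neumann series: surjectivity of A - z is obtained by writing the
  equation to be solved as a fixed-point equation.\<close>

lemma ell2_contraction_fixed_point:
  assumes F: "\<And>\<xi>. \<xi> \<in> ell2 V \<Longrightarrow> F \<xi> \<in> ell2 V"
    and q: "0 \<le> q" "q < 1"
    and contr: "\<And>\<xi> \<eta>. \<xi> \<in> ell2 V \<Longrightarrow> \<eta> \<in> ell2 V \<Longrightarrow>
      ell2_norm V (\<lambda>v. F \<xi> v - F \<eta> v) \<le> q * ell2_norm V (\<lambda>v. \<xi> v - \<eta> v)"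
  obtains \<xi> where "\<xi> \<in> ell2 V" "F \<xi> = \<xi>"
proof -
  interpret M: Metric_space "ell2 V" "\<lambda>\<xi> \<eta>. ell2_norm V (\<lambda>v. \<xi> v - \<eta> v)"
  proof
    fix \<xi> \<eta> assume "\<xi> \<in> ell2 V" "\<eta> \<in> ell2 V"
    then show "(ell2_norm V (\<lambda>v. \<xi> v - \<eta> v) = 0) = (\<xi> = \<eta>)"
      using ell2_eqI[of \<xi> V \<eta>] by auto
  qed (auto simp: ell2_norm_triangle_diff intro: ell2_norm_minus_commute)
  have "M.mcomplete"
    unfolding M.mcomplete_def
  proof (intro allI impI)
    fix X assume X: "M.MCauchy X"
    then have in_H: "X n \<in> ell2 V" for n by (auto simp: M.MCauchy_def)
    have "\<exists>M. \<forall>m\<ge>M. \<forall>n\<ge>M. ell2_norm V (\<lambda>v. X m v - X n v) \<le> e" if "e > 0" for e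
      using X that unfolding M.MCauchy_def by (meson less_imp_le)
    from ell2_complete[OF in_H this] obtain \<xi> where \<xi>: "\<xi> \<in> ell2 V" "ell2_converges V X \<xi>"
      by blast
    then have "limitin M.mtopology X \<xi> sequentially"
      unfolding M.limitin_metric_dist_null ell2_converges_def using in_H by simp
    then show "\<exists>\<xi>. limitin M.mtopology X \<xi> sequentially" by blast
  qed
  moreover have "ell2 V \<noteq> {}" using ell2_zero by blast
  ultimately show ?thesis
    using M.Banach_fixedpoint_thm[of F q] F q contr that by blast
qed

subsection \<open>The inner product\<close>

lemma ell2_inner_abs_summable:
  assumes "\<xi> \<in> ell2 V" "\<eta> \<in> ell2 V"
  shows "(\<lambda>v. cmod (\<xi> v * cnj (\<eta> v))) summable_on V"
proof (rule abs_summable_product)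
  show "(\<lambda>i. cmod (\<xi> i * \<xi> i)) summable_on V"
    using assms(1) by (simp add: ell2_def norm_mult power2_eq_square)
  show "(\<lambda>i. cmod (cnj (\<eta> i) * cnj (\<eta> i))) summable_on V"
    using assms(2) by (simp add: ell2_def norm_mult power2_eq_square)
qed

lemma ell2_inner_add_left:
  assumes "\<xi> \<in> ell2 V" "\<eta> \<in> ell2 V" "\<zeta> \<in> ell2 V"
  shows "ell2_inner V (\<lambda>v. \<xi> v + \<eta> v) \<zeta> = ell2_inner V \<xi> \<zeta> + ell2_inner V \<eta> \<zeta>"
  unfolding ell2_inner_def
  by (simp add: distrib_right infsum_add abs_summable_summable ell2_inner_abs_summable assms)

lemma ell2_inner_scale_left: "ell2_inner V (\<lambda>v. c * \<xi> v) \<eta> = c * ell2_inner V \<xi> \<eta>"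
  unfolding ell2_inner_def by (simp add: mult.assoc infsum_cmult_right')

lemma ell2_inner_commute: "ell2_inner V \<eta> \<xi> = cnj (ell2_inner V \<xi> \<eta>)"
  unfolding ell2_inner_def by (simp add: mult.commute flip: infsum_cnj)

lemma ell2_inner_diff_left:
  assumes "\<xi> \<in> ell2 V" "\<eta> \<in> ell2 V" "\<zeta> \<in> ell2 V"
  shows "ell2_inner V (\<lambda>v. \<xi> v - \<eta> v) \<zeta> = ell2_inner V \<xi> \<zeta> - ell2_inner V \<eta> \<zeta>"
  using ell2_inner_add_left[of \<xi> V "\<lambda>v. -1 * \<eta> v" \<zeta>] ell2_inner_scale_left[of V "-1" \<eta> \<zeta>] assms
  by simp

lemma ell2_inner_add_right:
  assumes "\<xi> \<in> ell2 V" "\<eta> \<in> ell2 V" "\<zeta> \<in> ell2 V"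
  shows "ell2_inner V \<zeta> (\<lambda>v. \<xi> v + \<eta> v) = ell2_inner V \<zeta> \<xi> + ell2_inner V \<zeta> \<eta>"
  using ell2_inner_add_left[OF assms]
  by (simp add: ell2_inner_commute[of V _ \<zeta>] flip: complex_cnj_add)

lemma ell2_inner_diff_right:
  assumes "\<xi> \<in> ell2 V" "\<eta> \<in> ell2 V" "\<zeta> \<in> ell2 V"
  shows "ell2_inner V \<zeta> (\<lambda>v. \<xi> v - \<eta> v) = ell2_inner V \<zeta> \<xi> - ell2_inner V \<zeta> \<eta>"
  using ell2_inner_diff_left[OF assms]
  by (simp add: ell2_inner_commute[of V _ \<zeta>] flip: complex_cnj_diff)

lemma ell2_inner_scale_right: "ell2_inner V \<xi> (\<lambda>v. c * \<eta> v) = cnj c * ell2_inner V \<xi> \<eta>"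
  using ell2_inner_scale_left[of V c \<eta> \<xi>]
  by (metis complex_cnj_mult ell2_inner_commute)

lemma ell2_inner_zero_right [simp]: "ell2_inner V \<xi> (\<lambda>v. 0) = 0"
  by (simp add: ell2_inner_def)

lemma ell2_inner_sum_right:
  assumes "\<xi> \<in> ell2 V" "\<And>i. i \<in> I \<Longrightarrow> \<eta> i \<in> ell2 V"
  shows "ell2_inner V \<xi> (\<lambda>v. \<Sum>i\<in>I. \<eta> i v) = (\<Sum>i\<in>I. ell2_inner V \<xi> (\<eta> i))"
  using assms
  by (induction I rule: infinite_finite_induct) (auto simp: ell2_inner_add_right)

lemma ell2_inner_self:
  assumes "\<xi> \<in> ell2 V"
  shows "ell2_inner V \<xi> \<xi> = of_real ((ell2_norm V \<xi>)\<^sup>2)"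
proof -
  have "(\<lambda>v. (cmod (\<xi> v))\<^sup>2) summable_on V" using assms by (simp add: ell2_def)
  then have "((\<lambda>v. complex_of_real ((cmod (\<xi> v))\<^sup>2)) has_sum of_real ((ell2_norm V \<xi>)\<^sup>2)) V"
    unfolding ell2_norm_square by (intro has_sum_of_real has_sum_infsum)
  then show ?thesis
    unfolding ell2_inner_def complex_norm_square by (rule infsumI)
qed

lemma ell2_Cauchy_Schwarz:
  assumes "\<xi> \<in> ell2 V" "\<eta> \<in> ell2 V"
  shows "cmod (ell2_inner V \<xi> \<eta>) \<le> ell2_norm V \<xi> * ell2_norm V \<eta>"
proof -
  have "cmod (ell2_inner V \<xi> \<eta>) \<le> (\<Sum>\<^sub>\<infinity>v\<in>V. cmod (\<xi> v * cnj (\<eta> v)))"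
    unfolding ell2_inner_def using ell2_inner_abs_summable[OF assms] by (rule norm_infsum_bound)
  also have "\<dots> \<le> ell2_norm V \<xi> * ell2_norm V \<eta>"
  proof (rule infsum_le_finite_sums)
    fix F assume F: "finite F" "F \<subseteq> V"
    have "(\<Sum>v\<in>F. cmod (\<xi> v * cnj (\<eta> v))) = (\<Sum>v\<in>F. \<bar>cmod (\<xi> v)\<bar> * \<bar>cmod (\<eta> v)\<bar>)"
      by (simp add: norm_mult)
    also have "\<dots> \<le> L2_set (\<lambda>v. cmod (\<xi> v)) F * L2_set (\<lambda>v. cmod (\<eta> v)) F"
      by (rule L2_set_mult_ineq)
    also have "\<dots> \<le> ell2_norm V \<xi> * ell2_norm V \<eta>"
      by (intro mult_mono L2_set_le_ell2_norm assms F) auto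
    finally show "(\<Sum>v\<in>F. cmod (\<xi> v * cnj (\<eta> v))) \<le> ell2_norm V \<xi> * ell2_norm V \<eta>" .
  qed (rule ell2_inner_abs_summable[OF assms])
  finally show ?thesis .
qed

lemma ell2_norm_diff_square:
  assumes "\<xi> \<in> ell2 V" "\<eta> \<in> ell2 V"
  shows "(ell2_norm V (\<lambda>v. \<xi> v - \<eta> v))\<^sup>2
    = (ell2_norm V \<xi>)\<^sup>2 - 2 * Re (ell2_inner V \<xi> \<eta>) + (ell2_norm V \<eta>)\<^sup>2"
proof -
  have "complex_of_real ((ell2_norm V (\<lambda>v. \<xi> v - \<eta> v))\<^sup>2)
    = ell2_inner V (\<lambda>v. \<xi> v - \<eta> v) (\<lambda>v. \<xi> v - \<eta> v)"
    using assms by (subst ell2_inner_self) auto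
  also have "\<dots> = ell2_inner V \<xi> \<xi> - ell2_inner V \<eta> \<xi> - (ell2_inner V \<xi> \<eta> - ell2_inner V \<eta> \<eta>)"
    using assms by (simp add: ell2_inner_diff_right ell2_inner_diff_left)
  also have "\<dots> = of_real ((ell2_norm V \<xi>)\<^sup>2) - cnj (ell2_inner V \<xi> \<eta>) - ell2_inner V \<xi> \<eta>
      + of_real ((ell2_norm V \<eta>)\<^sup>2)"
    using assms by (simp add: ell2_inner_self ell2_inner_commute[of V \<eta> \<xi>])
  finally have "Re (complex_of_real ((ell2_norm V (\<lambda>v. \<xi> v - \<eta> v))\<^sup>2)) = Re \<dots>" by (rule arg_cong)
  then show ?thesis by (simp del: of_real_power)
qed

lemma ell2_converges_inner:
  assumes "ell2_converges V X \<xi>" "\<And>n. X n \<in> ell2 V" "\<xi> \<in> ell2 V" "\<eta> \<in> ell2 V"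
  shows "(\<lambda>n. ell2_inner V (X n) \<eta>) \<longlonglongrightarrow> ell2_inner V \<xi> \<eta>"
proof (rule LIM_zero_cancel, rule Lim_null_comparison)
  have "cmod (ell2_inner V (X n) \<eta> - ell2_inner V \<xi> \<eta>)
    \<le> ell2_norm V (\<lambda>v. X n v - \<xi> v) * ell2_norm V \<eta>" for n
    using ell2_Cauchy_Schwarz[of "\<lambda>v. X n v - \<xi> v" V \<eta>] assms by (simp add: ell2_inner_diff_left)
  then show "\<forall>\<^sub>F n in sequentially. norm (ell2_inner V (X n) \<eta> - ell2_inner V \<xi> \<eta>)
      \<le> ell2_norm V (\<lambda>v. X n v - \<xi> v) * ell2_norm V \<eta>" by simp
  show "(\<lambda>n. ell2_norm V (\<lambda>v. X n v - \<xi> v) * ell2_norm V \<eta>) \<longlonglongrightarrow> 0"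
    using assms(1) unfolding ell2_converges_def by (rule tendsto_mult_left_zero)
qed

subsection \<open>Finitely supported functions\<close>

lemma delta_in_ell2 [simp]: "u \<in> V \<Longrightarrow> delta u \<in> ell2 V"
  and ell2_norm_delta [simp]: "u \<in> V \<Longrightarrow> ell2_norm V (delta u) = 1"
proof -
  assume u: "u \<in> V"
  have eq: "(\<lambda>v. (cmod (delta u v))\<^sup>2) = (\<lambda>v. if v = u then 1 else 0)"
    by (auto simp: delta_def)
  have "((\<lambda>v. if v = u then 1 else 0::real) has_sum 1) V"
    using u has_sum_finite[of "{u}" "\<lambda>_. 1::real"]
    by (subst has_sum_cong_neutral[where T = "{u}" and g = "\<lambda>_. 1"]) auto
  then show "delta u \<in> ell2 V" "ell2_norm V (delta u) = 1"
    using u has_sum_imp_summable unfolding ell2_def ell2_norm_def mem_Collect_eq eq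
    by (auto simp: infsumI delta_def)
qed

lemma ell2_inner_delta:
  assumes "u \<in> V"
  shows "ell2_inner V \<xi> (delta u) = \<xi> u"
proof -
  have "ell2_inner V \<xi> (delta u) = (\<Sum>\<^sub>\<infinity>v\<in>{u}. \<xi> v)"
    unfolding ell2_inner_def using assms
    by (intro infsum_cong_neutral) (auto simp: delta_def)
  then show ?thesis by simp
qed

text \<open>The squared norm of the error is the sum of the squares outside \<open>F\<close>, a tail
  of a convergent sum.\<close>

lemma ell2_finite_support_dense:
  assumes "\<xi> \<in> ell2 V" "e > 0"
  obtains F where "finite F" "F \<subseteq> V" "ell2_norm V (\<lambda>v. \<xi> v - (\<Sum>u\<in>F. \<xi> u * delta u v)) < e"
proof -
  have summ: "(\<lambda>v. (cmod (\<xi> v))\<^sup>2) summable_on V" using assms(1) by (simp add: ell2_def)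
  \<comment> \<open>The approximation theorem gives a non-strict bound; halving
    \<open>e\<^sup>2\<close> makes the final one strict.\<close>
  obtain F where F: "finite F" "F \<subseteq> V"
    and near: "dist (\<Sum>v\<in>F. (cmod (\<xi> v))\<^sup>2) (\<Sum>\<^sub>\<infinity>v\<in>V. (cmod (\<xi> v))\<^sup>2) \<le> e\<^sup>2 / 2"
    using infsum_finite_approximation[OF summ, of "e\<^sup>2 / 2"] assms(2) by auto
  have F_sum: "(\<Sum>u\<in>F. \<xi> u * delta u v) = (if v \<in> F then \<xi> v else 0)" for v
    using F(1) by (simp add: delta_def mult_delta_right if_distrib cong: if_cong)
  have "(ell2_norm V (\<lambda>v. \<xi> v - (\<Sum>u\<in>F. \<xi> u * delta u v)))\<^sup>2
    = (\<Sum>\<^sub>\<infinity>v\<in>V - F. (cmod (\<xi> v))\<^sup>2)"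
    unfolding ell2_norm_square F_sum using F by (intro infsum_cong_neutral) auto
  also have "\<dots> = (\<Sum>\<^sub>\<infinity>v\<in>V. (cmod (\<xi> v))\<^sup>2) - (\<Sum>v\<in>F. (cmod (\<xi> v))\<^sup>2)"
    using infsum_Un_disjoint[of "\<lambda>v. (cmod (\<xi> v))\<^sup>2" F "V - F"] F
      summable_on_subset_banach[OF summ, of "V - F"] by (simp add: Un_absorb1)
  also have "\<dots> < e\<^sup>2"
    using near zero_less_power[OF assms(2), of 2] unfolding dist_real_def by linarith
  finally have "ell2_norm V (\<lambda>v. \<xi> v - (\<Sum>u\<in>F. \<xi> u * delta u v)) < e"
    using assms(2) by (simp add: power_less_imp_less_base)
  with F show ?thesis by (rule that)
qed

section \<open>Bounded operators and their spectra\<close>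

lemma bounded_operator_in: "bounded_operator V T \<Longrightarrow> \<xi> \<in> ell2 V \<Longrightarrow> T \<xi> \<in> ell2 V"
  by (simp add: bounded_operator_def)

lemma bounded_operator_add:
  "bounded_operator V T \<Longrightarrow> \<xi> \<in> ell2 V \<Longrightarrow> \<eta> \<in> ell2 V \<Longrightarrow>
    T (\<lambda>v. \<xi> v + \<eta> v) = (\<lambda>v. T \<xi> v + T \<eta> v)"
  by (simp add: bounded_operator_def)

lemma bounded_operator_scale:
  "bounded_operator V T \<Longrightarrow> \<xi> \<in> ell2 V \<Longrightarrow> T (\<lambda>v. c * \<xi> v) = (\<lambda>v. c * T \<xi> v)"
  by (simp add: bounded_operator_def)

lemma bounded_operator_diff:
  assumes "bounded_operator V T" "\<xi> \<in> ell2 V" "\<eta> \<in> ell2 V"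
  shows "T (\<lambda>v. \<xi> v - \<eta> v) = (\<lambda>v. T \<xi> v - T \<eta> v)"
  using bounded_operator_add[OF assms(1,2), of "\<lambda>v. -1 * \<eta> v"]
    bounded_operator_scale[OF assms(1,3), of "-1"] assms(3) by simp

lemma bounded_operator_zero: "bounded_operator V T \<Longrightarrow> T (\<lambda>v. 0) = (\<lambda>v. 0)"
  using bounded_operator_scale[of V T "\<lambda>v. 0" 0] by simp

lemma bounded_operator_sum:
  assumes "bounded_operator V T" "\<And>i. i \<in> I \<Longrightarrow> \<xi> i \<in> ell2 V"
  shows "T (\<lambda>v. \<Sum>i\<in>I. \<xi> i v) = (\<lambda>v. \<Sum>i\<in>I. T (\<xi> i) v)"
  using assms(2)
  by (induction I rule: infinite_finite_induct)
     (auto simp: bounded_operator_zero[OF assms(1)] bounded_operator_add[OF assms(1)])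

lemma bounded_operator_bounded:
  assumes "bounded_operator V T"
  obtains C where "0 \<le> C" "\<And>\<xi>. \<xi> \<in> ell2 V \<Longrightarrow> ell2_norm V (T \<xi>) \<le> C * ell2_norm V \<xi>"
proof -
  obtain C where C: "\<And>\<xi>. \<xi> \<in> ell2 V \<Longrightarrow> ell2_norm V (T \<xi>) \<le> C * ell2_norm V \<xi>"
    using assms unfolding bounded_operator_def by blast
  show ?thesis
  proof (rule that[of "\<bar>C\<bar>"])
    fix \<xi> assume "\<xi> \<in> ell2 V"
    from C[OF this] show "ell2_norm V (T \<xi>) \<le> \<bar>C\<bar> * ell2_norm V \<xi>"
      by (rule order_trans) (simp add: mult_right_mono)
  qed simp
qed

section \<open>The operator norm and the stability of regular points\<close>

lemma operator_norm_le:
  assumes "0 \<le> C" "\<And>\<xi>. \<xi> \<in> ell2 V \<Longrightarrow> ell2_norm V (T \<xi>) \<le> C * ell2_norm V \<xi>"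
  shows "operator_norm V T \<le> C"
  unfolding operator_norm_def
proof (rule cSUP_least)
  show "{\<xi> \<in> ell2 V. ell2_norm V \<xi> \<le> 1} \<noteq> {}" by (auto intro!: exI[of _ "\<lambda>v. 0"])
  fix \<xi> assume "\<xi> \<in> {\<xi> \<in> ell2 V. ell2_norm V \<xi> \<le> 1}"
  then show "ell2_norm V (T \<xi>) \<le> C"
    using assms(2)[of \<xi>] mult_left_mono[of "ell2_norm V \<xi>" 1 C] assms(1) by auto
qed

text \<open>\<open>operator_norm\<close> is a supremum of reals, so it controls the values only if
  these are bounded above, which is what boundedness of \<open>T\<close> supplies. Rescaling a
  nonzero vector to norm one then gives the homogeneous estimate.\<close>

lemma
  assumes "bounded_operator V T"
  shows operator_norm_nonneg: "0 \<le> operator_norm V T"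
    and operator_norm_bound: "\<xi> \<in> ell2 V \<Longrightarrow> ell2_norm V (T \<xi>) \<le> operator_norm V T * ell2_norm V \<xi>"
proof -
  let ?U = "{\<xi> \<in> ell2 V. ell2_norm V \<xi> \<le> 1}"
  obtain C where C: "0 \<le> C" "\<And>\<xi>. \<xi> \<in> ell2 V \<Longrightarrow> ell2_norm V (T \<xi>) \<le> C * ell2_norm V \<xi>"
    using assms by (rule bounded_operator_bounded) blast
  have "bdd_above ((\<lambda>\<xi>. ell2_norm V (T \<xi>)) ` ?U)"
  proof (rule bdd_aboveI2)
    fix \<xi> assume "\<xi> \<in> ?U"
    then show "ell2_norm V (T \<xi>) \<le> C"
      using C(2)[of \<xi>] mult_left_mono[of "ell2_norm V \<xi>" 1 C] C(1) by auto
  qed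
  then have upper: "ell2_norm V (T \<xi>) \<le> operator_norm V T" if "\<xi> \<in> ?U" for \<xi>
    unfolding operator_norm_def using that by (rule cSUP_upper2[OF _ _ order_refl])
  from upper[of "\<lambda>v. 0"] show "0 \<le> operator_norm V T"
    using ell2_norm_nonneg[of V "T (\<lambda>v. 0)"] by (simp del: ell2_norm_nonneg)
  assume \<xi>: "\<xi> \<in> ell2 V"
  show "ell2_norm V (T \<xi>) \<le> operator_norm V T * ell2_norm V \<xi>"
  proof (cases "ell2_norm V \<xi> = 0")
    case True
    then show ?thesis using C(2)[OF \<xi>] by simp
  next
    case False
    define c where "c = complex_of_real (1 / ell2_norm V \<xi>)"
    have c: "cmod c = 1 / ell2_norm V \<xi>" by (simp add: c_def norm_divide)
    have "ell2_norm V (T (\<lambda>v. c * \<xi> v)) \<le> operator_norm V T"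
      using \<xi> False by (intro upper) (simp add: c)
    then show ?thesis
      using False by (simp add: bounded_operator_scale[OF assms \<xi>] c field_simps less_le)
  qed
qed

text \<open>Splits invertibility of A - z into two properties that can be proved separately: a lower
  bound, which gives injectivity and the bound on the inverse, and surjectivity.\<close>

lemma not_in_spectrum_iff:
  assumes A: "bounded_operator V A"
  shows "z \<notin> spectrum V A \<longleftrightarrow>
    (\<exists>c\<ge>0. \<forall>\<xi>\<in>ell2 V. ell2_norm V \<xi> \<le> c * ell2_norm V (\<lambda>v. A \<xi> v - z * \<xi> v)) \<and>
    (\<forall>\<eta>\<in>ell2 V. \<exists>\<xi>\<in>ell2 V. (\<lambda>v. A \<xi> v - z * \<xi> v) = \<eta>)" (is "_ \<longleftrightarrow> ?below \<and> ?surj")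
proof
  let ?T = "\<lambda>\<xi> v. A \<xi> v - z * \<xi> v"
  have T_in: "?T \<xi> \<in> ell2 V" if "\<xi> \<in> ell2 V" for \<xi>
    using bounded_operator_in[OF A that] that by simp
  assume "z \<notin> spectrum V A"
  then obtain B where B: "bounded_operator V B"
    and left: "\<And>\<xi>. \<xi> \<in> ell2 V \<Longrightarrow> B (?T \<xi>) = \<xi>" and right: "\<And>\<xi>. \<xi> \<in> ell2 V \<Longrightarrow> ?T (B \<xi>) = \<xi>"
    by (auto simp: spectrum_def)
  have "ell2_norm V \<xi> \<le> operator_norm V B * ell2_norm V (?T \<xi>)" if "\<xi> \<in> ell2 V" for \<xi>
    using operator_norm_bound[OF B T_in[OF that]] left[OF that] by simp
  then have ?below using operator_norm_nonneg[OF B] by blast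
  moreover have ?surj using right bounded_operator_in[OF B] by blast
  ultimately show "?below \<and> ?surj" ..
next
  let ?T = "\<lambda>\<xi> v. A \<xi> v - z * \<xi> v"
  assume "?below \<and> ?surj"
  then obtain c where c: "0 \<le> c"
      "\<And>\<xi>. \<xi> \<in> ell2 V \<Longrightarrow> ell2_norm V \<xi> \<le> c * ell2_norm V (?T \<xi>)"
    and surj: "\<And>\<eta>. \<eta> \<in> ell2 V \<Longrightarrow> \<exists>\<xi>. \<xi> \<in> ell2 V \<and> ?T \<xi> = \<eta>" by blast
  have T_diff: "?T (\<lambda>v. \<xi> v - \<eta> v) = (\<lambda>v. ?T \<xi> v - ?T \<eta> v)"
    and T_add: "?T (\<lambda>v. \<xi> v + \<eta> v) = (\<lambda>v. ?T \<xi> v + ?T \<eta> v)"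
    if "\<xi> \<in> ell2 V" "\<eta> \<in> ell2 V" for \<xi> \<eta>
    using that by (auto simp: bounded_operator_diff[OF A] bounded_operator_add[OF A] algebra_simps)
  have T_scale: "?T (\<lambda>v. k * \<xi> v) = (\<lambda>v. k * ?T \<xi> v)" if "\<xi> \<in> ell2 V" for k \<xi>
    using that by (auto simp: bounded_operator_scale[OF A] algebra_simps)
  have inj: "\<xi> = \<eta>" if "\<xi> \<in> ell2 V" "\<eta> \<in> ell2 V" "?T \<xi> = ?T \<eta>" for \<xi> \<eta>
  proof (rule ell2_eqI[OF that(1,2)])
    have "?T (\<lambda>v. \<xi> v - \<eta> v) = (\<lambda>v. 0)"
      using that(3) unfolding T_diff[OF that(1,2)] fun_eq_iff by simp
    then show "ell2_norm V (\<lambda>v. \<xi> v - \<eta> v) \<le> 0"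
      using c(2)[OF ell2_diff(1)[OF that(1,2)]] by simp
  qed
  \<comment> \<open>Preimages are unique by \<open>inj\<close>, so this arbitrary choice is linear:
    both sides of each linearity equation have the same image under A - z.\<close>
  define B where "B \<eta> = (SOME \<xi>. \<xi> \<in> ell2 V \<and> ?T \<xi> = \<eta>)" for \<eta>
  have B: "B \<eta> \<in> ell2 V" "?T (B \<eta>) = \<eta>" if "\<eta> \<in> ell2 V" for \<eta>
    using someI_ex[OF surj[OF that]] unfolding B_def by auto
  have T_in: "?T \<xi> \<in> ell2 V" if "\<xi> \<in> ell2 V" for \<xi>
    using bounded_operator_in[OF A that] that by simp
  have "bounded_operator V B"
    unfolding bounded_operator_def
  proof (intro conjI ballI allI exI[of _ c])
    fix \<xi> assume \<xi>: "\<xi> \<in> ell2 V"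
    show "B \<xi> \<in> ell2 V" using B(1)[OF \<xi>] .
    show "ell2_norm V (B \<xi>) \<le> c * ell2_norm V \<xi>" using c(2)[OF B(1)[OF \<xi>]] B(2)[OF \<xi>] by simp
    show "B (\<lambda>v. k * \<xi> v) = (\<lambda>v. k * B \<xi> v)" for k
    proof (rule inj)
      have "?T (\<lambda>v. k * B \<xi> v) = (\<lambda>v. k * \<xi> v)"
        unfolding T_scale[OF B(1)[OF \<xi>]] using B(2)[OF \<xi>] by metis
      then show "?T (B (\<lambda>v. k * \<xi> v)) = ?T (\<lambda>v. k * B \<xi> v)" using B(2) \<xi> by simp
    qed (use B \<xi> in auto)
    fix \<eta> assume \<eta>: "\<eta> \<in> ell2 V"
    show "B (\<lambda>v. \<xi> v + \<eta> v) = (\<lambda>v. B \<xi> v + B \<eta> v)"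
    proof (rule inj)
      have "?T (\<lambda>v. B \<xi> v + B \<eta> v) = (\<lambda>v. \<xi> v + \<eta> v)"
        unfolding T_add[OF B(1)[OF \<xi>] B(1)[OF \<eta>]] using B(2)[OF \<xi>] B(2)[OF \<eta>] by metis
      then show "?T (B (\<lambda>v. \<xi> v + \<eta> v)) = ?T (\<lambda>v. B \<xi> v + B \<eta> v)" using B(2) \<xi> \<eta> by simp
    qed (use B \<xi> \<eta> in auto)
  qed
  moreover have "B (?T \<xi>) = \<xi>" if "\<xi> \<in> ell2 V" for \<xi>
    using inj[OF B(1) that] B(2) T_in[OF that] by blast
  ultimately show "z \<notin> spectrum V A"
    unfolding spectrum_def using B(2) by blast
qed

text \<open>The constant \<open>c\<close> of the lower bound also bounds the inverse
  \<open>B\<close> of A - z. Passing from z to w costs the factor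
  \<open>1 - c * cmod (w - z)\<close> in the lower bound, and (A - w) xi = eta becomes xi = B (eta +
  (w - z) xi), a contraction with factor \<open>c * cmod (w - z)\<close>. The constant is kept
  explicit because its size decides how far z may be moved.\<close>

lemma not_in_spectrum_near:
  assumes A: "bounded_operator V A"
    and below: "\<And>\<xi>. \<xi> \<in> ell2 V \<Longrightarrow> ell2_norm V \<xi> \<le> c * ell2_norm V (\<lambda>v. A \<xi> v - z * \<xi> v)"
    and "0 \<le> c" and z: "z \<notin> spectrum V A" and near: "c * cmod (w - z) < 1"
  shows "w \<notin> spectrum V A"
  unfolding not_in_spectrum_iff[OF A]
proof
  let ?q = "c * cmod (w - z)"
  have A_in: "A \<xi> \<in> ell2 V" if "\<xi> \<in> ell2 V" for \<xi> using bounded_operator_in[OF A that] .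
  have "ell2_norm V \<xi> \<le> c / (1 - ?q) * ell2_norm V (\<lambda>v. A \<xi> v - w * \<xi> v)" if \<xi>: "\<xi> \<in> ell2 V" for \<xi>
  proof -
    have "ell2_norm V (\<lambda>v. A \<xi> v - z * \<xi> v)
      \<le> ell2_norm V (\<lambda>v. A \<xi> v - w * \<xi> v) + ell2_norm V (\<lambda>v. (w - z) * \<xi> v)"
      using ell2_add(2)[of "\<lambda>v. A \<xi> v - w * \<xi> v" V "\<lambda>v. (w - z) * \<xi> v"] A_in[OF \<xi>] \<xi>
      by (simp add: left_diff_distrib)
    from mult_left_mono[OF this \<open>0 \<le> c\<close>] below[OF \<xi>]
    have "ell2_norm V \<xi> \<le> c * ell2_norm V (\<lambda>v. A \<xi> v - w * \<xi> v) + ?q * ell2_norm V \<xi>"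
      unfolding ell2_norm_scale by (simp add: distrib_left mult.assoc)
    then have "(1 - ?q) * ell2_norm V \<xi> \<le> c * ell2_norm V (\<lambda>v. A \<xi> v - w * \<xi> v)"
      by (simp add: left_diff_distrib)
    then show ?thesis using near by (simp add: pos_le_divide_eq mult.commute)
  qed
  moreover have "0 \<le> c / (1 - ?q)" using \<open>0 \<le> c\<close> near by simp
  ultimately show "\<exists>c\<ge>0. \<forall>\<xi>\<in>ell2 V. ell2_norm V \<xi> \<le> c * ell2_norm V (\<lambda>v. A \<xi> v - w * \<xi> v)" by blast
  show "\<forall>\<eta>\<in>ell2 V. \<exists>\<xi>\<in>ell2 V. (\<lambda>v. A \<xi> v - w * \<xi> v) = \<eta>"
  proof
    fix \<eta> assume \<eta>: "\<eta> \<in> ell2 V"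
    obtain B where B: "bounded_operator V B"
      "\<And>\<xi>. \<xi> \<in> ell2 V \<Longrightarrow> (\<lambda>v. A (B \<xi>) v - z * B \<xi> v) = \<xi>"
      using z by (auto simp: spectrum_def)
    let ?F = "\<lambda>\<xi>. B (\<lambda>v. \<eta> v + (w - z) * \<xi> v)"
    obtain \<xi> where \<xi>: "\<xi> \<in> ell2 V" "?F \<xi> = \<xi>"
    proof (rule ell2_contraction_fixed_point[of V ?F ?q])
      fix \<xi> \<zeta> assume \<xi>\<zeta>: "\<xi> \<in> ell2 V" "\<zeta> \<in> ell2 V"
      show "?F \<xi> \<in> ell2 V" using \<xi>\<zeta> \<eta> by (intro bounded_operator_in[OF B(1)]) simp
      have "(\<lambda>v. ?F \<xi> v - ?F \<zeta> v) = B (\<lambda>v. (w - z) * (\<xi> v - \<zeta> v))"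
        using \<xi>\<zeta> \<eta> by (simp add: algebra_simps flip: bounded_operator_diff[OF B(1)])
      moreover have "ell2_norm V (B \<zeta>) \<le> c * ell2_norm V \<zeta>" if "\<zeta> \<in> ell2 V" for \<zeta>
        using below[OF bounded_operator_in[OF B(1) that]] B(2)[OF that] by simp
      ultimately show "ell2_norm V (\<lambda>v. ?F \<xi> v - ?F \<zeta> v) \<le> ?q * ell2_norm V (\<lambda>v. \<xi> v - \<zeta> v)"
        using \<xi>\<zeta> by (metis ell2_diff(1) ell2_norm_scale ell2_scale mult.assoc)
    qed (use \<open>0 \<le> c\<close> near in auto)
    have "(\<lambda>v. A \<xi> v - z * \<xi> v) = (\<lambda>v. \<eta> v + (w - z) * \<xi> v)"
      using B(2)[of "\<lambda>v. \<eta> v + (w - z) * \<xi> v"] \<xi> \<eta> by simp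
    then have "(\<lambda>v. A \<xi> v - w * \<xi> v) = \<eta>" by (auto simp: fun_eq_iff algebra_simps)
    with \<xi>(1) show "\<exists>\<xi>\<in>ell2 V. (\<lambda>v. A \<xi> v - w * \<xi> v) = \<eta>" by blast
  qed
qed

text \<open>For z beyond the norm, the triangle inequality bounds A - z below by
  \<open>cmod z - operator_norm V A\<close>, and (A - z) xi = eta becomes xi = (A xi - eta) / z, a
  contraction.\<close>

lemma spectrum_norm_le:
  assumes A: "bounded_operator V A" and "z \<in> spectrum V A"
  shows "cmod z \<le> operator_norm V A"
proof (rule ccontr)
  assume "\<not> ?thesis"
  then have big: "operator_norm V A < cmod z" by simp
  have nz: "z \<noteq> 0" "0 < cmod z" using operator_norm_nonneg[OF A] big by auto
  let ?q = "operator_norm V A / cmod z"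
  have A_in: "A \<xi> \<in> ell2 V" if "\<xi> \<in> ell2 V" for \<xi> using bounded_operator_in[OF A that] .
  have "ell2_norm V \<xi> \<le> 1 / (cmod z - operator_norm V A) * ell2_norm V (\<lambda>v. A \<xi> v - z * \<xi> v)"
    if \<xi>: "\<xi> \<in> ell2 V" for \<xi>
  proof -
    have "cmod z * ell2_norm V \<xi> \<le> ell2_norm V (A \<xi>) + ell2_norm V (\<lambda>v. z * \<xi> v - A \<xi> v)"
      using ell2_norm_le_add_diff[of "\<lambda>v. z * \<xi> v" V "A \<xi>"] A_in[OF \<xi>] \<xi> by simp
    then have "cmod z * ell2_norm V \<xi>
      \<le> operator_norm V A * ell2_norm V \<xi> + ell2_norm V (\<lambda>v. A \<xi> v - z * \<xi> v)"
      using operator_norm_bound[OF A \<xi>] ell2_norm_minus_commute[of V "A \<xi>" "\<lambda>v. z * \<xi> v"] by simp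
    then show ?thesis using big by (simp add: field_simps)
  qed
  moreover have "0 \<le> 1 / (cmod z - operator_norm V A)" using big by simp
  moreover have "\<exists>\<xi>\<in>ell2 V. (\<lambda>v. A \<xi> v - z * \<xi> v) = \<eta>" if \<eta>: "\<eta> \<in> ell2 V" for \<eta>
  proof -
    let ?F = "\<lambda>\<xi> v. (1 / z) * (A \<xi> v - \<eta> v)"
    obtain \<xi> where \<xi>: "\<xi> \<in> ell2 V" "?F \<xi> = \<xi>"
    proof (rule ell2_contraction_fixed_point[of V ?F ?q])
      fix \<xi> \<zeta> assume \<xi>\<zeta>: "\<xi> \<in> ell2 V" "\<zeta> \<in> ell2 V"
      show "?F \<xi> \<in> ell2 V" using ell2_scale[OF ell2_diff(1)[OF A_in[OF \<xi>\<zeta>(1)] \<eta>]] .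
      have "(\<lambda>v. ?F \<xi> v - ?F \<zeta> v) = (\<lambda>v. (1 / z) * A (\<lambda>v. \<xi> v - \<zeta> v) v)"
        using \<xi>\<zeta> by (simp add: bounded_operator_diff[OF A] algebra_simps)
      then have "ell2_norm V (\<lambda>v. ?F \<xi> v - ?F \<zeta> v) = cmod (1 / z) * ell2_norm V (A (\<lambda>v. \<xi> v - \<zeta> v))"
        by (simp only: ell2_norm_scale)
      then show "ell2_norm V (\<lambda>v. ?F \<xi> v - ?F \<zeta> v) \<le> ?q * ell2_norm V (\<lambda>v. \<xi> v - \<zeta> v)"
        using operator_norm_bound[OF A ell2_diff(1)[OF \<xi>\<zeta>]] nz
        by (simp add: norm_divide divide_right_mono)
    qed (use big nz operator_norm_nonneg[OF A] in auto)
    have "A \<xi> v - z * \<xi> v = \<eta> v" for v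
    proof -
      have "z * \<xi> v = z * ?F \<xi> v" using \<xi>(2) by metis
      then show ?thesis using nz by simp
    qed
    with \<xi>(1) show ?thesis by blast
  qed
  ultimately have "z \<notin> spectrum V A" unfolding not_in_spectrum_iff[OF A] by blast
  with assms(2) show False by simp
qed

lemma compact_spectrum:
  assumes A: "bounded_operator V A"
  shows "compact (spectrum V A)"
  unfolding compact_eq_bounded_closed
proof
  show "bounded (spectrum V A)"
    using spectrum_norm_le[OF A] by (auto simp: bounded_iff)
  have "\<exists>e>0. ball z e \<subseteq> - spectrum V A" if z: "z \<in> - spectrum V A" for z
  proof -
    obtain c where c: "0 \<le> c"
      "\<And>\<xi>. \<xi> \<in> ell2 V \<Longrightarrow> ell2_norm V \<xi> \<le> c * ell2_norm V (\<lambda>v. A \<xi> v - z * \<xi> v)"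
      using z not_in_spectrum_iff[OF A, of z] by auto
    \<comment> \<open>The radius is \<open>1 / (c + 1)\<close> and not \<open>1 / c\<close> because
      \<open>c\<close> may be zero.\<close>
    have "w \<notin> spectrum V A" if "dist z w < 1 / (c + 1)" for w
    proof (rule not_in_spectrum_near[OF A c(2) c(1)])
      have "c * cmod (w - z) \<le> c * (1 / (c + 1))"
        using that c(1) by (intro mult_left_mono) (auto simp: dist_norm norm_minus_commute)
      also have "\<dots> < 1" using c(1) by (simp add: field_simps)
      finally show "c * cmod (w - z) < 1" .
    qed (use z in auto)
    then show ?thesis using c(1) by (intro exI[of _ "1 / (c + 1)"]) auto
  qed
  then show "closed (spectrum V A)" unfolding closed_def open_contains_ball by blast
qed

section \<open>Self-adjoint operators\<close>

text \<open>The spectral theory below speaks of an arbitrary bounded symmetric operator; the graph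
  enters only when the locale is interpreted. A vertex supplies a unit vector: over an empty
  \<open>V\<close> the space is zero and the spectrum is empty.\<close>

locale self_adjoint_operator =
  fixes V :: "'a set" and A :: "'a operator"
  assumes nonempty: "V \<noteq> {}"
    and bounded: "bounded_operator V A"
    and symmetric: "\<And>\<xi> \<eta>. \<xi> \<in> ell2 V \<Longrightarrow> \<eta> \<in> ell2 V \<Longrightarrow> ell2_inner V (A \<xi>) \<eta> = ell2_inner V \<xi> (A \<eta>)"
begin

abbreviation "\<Sigma> \<equiv> spectrum V A"
abbreviation "P \<equiv> poly_operator A"

lemma A_in [simp]: "\<xi> \<in> ell2 V \<Longrightarrow> A \<xi> \<in> ell2 V"
  using bounded_operator_in[OF bounded] .

text \<open>By symmetry <A xi, xi> is real, so the imaginary part of <(A - z) xi, xi> is -Im z times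
  the squared norm of xi; the Cauchy-Schwarz inequality does the rest.\<close>

lemma imaginary_part_bound:
  assumes \<xi>: "\<xi> \<in> ell2 V"
  shows "\<bar>Im z\<bar> * ell2_norm V \<xi> \<le> ell2_norm V (\<lambda>v. A \<xi> v - z * \<xi> v)"
proof -
  let ?y = "\<lambda>v. A \<xi> v - z * \<xi> v"
  have "Im (ell2_inner V (A \<xi>) \<xi>) = 0"
    using symmetric[OF \<xi> \<xi>] ell2_inner_commute[of V "A \<xi>" \<xi>] by (simp add: complex_eq_iff)
  moreover have "ell2_inner V ?y \<xi> = ell2_inner V (A \<xi>) \<xi> - z * of_real ((ell2_norm V \<xi>)\<^sup>2)"
    using \<xi> by (simp add: ell2_inner_diff_left ell2_inner_scale_left ell2_inner_self)
  ultimately have "Im (ell2_inner V ?y \<xi>) = - Im z * (ell2_norm V \<xi>)\<^sup>2"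
    by (simp del: of_real_power)
  then have "\<bar>Im z\<bar> * (ell2_norm V \<xi>)\<^sup>2 = \<bar>Im (ell2_inner V ?y \<xi>)\<bar>"
    by (simp add: abs_mult)
  also have "\<dots> \<le> cmod (ell2_inner V ?y \<xi>)" by (rule abs_Im_le_cmod)
  also have "\<dots> \<le> ell2_norm V ?y * ell2_norm V \<xi>"
    using \<xi> by (intro ell2_Cauchy_Schwarz) simp_all
  finally have "(\<bar>Im z\<bar> * ell2_norm V \<xi>) * ell2_norm V \<xi> \<le> ell2_norm V ?y * ell2_norm V \<xi>"
    by (simp add: power2_eq_square mult.assoc)
  then show ?thesis
    using ell2_norm_nonneg[of V \<xi>] ell2_norm_nonneg[of V ?y]
    by (cases "ell2_norm V \<xi> = 0") (auto simp del: ell2_norm_nonneg)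
qed

text \<open>For \<open>t\<close> large, \<open>Re z \<plusminus> \<i>t\<close> is a regular point, and the resolvent bound \<open>1/t\<close> there makes the
  whole disc of radius \<open>t\<close> around it regular; such discs exhaust the open half plane.\<close>

lemma spectrum_real: "z \<in> \<Sigma> \<Longrightarrow> Im z = 0"
proof (rule ccontr)
  assume z: "z \<in> \<Sigma>" and Im: "Im z \<noteq> 0"
  \<comment> \<open>The norm in \<open>t\<close> puts \<open>w\<close> outside the disc that
    contains the spectrum, and the remaining summands make \<open>t\<close> exceed
    \<open>\<bar>Im z\<bar>\<close>. The sign puts \<open>w\<close> on the same side of the real
    line as \<open>z\<close>, at distance \<open>t - \<bar>Im z\<bar>\<close> from it.\<close>
  define t where "t = operator_norm V A + \<bar>Im z\<bar> + 1"
  define w where "w = Complex (Re z) (sgn (Im z) * t)"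
  have t: "0 < t" "operator_norm V A < t" "\<bar>Im z\<bar> < t"
    using operator_norm_nonneg[OF bounded] by (auto simp: t_def)
  have Im_w: "\<bar>Im w\<bar> = t" using Im t by (simp add: w_def abs_mult abs_sgn_eq)
  have "t \<le> cmod w" using Im_w abs_Im_le_cmod[of w] by simp
  then have w: "w \<notin> \<Sigma>" using spectrum_norm_le[OF bounded, of w] t by linarith
  have "Im z = sgn (Im z) * \<bar>Im z\<bar>" by (simp add: sgn_mult_abs)
  then have "z - w = \<i> * of_real (sgn (Im z) * (\<bar>Im z\<bar> - t))"
    by (simp add: w_def complex_eq_iff algebra_simps)
  then have "cmod (z - w) = t - \<bar>Im z\<bar>"
    using t Im by (simp add: norm_mult abs_mult abs_sgn_eq del: of_real_mult of_real_diff)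
  then have "1 / t * cmod (z - w) < 1" using t Im by (simp add: field_simps)
  moreover have "ell2_norm V \<xi> \<le> 1 / t * ell2_norm V (\<lambda>v. A \<xi> v - w * \<xi> v)" if "\<xi> \<in> ell2 V" for \<xi>
    using imaginary_part_bound[OF that, of w] t(1) unfolding Im_w by (simp add: field_simps)
  ultimately have "z \<notin> \<Sigma>"
    using not_in_spectrum_near[OF bounded _ _ w, of "1 / t" z] t(1) by simp
  with z show False by simp
qed

subsection \<open>Polynomials of the operator\<close>

lemma power_in [simp]: "\<xi> \<in> ell2 V \<Longrightarrow> (A ^^ i) \<xi> \<in> ell2 V"
  by (induction i) auto

text \<open>Frees the sum from the exact degree, which may drop under addition, so that polynomials
  can be compared over a common range of indices.\<close>

lemma poly_operator_eq:
  assumes "degree p \<le> n"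
  shows "P p \<xi> = (\<lambda>v. \<Sum>i\<le>n. coeff p i * (A ^^ i) \<xi> v)"
  unfolding poly_operator_def
  by (intro ext sum.mono_neutral_left) (use assms in \<open>auto simp: coeff_eq_0\<close>)

lemma poly_operator_in [simp]: "\<xi> \<in> ell2 V \<Longrightarrow> P p \<xi> \<in> ell2 V"
  unfolding poly_operator_def by simp

lemma poly_operator_0 [simp]: "P 0 \<xi> = (\<lambda>v. 0)"
  by (simp add: poly_operator_def)

text \<open>Horner's rule; it turns the properties of p(A) into inductions on
  \<open>pCons\<close>.\<close>

lemma poly_operator_pCons:
  assumes "\<xi> \<in> ell2 V"
  shows "P (pCons a p) \<xi> = (\<lambda>v. a * \<xi> v + A (P p \<xi>) v)"
proof -
  have "A (P p \<xi>) = (\<lambda>v. \<Sum>i\<le>degree p. coeff p i * (A ^^ Suc i) \<xi> v)"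
    unfolding poly_operator_def
    using assms by (simp add: bounded_operator_sum[OF bounded] bounded_operator_scale[OF bounded])
  moreover have "P (pCons a p) \<xi> = (\<lambda>v. \<Sum>i\<le>Suc (degree p). coeff (pCons a p) i * (A ^^ i) \<xi> v)"
    by (rule poly_operator_eq) (simp add: degree_pCons_le)
  ultimately show ?thesis by (simp add: sum.atMost_Suc_shift del: sum.atMost_Suc)
qed

lemma poly_operator_add: "P (p + q) \<xi> = (\<lambda>v. P p \<xi> v + P q \<xi> v)"
proof -
  let ?n = "max (degree p) (degree q)"
  have "degree (p + q) \<le> ?n" by (rule degree_add_le) auto
  from poly_operator_eq[OF this] show ?thesis
    unfolding poly_operator_eq[of p ?n, OF max.cobounded1] poly_operator_eq[of q ?n, OF max.cobounded2]
    by (simp add: sum.distrib distrib_right)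
qed

lemma poly_operator_smult: "P (smult c p) \<xi> = (\<lambda>v. c * P p \<xi> v)"
  using poly_operator_eq[OF degree_smult_le, of c p]
  by (simp add: poly_operator_def sum_distrib_left mult.assoc)

lemma poly_operator_diff: "P (p - q) \<xi> = (\<lambda>v. P p \<xi> v - P q \<xi> v)"
  using poly_operator_add[of p "smult (-1) q"] poly_operator_smult[of "-1" q] by simp

lemma poly_operator_const: "P [:c:] \<xi> = (\<lambda>v. c * \<xi> v)"
  by (simp add: poly_operator_def)

lemma poly_operator_mult:
  assumes "\<xi> \<in> ell2 V"
  shows "P (p * q) \<xi> = P p (P q \<xi>)"
proof (induction p)
  case (pCons a p)
  have "P (pCons a p * q) \<xi> = (\<lambda>v. a * P q \<xi> v + A (P (p * q) \<xi>) v)"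
    using assms by (simp add: poly_operator_add poly_operator_smult poly_operator_pCons)
  then show ?case using assms by (simp add: pCons poly_operator_pCons)
qed simp

lemma bounded_poly_operator: "bounded_operator V (P p)"
  unfolding bounded_operator_def
proof (intro conjI ballI allI)
  fix \<xi> assume \<xi>: "\<xi> \<in> ell2 V"
  then show "P p \<xi> \<in> ell2 V" by simp
  show "P p (\<lambda>v. c * \<xi> v) = (\<lambda>v. c * P p \<xi> v)" for c
    using \<xi> by (induction p)
      (auto simp: poly_operator_pCons bounded_operator_scale[OF bounded] algebra_simps)
  fix \<eta> assume \<eta>: "\<eta> \<in> ell2 V"
  show "P p (\<lambda>v. \<xi> v + \<eta> v) = (\<lambda>v. P p \<xi> v + P p \<eta> v)"
    using \<xi> \<eta> by (induction p)
      (auto simp: poly_operator_pCons bounded_operator_add[OF bounded] algebra_simps)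
next
  show "\<exists>C. \<forall>\<xi>\<in>ell2 V. ell2_norm V (P p \<xi>) \<le> C * ell2_norm V \<xi>"
  proof (induction p)
    case (pCons a p)
    then obtain C where C: "\<And>\<xi>. \<xi> \<in> ell2 V \<Longrightarrow> ell2_norm V (P p \<xi>) \<le> C * ell2_norm V \<xi>" by blast
    have "ell2_norm V (P (pCons a p) \<xi>) \<le> (cmod a + operator_norm V A * C) * ell2_norm V \<xi>"
      if \<xi>: "\<xi> \<in> ell2 V" for \<xi>
    proof -
      have "ell2_norm V (P (pCons a p) \<xi>) \<le> cmod a * ell2_norm V \<xi> + ell2_norm V (A (P p \<xi>))"
        using ell2_add(2)[of "\<lambda>v. a * \<xi> v" V "A (P p \<xi>)"] \<xi> by (simp add: poly_operator_pCons)
      also have "ell2_norm V (A (P p \<xi>)) \<le> operator_norm V A * ell2_norm V (P p \<xi>)"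
        using \<xi> by (intro operator_norm_bound[OF bounded]) simp
      also have "\<dots> \<le> operator_norm V A * (C * ell2_norm V \<xi>)"
        using C[OF \<xi>] operator_norm_nonneg[OF bounded] by (rule mult_left_mono)
      finally show ?thesis by (simp add: algebra_simps)
    qed
    then show ?case by blast
  qed (auto intro: exI[of _ 0])
qed

lemma poly_operator_commute: "\<xi> \<in> ell2 V \<Longrightarrow> P p (A \<xi>) = A (P p \<xi>)"
  by (induction p)
     (auto simp: poly_operator_pCons bounded_operator_zero[OF bounded]
        bounded_operator_add[OF bounded] bounded_operator_scale[OF bounded])

text \<open>The adjoint of p(A) has conjugated coefficients because A is its own adjoint. The
  induction varies \<open>\<eta>\<close>, since each step moves one factor A to the right-hand
  vector.\<close>

lemma poly_operator_adjoint:
  assumes "\<xi> \<in> ell2 V" "\<eta> \<in> ell2 V"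
  shows "ell2_inner V (P p \<xi>) \<eta> = ell2_inner V \<xi> (P (map_poly cnj p) \<eta>)"
  using assms
proof (induction p arbitrary: \<eta>)
  case 0
  then show ?case using ell2_inner_scale_left[of V 0 "\<lambda>v. 0" \<eta>] by simp
next
  case (pCons a p)
  then show ?case
    by (simp add: map_poly_pCons poly_operator_pCons ell2_inner_add_left ell2_inner_add_right
        ell2_inner_scale_left ell2_inner_scale_right symmetric poly_operator_commute)
qed

section \<open>Isometry of the polynomial calculus on the spectrum\<close>

lemma bounded_below_poly_operator:
  assumes "r \<noteq> 0" "\<And>z. z \<in> \<Sigma> \<Longrightarrow> poly r z \<noteq> 0"
  shows "\<exists>c\<ge>0. \<forall>\<xi>\<in>ell2 V. ell2_norm V \<xi> \<le> c * ell2_norm V (P r \<xi>)"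
  using assms
proof (induction "degree r" arbitrary: r)
  case 0
  then obtain a where r: "r = [:a:]" "a \<noteq> 0" by (metis degree_eq_zeroE pCons_0_0)
  then show ?case by (intro exI[of _ "1 / cmod a"]) (simp add: poly_operator_const)
next
  case (Suc n)
  \<comment> \<open>One complex root is split off at a time. The root is a regular point, so its
    linear factor is bounded below, and the constants of the factors multiply.\<close>
  have "\<not> constant (poly r)" using Suc.hyps(2) by (simp add: constant_degree)
  then obtain z where z: "poly r z = 0" using fundamental_theorem_of_algebra by blast
  then obtain s where s: "r = [:-z, 1:] * s" by (metis dvdE poly_eq_0_iff_dvd)
  have "s \<noteq> 0" using s Suc.prems(1) by auto
  then have "degree s = n" using Suc.hyps(2) unfolding s by (subst (asm) degree_mult_eq) auto
  moreover have "poly s w \<noteq> 0" if "w \<in> \<Sigma>" for w using Suc.prems(2)[OF that] by (simp add: s)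
  ultimately obtain c where c: "0 \<le> c" "\<And>\<xi>. \<xi> \<in> ell2 V \<Longrightarrow> ell2_norm V \<xi> \<le> c * ell2_norm V (P s \<xi>)"
    using Suc.hyps(1)[of s] \<open>s \<noteq> 0\<close> by blast
  have "z \<notin> \<Sigma>" using z Suc.prems(2) by blast
  then obtain d where d: "0 \<le> d"
    "\<And>\<xi>. \<xi> \<in> ell2 V \<Longrightarrow> ell2_norm V \<xi> \<le> d * ell2_norm V (\<lambda>v. A \<xi> v - z * \<xi> v)"
    unfolding not_in_spectrum_iff[OF bounded] by blast
  have "ell2_norm V \<xi> \<le> (c * d) * ell2_norm V (P r \<xi>)" if \<xi>: "\<xi> \<in> ell2 V" for \<xi>
  proof -
    have "P r \<xi> = (\<lambda>v. A (P s \<xi>) v - z * P s \<xi> v)"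
      unfolding s poly_operator_mult[OF \<xi>]
      using \<xi> by (simp add: poly_operator_pCons poly_operator_const)
    then have "ell2_norm V (P s \<xi>) \<le> d * ell2_norm V (P r \<xi>)" using d(2)[of "P s \<xi>"] \<xi> by simp
    with c(2)[OF \<xi>] show ?thesis
      using c(1) by (metis mult.assoc mult_left_mono order_trans)
  qed
  then show ?case using c(1) d(1) by (intro exI[of _ "c * d"]) auto
qed

text \<open>With \<open>M\<close> the norm of \<open>p(A)\<close>, any \<open>\<xi>\<close> that almost attains the norm is almost annihilated by
  \<open>p(A)\<^sup>*p(A) - M\<^sup>2\<close>, so that this operator is not bounded below.\<close>

lemma norm_polynomial_has_root_in_spectrum:
  fixes p :: "complex poly"
  defines "M \<equiv> operator_norm V (P p)"
  defines "r \<equiv> map_poly cnj p * p - [:of_real (M\<^sup>2):]"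
  assumes "r \<noteq> 0"
  shows "\<exists>z\<in>\<Sigma>. poly r z = 0"
proof (rule ccontr)
  assume "\<not> ?thesis"
  then obtain c0 where c0: "0 \<le> c0" "\<And>\<xi>. \<xi> \<in> ell2 V \<Longrightarrow> ell2_norm V \<xi> \<le> c0 * ell2_norm V (P r \<xi>)"
    using bounded_below_poly_operator[OF assms(3)] by blast
  \<comment> \<open>A positive constant, since it is later divided by.\<close>
  define c where "c = c0 + 1"
  have c: "0 < c" "\<And>\<xi>. \<xi> \<in> ell2 V \<Longrightarrow> ell2_norm V \<xi> \<le> c * ell2_norm V (P r \<xi>)"
    using c0 by (auto simp: c_def distrib_right intro: add_increasing2)
  let ?q = "map_poly cnj p"
  have M0: "0 \<le> M" and M: "\<And>\<xi>. \<xi> \<in> ell2 V \<Longrightarrow> ell2_norm V (P p \<xi>) \<le> M * ell2_norm V \<xi>"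
    unfolding M_def using operator_norm_nonneg operator_norm_bound bounded_poly_operator by blast+
  have cnj_q: "map_poly cnj ?q = p" by (simp add: map_poly_map_poly o_def)
  \<comment> \<open>The adjoint has norm at most \<open>M\<close>: with y = p(A)^* eta, the squared
    norm of y is <eta, p(A) y>, which is at most the norm of eta times \<open>M\<close> times the
    norm of y.\<close>
  have Mq: "ell2_norm V (P ?q \<eta>) \<le> M * ell2_norm V \<eta>" if \<eta>: "\<eta> \<in> ell2 V" for \<eta>
  proof -
    let ?y = "P ?q \<eta>"
    have y: "?y \<in> ell2 V" using \<eta> by simp
    have "of_real ((ell2_norm V ?y)\<^sup>2) = ell2_inner V \<eta> (P p ?y)"
      using poly_operator_adjoint[OF \<eta> y, of ?q] y unfolding cnj_q
      by (simp add: ell2_inner_self del: of_real_power)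
    then have "(ell2_norm V ?y)\<^sup>2 = cmod (ell2_inner V \<eta> (P p ?y))"
      by (metis norm_of_real abs_power2 power2_abs real_norm_def)
    also have "\<dots> \<le> ell2_norm V \<eta> * ell2_norm V (P p ?y)"
      using \<eta> by (intro ell2_Cauchy_Schwarz) simp_all
    also have "\<dots> \<le> ell2_norm V \<eta> * (M * ell2_norm V ?y)"
      using M[OF y] by (intro mult_left_mono) auto
    finally have "ell2_norm V ?y * ell2_norm V ?y \<le> (M * ell2_norm V \<eta>) * ell2_norm V ?y"
      by (simp add: power2_eq_square mult_ac)
    then show ?thesis
      using ell2_norm_nonneg[of V ?y] M0 ell2_norm_nonneg[of V \<eta>]
      by (cases "ell2_norm V ?y = 0") (auto simp del: ell2_norm_nonneg)
  qed
  \<comment> \<open>Expanding the square of the norm of p(A)^* p(A) xi - M^2 xi gives a cross term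
    -2 M^2 |p(A) xi|^2, while by \<open>Mq\<close> the first square is at most M^2 |p(A) xi|^2. What
    remains is M^2 times the defect M^2 |xi|^2 - |p(A) xi|^2.\<close>
  have key: "(ell2_norm V \<xi>)\<^sup>2 \<le> c\<^sup>2 * M\<^sup>2 * (M\<^sup>2 * (ell2_norm V \<xi>)\<^sup>2 - (ell2_norm V (P p \<xi>))\<^sup>2)"
    if \<xi>: "\<xi> \<in> ell2 V" for \<xi>
  proof -
    let ?y = "P ?q (P p \<xi>)"
    have y: "?y \<in> ell2 V" using \<xi> by simp
    have inner: "ell2_inner V ?y (\<lambda>v. of_real (M\<^sup>2) * \<xi> v) = of_real (M\<^sup>2 * (ell2_norm V (P p \<xi>))\<^sup>2)"
      using poly_operator_adjoint[of "P p \<xi>" \<xi> ?q] \<xi> unfolding cnj_q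
      by (simp add: ell2_inner_scale_right ell2_inner_self)
    have "P r \<xi> = (\<lambda>v. ?y v - of_real (M\<^sup>2) * \<xi> v)"
      unfolding r_def poly_operator_diff poly_operator_mult[OF \<xi>] poly_operator_const ..
    then have "(ell2_norm V (P r \<xi>))\<^sup>2
      = (ell2_norm V ?y)\<^sup>2 - 2 * (M\<^sup>2 * (ell2_norm V (P p \<xi>))\<^sup>2) + (M\<^sup>2 * ell2_norm V \<xi>)\<^sup>2"
      using ell2_norm_diff_square[OF y, of "\<lambda>v. of_real (M\<^sup>2) * \<xi> v"] \<xi> unfolding inner
      by (simp del: of_real_power of_real_mult)
    also have "(ell2_norm V ?y)\<^sup>2 \<le> (M * ell2_norm V (P p \<xi>))\<^sup>2"
      using Mq[of "P p \<xi>"] \<xi> by (intro power_mono) auto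
    finally have "(ell2_norm V (P r \<xi>))\<^sup>2 \<le> M\<^sup>2 * (M\<^sup>2 * (ell2_norm V \<xi>)\<^sup>2 - (ell2_norm V (P p \<xi>))\<^sup>2)"
      by (simp add: algebra_simps power_mult_distrib power2_eq_square)
    then have "c\<^sup>2 * (ell2_norm V (P r \<xi>))\<^sup>2
        \<le> c\<^sup>2 * (M\<^sup>2 * (M\<^sup>2 * (ell2_norm V \<xi>)\<^sup>2 - (ell2_norm V (P p \<xi>))\<^sup>2))"
      by (rule mult_left_mono) simp
    moreover have "(ell2_norm V \<xi>)\<^sup>2 \<le> (c * ell2_norm V (P r \<xi>))\<^sup>2"
      using c(2)[OF \<xi>] by (intro power_mono) auto
    ultimately show ?thesis by (simp add: power_mult_distrib mult.assoc)
  qed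
  obtain u where u: "u \<in> V" using nonempty by blast
  \<comment> \<open>With \<open>M = 0\<close> the inequality \<open>key\<close> would force a unit
    vector to vanish.\<close>
  have "M \<noteq> 0" using key[of "delta u"] u by auto
  with M0 have Mpos: "0 < M" by simp
  \<comment> \<open>Solving \<open>key\<close> for the norm of p(A) xi gives the squared bound
    \<open>K\<close>, which lies strictly below \<open>M\<^sup>2\<close>; this contradicts
    \<open>M\<close> being the operator norm.\<close>
  define K where "K = M\<^sup>2 - 1 / (c\<^sup>2 * M\<^sup>2)"
  have cM: "0 < c\<^sup>2 * M\<^sup>2" using c(1) Mpos by simp
  have le: "(ell2_norm V (P p \<xi>))\<^sup>2 \<le> K * (ell2_norm V \<xi>)\<^sup>2" if "\<xi> \<in> ell2 V" for \<xi>
  proof -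
    have "1 / (c\<^sup>2 * M\<^sup>2) * (ell2_norm V \<xi>)\<^sup>2 \<le> M\<^sup>2 * (ell2_norm V \<xi>)\<^sup>2 - (ell2_norm V (P p \<xi>))\<^sup>2"
      using key[OF that] cM by (simp add: pos_divide_le_eq mult.commute)
    then show ?thesis by (simp add: K_def algebra_simps)
  qed
  have "0 \<le> K" using le[of "delta u"] u by (simp add: order_trans[OF zero_le_power2])
  have "M \<le> sqrt K"
    unfolding M_def
  proof (rule operator_norm_le)
    fix \<xi> assume "\<xi> \<in> ell2 V"
    from real_sqrt_le_mono[OF le[OF this]] show "ell2_norm V (P p \<xi>) \<le> sqrt K * ell2_norm V \<xi>"
      by (simp add: real_sqrt_mult)
  qed (use \<open>0 \<le> K\<close> in simp)
  then have "M\<^sup>2 \<le> K" using M0 \<open>0 \<le> K\<close> by (metis power_mono real_sqrt_pow2)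
  then show False using cM by (simp add: K_def)
qed

text \<open>For p = X the polynomial is X^2 - M^2, which is nonzero by its leading coefficient, so
  the root lemma provides a point of the spectrum.\<close>

lemma spectrum_nonempty: "\<Sigma> \<noteq> {}"
proof -
  let ?p = "[:0, 1:] :: complex poly"
  have "coeff (map_poly cnj ?p * ?p - [:of_real ((operator_norm V (P ?p))\<^sup>2):]) 2 = 1"
    by (simp add: map_poly_pCons numeral_2_eq_2)
  then have "map_poly cnj ?p * ?p - [:of_real ((operator_norm V (P ?p))\<^sup>2):] \<noteq> 0"
    by (metis coeff_0 zero_neq_one)
  from norm_polynomial_has_root_in_spectrum[OF this] show ?thesis by blast
qed

text \<open>At real points, conjugating the coefficients conjugates the value; this makes p(A)^*
  p(A) correspond to |p|^2 on the spectrum.\<close>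

lemma poly_map_cnj_spectrum: "z \<in> \<Sigma> \<Longrightarrow> poly (map_poly cnj p) z = cnj (poly p z)"
proof -
  assume "z \<in> \<Sigma>"
  then have "cnj z = z" using spectrum_real[of z] by (simp add: complex_eq_iff)
  then show ?thesis by simp
qed

lemma poly_operator_norm: "\<exists>z\<in>\<Sigma>. operator_norm V (P p) = cmod (poly p z)"
proof -
  let ?M = "operator_norm V (P p)"
  let ?r = "map_poly cnj p * p - [:of_real (?M\<^sup>2):]"
  \<comment> \<open>The root lemma excludes the zero polynomial, but then every point of the
    spectrum is a root, and there is one.\<close>
  have "\<exists>z\<in>\<Sigma>. poly ?r z = 0"
  proof (cases "?r = 0")
    case True
    then show ?thesis using spectrum_nonempty by (metis all_not_in_conv poly_0)
  qed (rule norm_polynomial_has_root_in_spectrum)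
  then obtain z where z: "z \<in> \<Sigma>" "poly ?r z = 0" by blast
  have "complex_of_real (?M\<^sup>2) = cnj (poly p z) * poly p z"
    using z(2) unfolding poly_diff poly_mult poly_map_cnj_spectrum[OF z(1)] by simp
  also have "\<dots> = of_real ((cmod (poly p z))\<^sup>2)"
    unfolding complex_norm_square by (rule mult.commute)
  finally have "?M\<^sup>2 = (cmod (poly p z))\<^sup>2" by (simp only: of_real_eq_iff)
  then have "?M = cmod (poly p z)"
    using operator_norm_nonneg[OF bounded_poly_operator] by (simp add: power2_eq_iff_nonneg)
  with z(1) show ?thesis by blast
qed

lemma poly_operator_bound:
  assumes "\<xi> \<in> ell2 V" "\<And>z. z \<in> \<Sigma> \<Longrightarrow> cmod (poly p z) \<le> b"
  shows "ell2_norm V (P p \<xi>) \<le> b * ell2_norm V \<xi>"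
proof -
  have "operator_norm V (P p) \<le> b" using poly_operator_norm[of p] assms(2) by force
  with operator_norm_bound[OF bounded_poly_operator assms(1), of p] show ?thesis
    by (meson ell2_norm_nonneg mult_right_mono order_trans)
qed

end

section \<open>The continuous functional calculus\<close>

lemma bounded_operator_minus:
  assumes S: "bounded_operator V S" and T: "bounded_operator V T"
  shows "bounded_operator V (\<lambda>\<xi> v. S \<xi> v - T \<xi> v)"
  unfolding bounded_operator_def
proof (intro conjI ballI allI exI[of _ "operator_norm V S + operator_norm V T"])
  fix \<xi> assume \<xi>: "\<xi> \<in> ell2 V"
  have in_H: "S \<xi> \<in> ell2 V" "T \<xi> \<in> ell2 V" using bounded_operator_in S T \<xi> by auto
  then show "(\<lambda>v. S \<xi> v - T \<xi> v) \<in> ell2 V" by simp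
  show "(\<lambda>v. S (\<lambda>v. c * \<xi> v) v - T (\<lambda>v. c * \<xi> v) v) = (\<lambda>v. c * (S \<xi> v - T \<xi> v))" for c
    using \<xi> by (simp add: bounded_operator_scale[OF S] bounded_operator_scale[OF T] algebra_simps)
  show "ell2_norm V (\<lambda>v. S \<xi> v - T \<xi> v) \<le> (operator_norm V S + operator_norm V T) * ell2_norm V \<xi>"
    using ell2_diff(2)[OF in_H] operator_norm_bound[OF S \<xi>] operator_norm_bound[OF T \<xi>]
    by (simp add: distrib_right)
  fix \<eta> assume \<eta>: "\<eta> \<in> ell2 V"
  show "(\<lambda>v. S (\<lambda>v. \<xi> v + \<eta> v) v - T (\<lambda>v. \<xi> v + \<eta> v) v)
    = (\<lambda>v. S \<xi> v - T \<xi> v + (S \<eta> v - T \<eta> v))"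
    using \<xi> \<eta> by (simp add: bounded_operator_add[OF S] bounded_operator_add[OF T] algebra_simps)
qed

section \<open>Uniform approximation by polynomials on the spectrum\<close>

lemma real_polynomial_function_poly:
  fixes g :: "real \<Rightarrow> real"
  assumes "real_polynomial_function g"
  shows "\<exists>q :: complex poly. \<forall>x. poly q (of_real x) = of_real (g x)"
proof -
  obtain a n where g: "g = (\<lambda>x. \<Sum>i\<le>n. a i * x ^ i)"
    using assms by (auto simp: real_polynomial_function_iff_sum)
  show ?thesis
    by (rule exI[of _ "\<Sum>i\<le>n. monom (of_real (a i)) i"]) (simp add: g poly_sum poly_monom)
qed

context self_adjoint_operator
begin

lemma of_real_Re_spectrum: "z \<in> \<Sigma> \<Longrightarrow> of_real (Re z) = z"
  using spectrum_real[of z] by (simp add: complex_eq_iff)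

text \<open>The spectrum is identified with its image under \<open>Re\<close>, a compact set of
  reals, where the Stone-Weierstrass theorem treats the real and imaginary parts of \<open>f\<close>
  separately.\<close>

lemma poly_approximation:
  assumes f: "continuous_on \<Sigma> f" and "e > 0"
  shows "\<exists>q. \<forall>z\<in>\<Sigma>. cmod (poly q z - f z) < e"
proof -
  have K: "compact (Re ` \<Sigma>)"
    by (intro compact_continuous_image compact_spectrum bounded continuous_intros)
  have "of_real ` Re ` \<Sigma> \<subseteq> \<Sigma>" using of_real_Re_spectrum by auto
  then have cont: "continuous_on (Re ` \<Sigma>) (\<lambda>x. f (of_real x))"
    by (intro continuous_on_compose2[OF f] continuous_intros)
  obtain g where g: "real_polynomial_function g"
    "\<And>x. x \<in> Re ` \<Sigma> \<Longrightarrow> \<bar>Re (f (of_real x)) - g x\<bar> < e / 2"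
    using Stone_Weierstrass_real_polynomial_function[OF K continuous_on_Re[OF cont], of "e / 2"]
      \<open>e > 0\<close> by auto
  obtain h where h: "real_polynomial_function h"
    "\<And>x. x \<in> Re ` \<Sigma> \<Longrightarrow> \<bar>Im (f (of_real x)) - h x\<bar> < e / 2"
    using Stone_Weierstrass_real_polynomial_function[OF K continuous_on_Im[OF cont], of "e / 2"]
      \<open>e > 0\<close> by auto
  obtain p :: "complex poly" where p: "\<And>x. poly p (of_real x) = of_real (g x)"
    using real_polynomial_function_poly[OF g(1)] by blast
  obtain q :: "complex poly" where q: "\<And>x. poly q (of_real x) = of_real (h x)"
    using real_polynomial_function_poly[OF h(1)] by blast
  have "cmod (poly (p + smult \<i> q) z - f z) < e" if z: "z \<in> \<Sigma>" for z
  proof -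
    have "poly p z = of_real (g (Re z))" "poly q z = of_real (h (Re z))"
      using p[of "Re z"] q[of "Re z"] of_real_Re_spectrum[OF z] by simp_all
    then have "cmod (poly (p + smult \<i> q) z - f z) \<le> \<bar>g (Re z) - Re (f z)\<bar> + \<bar>h (Re z) - Im (f z)\<bar>"
      using cmod_le[of "poly (p + smult \<i> q) z - f z"] by simp
    also have "\<dots> < e"
      using g(2)[of "Re z"] h(2)[of "Re z"] z of_real_Re_spectrum[OF z] by (simp add: abs_minus_commute)
    finally show ?thesis .
  qed
  then show ?thesis by blast
qed

lemma uniform_limit_polys:
  assumes "continuous_on \<Sigma> f"
  obtains p where "uniform_limit \<Sigma> (\<lambda>n. poly (p n)) f sequentially"
proof -
  have "\<exists>q. \<forall>z\<in>\<Sigma>. cmod (poly q z - f z) < 1 / Suc n" for n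
    using poly_approximation[OF assms] by simp
  then obtain p where p: "\<And>n z. z \<in> \<Sigma> \<Longrightarrow> cmod (poly (p n) z - f z) < 1 / Suc n" by metis
  have "uniform_limit \<Sigma> (\<lambda>n. poly (p n)) f sequentially"
    unfolding uniform_limit_sequentially_iff dist_norm
  proof (intro allI impI)
    fix e :: real assume "e > 0"
    then obtain N where N: "1 / Suc N < e" using nat_approx_posE by blast
    have "cmod (poly (p n) z - f z) < e" if "N \<le> n" "z \<in> \<Sigma>" for n z
    proof -
      have "1 / real (Suc n) \<le> 1 / real (Suc N)" using that(1) by (simp add: field_simps)
      then show ?thesis using p[OF that(2), of n] N by linarith
    qed
    then show "\<exists>N. \<forall>n\<ge>N. \<forall>z\<in>\<Sigma>. cmod (poly (p n) z - f z) < e" by blast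
  qed
  then show ?thesis by (rule that)
qed

text \<open>The condition inside the description in \<open>functional_calculus\<close>, named so
  that existence and uniqueness can be stated.\<close>

definition calculus_operator :: "(complex \<Rightarrow> complex) \<Rightarrow> 'a operator \<Rightarrow> bool" where
  "calculus_operator f T \<longleftrightarrow> bounded_operator V T \<and> T \<in> extensional (ell2 V) \<and>
     (\<forall>p. uniform_limit \<Sigma> (\<lambda>n. poly (p n)) f sequentially \<longrightarrow>
        (\<lambda>n. operator_norm V (\<lambda>\<xi> v. P (p n) \<xi> v - T \<xi> v)) \<longlonglongrightarrow> 0)"

lemma calculus_operator_converges:
  assumes T: "calculus_operator f T" and p: "uniform_limit \<Sigma> (\<lambda>n. poly (p n)) f sequentially"
    and \<xi>: "\<xi> \<in> ell2 V"
  shows "ell2_converges V (\<lambda>n. P (p n) \<xi>) (T \<xi>)"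
proof (rule ell2_converges_le)
  have B: "bounded_operator V T" and lim: "(\<lambda>n. operator_norm V (\<lambda>\<xi> v. P (p n) \<xi> v - T \<xi> v)) \<longlonglongrightarrow> 0"
    using T p by (auto simp: calculus_operator_def)
  show "ell2_norm V (\<lambda>v. P (p n) \<xi> v - T \<xi> v)
      \<le> operator_norm V (\<lambda>\<xi> v. P (p n) \<xi> v - T \<xi> v) * ell2_norm V \<xi>" for n
    using operator_norm_bound[OF bounded_operator_minus[OF bounded_poly_operator B] \<xi>] .
  show "(\<lambda>n. operator_norm V (\<lambda>\<xi> v. P (p n) \<xi> v - T \<xi> v) * ell2_norm V \<xi>) \<longlonglongrightarrow> 0"
    using lim by (rule tendsto_mult_left_zero)
qed

text \<open>An approximating sequence exists because \<open>f\<close> is continuous; along it the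
  operators are determined on \<open>ell2 V\<close> as pointwise limits, and extensionality fixes
  them elsewhere.\<close>

lemma calculus_operator_unique:
  assumes "continuous_on \<Sigma> f" "calculus_operator f S" "calculus_operator f T"
  shows "S = T"
proof -
  obtain p where p: "uniform_limit \<Sigma> (\<lambda>n. poly (p n)) f sequentially"
    using uniform_limit_polys[OF assms(1)] .
  have "S \<xi> = T \<xi>" if \<xi>: "\<xi> \<in> ell2 V" for \<xi>
    using calculus_operator_converges[OF assms(2) p \<xi>] calculus_operator_converges[OF assms(3) p \<xi>]
  proof (rule ell2_converges_unique)
    show "S \<xi> \<in> ell2 V" "T \<xi> \<in> ell2 V"
      using assms(2,3) \<xi> bounded_operator_in by (auto simp: calculus_operator_def)
  qed (use \<xi> in simp)
  moreover have "S \<in> extensional (ell2 V)" "T \<in> extensional (ell2 V)"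
    using assms(2,3) by (auto simp: calculus_operator_def)
  ultimately show ?thesis by (rule extensionalityI[rotated 2])
qed

text \<open>The operator is the pointwise limit along one chosen sequence. The estimate
  \<open>approx\<close> then compares it with q(A) for every polynomial q through the distance of q
  from \<open>f\<close> on the spectrum, and so gives operator-norm convergence along all
  approximating sequences.\<close>

lemma calculus_operator_exists:
  assumes f: "continuous_on \<Sigma> f"
  shows "\<exists>T. calculus_operator f T"
proof -
  obtain p where p: "uniform_limit \<Sigma> (\<lambda>n. poly (p n)) f sequentially"
    using uniform_limit_polys[OF f] .
  \<comment> \<open>The isometry: q - r is at most \<open>a + b\<close> in modulus on the
    spectrum.\<close>
  have diff: "ell2_norm V (\<lambda>v. P q \<xi> v - P r \<xi> v) \<le> (a + b) * ell2_norm V \<xi>"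
    if \<xi>: "\<xi> \<in> ell2 V" and q: "\<And>z. z \<in> \<Sigma> \<Longrightarrow> cmod (poly q z - f z) \<le> a"
      and r: "\<And>z. z \<in> \<Sigma> \<Longrightarrow> cmod (poly r z - f z) \<le> b" for \<xi> q r a b
  proof -
    have "cmod (poly (q - r) z) \<le> a + b" if "z \<in> \<Sigma>" for z
      using norm_triangle_ineq4[of "poly q z - f z" "poly r z - f z"] q[OF that] r[OF that] by simp
    from poly_operator_bound[OF \<xi> this] show ?thesis unfolding poly_operator_diff .
  qed
  have near: "\<exists>M. \<forall>n\<ge>M. \<forall>z\<in>\<Sigma>. cmod (poly (p n) z - f z) \<le> e" if "e > 0" for e
    using p that unfolding uniform_limit_sequentially_iff dist_norm by (meson less_imp_le)
  have "\<exists>\<eta>. \<eta> \<in> ell2 V \<and> ell2_converges V (\<lambda>n. P (p n) \<xi>) \<eta>" if \<xi>: "\<xi> \<in> ell2 V" for \<xi>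
  proof -
    have "\<exists>M. \<forall>m\<ge>M. \<forall>n\<ge>M. ell2_norm V (\<lambda>v. P (p m) \<xi> v - P (p n) \<xi> v) \<le> e" if "e > 0" for e
    proof -
      \<comment> \<open>Two members of the sequence within \<open>d\<close> of \<open>f\<close>
        differ by at most \<open>2 * d\<close>; the summand 1 keeps the denominator positive for the
        zero vector.\<close>
      define d where "d = e / (ell2_norm V \<xi> + 1) / 2"
      have d: "0 < d" using that by (auto simp: d_def intro!: divide_pos_pos add_nonneg_pos)
      have "ell2_norm V \<xi> + 1 > 0" by (rule add_nonneg_pos) auto
      moreover have "d + d = e / (ell2_norm V \<xi> + 1)" unfolding d_def by (rule field_sum_of_halves)
      ultimately have "(d + d) * (ell2_norm V \<xi> + 1) = e" by simp
      moreover have "(d + d) * ell2_norm V \<xi> \<le> (d + d) * (ell2_norm V \<xi> + 1)"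
        using d by (intro mult_left_mono) auto
      ultimately have "(d + d) * ell2_norm V \<xi> \<le> e" by simp
      moreover obtain M where "\<forall>n\<ge>M. \<forall>z\<in>\<Sigma>. cmod (poly (p n) z - f z) \<le> d"
        using near[OF d] by blast
      ultimately show ?thesis using diff[OF \<xi>] by (meson order_trans)
    qed
    from ell2_complete[OF poly_operator_in[OF \<xi>] this] show ?thesis by blast
  qed
  then obtain T0 where T0: "\<And>\<xi>. \<xi> \<in> ell2 V \<Longrightarrow> T0 \<xi> \<in> ell2 V"
    "\<And>\<xi>. \<xi> \<in> ell2 V \<Longrightarrow> ell2_converges V (\<lambda>n. P (p n) \<xi>) (T0 \<xi>)" by metis
  define T where "T = restrict T0 (ell2 V)"
  have T_in: "T \<xi> \<in> ell2 V" and T_lim: "ell2_converges V (\<lambda>n. P (p n) \<xi>) (T \<xi>)"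
    if "\<xi> \<in> ell2 V" for \<xi> using T0 that by (auto simp: T_def)
  \<comment> \<open>Here q need not belong to the chosen sequence: q(A) is compared with p_n(A) by
    \<open>diff\<close>, and p_n(A) xi with its limit for large n.\<close>
  have approx: "ell2_norm V (\<lambda>v. P q \<xi> v - T \<xi> v) \<le> a * ell2_norm V \<xi>"
    if \<xi>: "\<xi> \<in> ell2 V" and q: "\<And>z. z \<in> \<Sigma> \<Longrightarrow> cmod (poly q z - f z) \<le> a" for \<xi> q a
  proof (rule field_le_epsilon)
    fix e :: real assume "e > 0"
    define d where "d = e / (ell2_norm V \<xi> + 1)"
    have pos: "ell2_norm V \<xi> + 1 > 0" by (rule add_nonneg_pos) auto
    have d: "0 < d" using \<open>e > 0\<close> pos by (simp add: d_def)
    obtain M where M: "\<forall>n\<ge>M. \<forall>z\<in>\<Sigma>. cmod (poly (p n) z - f z) \<le> d" using near[OF d] by blast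
    obtain M' where M': "\<forall>n\<ge>M'. ell2_norm V (\<lambda>v. P (p n) \<xi> v - T \<xi> v) < d"
      using T_lim[OF \<xi>] d unfolding ell2_converges_def LIMSEQ_iff by auto
    define n where "n = max M M'"
    have "ell2_norm V (\<lambda>v. P q \<xi> v - T \<xi> v)
      \<le> ell2_norm V (\<lambda>v. P q \<xi> v - P (p n) \<xi> v) + ell2_norm V (\<lambda>v. P (p n) \<xi> v - T \<xi> v)"
      using \<xi> T_in by (intro ell2_norm_triangle_diff) auto
    also have "\<dots> \<le> (a + d) * ell2_norm V \<xi> + d"
      using diff[OF \<xi> q, of "p n" d] M M' by (intro add_mono) (auto simp: n_def less_imp_le)
    also have "\<dots> = a * ell2_norm V \<xi> + d * (ell2_norm V \<xi> + 1)" by (simp add: algebra_simps)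
    also have "\<dots> = a * ell2_norm V \<xi> + e" using pos by (simp add: d_def)
    finally show "ell2_norm V (\<lambda>v. P q \<xi> v - T \<xi> v) \<le> a * ell2_norm V \<xi> + e" .
  qed
  have bounded_T: "bounded_operator V T"
    unfolding bounded_operator_def
  proof (intro conjI ballI allI)
    obtain M where M: "\<And>n z. M \<le> n \<Longrightarrow> z \<in> \<Sigma> \<Longrightarrow> cmod (poly (p n) z - f z) \<le> 1" using near[of 1] by auto
    have "ell2_norm V (T \<xi>) \<le> (operator_norm V (P (p M)) + 1) * ell2_norm V \<xi>" if \<xi>: "\<xi> \<in> ell2 V" for \<xi>
      using ell2_norm_le_add_diff[of "T \<xi>" V "P (p M) \<xi>"] approx[OF \<xi> M[OF order_refl]] T_in[OF \<xi>] \<xi>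
        operator_norm_bound[OF bounded_poly_operator \<xi>, of "p M"]
        ell2_norm_minus_commute[of V "T \<xi>" "P (p M) \<xi>"]
      by (simp add: distrib_right)
    then show "\<exists>C. \<forall>\<xi>\<in>ell2 V. ell2_norm V (T \<xi>) \<le> C * ell2_norm V \<xi>" by blast
  next
    fix \<xi> assume \<xi>: "\<xi> \<in> ell2 V"
    then show "T \<xi> \<in> ell2 V" by (rule T_in)
    show "T (\<lambda>v. c * \<xi> v) = (\<lambda>v. c * T \<xi> v)" for c
    proof (rule ell2_converges_unique)
      show "ell2_converges V (\<lambda>n. P (p n) (\<lambda>v. c * \<xi> v)) (T (\<lambda>v. c * \<xi> v))" using \<xi> by (intro T_lim) simp
      show "ell2_converges V (\<lambda>n. P (p n) (\<lambda>v. c * \<xi> v)) (\<lambda>v. c * T \<xi> v)"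
        using ell2_converges_scale[OF T_lim[OF \<xi>], of c] \<xi>
        by (simp add: bounded_operator_scale[OF bounded_poly_operator])
    qed (use \<xi> T_in in auto)
    fix \<eta> assume \<eta>: "\<eta> \<in> ell2 V"
    show "T (\<lambda>v. \<xi> v + \<eta> v) = (\<lambda>v. T \<xi> v + T \<eta> v)"
    proof (rule ell2_converges_unique)
      show "ell2_converges V (\<lambda>n. P (p n) (\<lambda>v. \<xi> v + \<eta> v)) (T (\<lambda>v. \<xi> v + \<eta> v))"
        using \<xi> \<eta> by (intro T_lim) simp
      show "ell2_converges V (\<lambda>n. P (p n) (\<lambda>v. \<xi> v + \<eta> v)) (\<lambda>v. T \<xi> v + T \<eta> v)"
        using ell2_converges_add[OF T_lim[OF \<xi>] T_lim[OF \<eta>]] \<xi> \<eta> T_in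
        by (simp add: bounded_operator_add[OF bounded_poly_operator])
    qed (use \<xi> \<eta> T_in in auto)
  qed
  have "(\<lambda>n. operator_norm V (\<lambda>\<xi> v. P (q n) \<xi> v - T \<xi> v)) \<longlonglongrightarrow> 0"
    if q: "uniform_limit \<Sigma> (\<lambda>n. poly (q n)) f sequentially" for q
  proof (rule LIMSEQ_I)
    fix e :: real assume "e > 0"
    then have "e / 2 > 0" by simp
    then obtain M where M: "\<And>n z. n \<ge> M \<Longrightarrow> z \<in> \<Sigma> \<Longrightarrow> cmod (poly (q n) z - f z) < e / 2"
      using q unfolding uniform_limit_sequentially_iff dist_norm by blast
    have "norm (operator_norm V (\<lambda>\<xi> v. P (q n) \<xi> v - T \<xi> v) - 0) < e" if n: "n \<ge> M" for n
    proof -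
      have "operator_norm V (\<lambda>\<xi> v. P (q n) \<xi> v - T \<xi> v) \<le> e / 2"
        using approx[of _ "q n" "e / 2"] M[OF n] \<open>e > 0\<close>
        by (intro operator_norm_le) (auto simp: less_imp_le)
      moreover have "0 \<le> operator_norm V (\<lambda>\<xi> v. P (q n) \<xi> v - T \<xi> v)"
        by (intro operator_norm_nonneg bounded_operator_minus bounded_poly_operator bounded_T)
      ultimately show ?thesis using \<open>e > 0\<close> by simp
    qed
    then show "\<exists>M. \<forall>n\<ge>M. norm (operator_norm V (\<lambda>\<xi> v. P (q n) \<xi> v - T \<xi> v) - 0) < e" by blast
  qed
  with bounded_T have "calculus_operator f T" by (simp add: calculus_operator_def T_def)
  then show ?thesis by blast
qed

section \<open>Rules and positivity of the functional calculus\<close>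

abbreviation "fc \<equiv> functional_calculus V A"

lemma calculus_operator_fc:
  assumes "continuous_on \<Sigma> f"
  shows "calculus_operator f (fc f)"
proof -
  have "\<exists>!T. calculus_operator f T"
    using calculus_operator_exists[OF assms] calculus_operator_unique[OF assms] by blast
  then have "calculus_operator f (THE T. calculus_operator f T)" by (rule theI')
  then show ?thesis by (simp add: functional_calculus_def calculus_operator_def)
qed

lemma bounded_fc: "continuous_on \<Sigma> f \<Longrightarrow> bounded_operator V (fc f)"
  using calculus_operator_fc[of f] by (simp add: calculus_operator_def)

lemma fc_in [simp]: "continuous_on \<Sigma> f \<Longrightarrow> \<xi> \<in> ell2 V \<Longrightarrow> fc f \<xi> \<in> ell2 V"
  using bounded_operator_in[OF bounded_fc] .

lemma fc_converges:
  assumes "continuous_on \<Sigma> f" "uniform_limit \<Sigma> (\<lambda>n. poly (p n)) f sequentially" "\<xi> \<in> ell2 V"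
  shows "ell2_converges V (\<lambda>n. P (p n) \<xi>) (fc f \<xi>)"
  using calculus_operator_converges[OF calculus_operator_fc] assms by blast

text \<open>A single convenient approximating sequence identifies f(A) xi. In particular it allows
  \<open>f\<close> to be replaced by a function that agrees with it on the spectrum only.\<close>

lemma fc_eqI:
  assumes "continuous_on \<Sigma> f" "uniform_limit \<Sigma> (\<lambda>n. poly (p n)) f sequentially"
    and "\<xi> \<in> ell2 V" "\<eta> \<in> ell2 V" "ell2_converges V (\<lambda>n. P (p n) \<xi>) \<eta>"
  shows "fc f \<xi> = \<eta>"
  using ell2_converges_unique[OF fc_converges[OF assms(1,2,3)] assms(5)] assms by simp

lemma fc_one: "\<xi> \<in> ell2 V \<Longrightarrow> fc (\<lambda>z. 1) \<xi> = \<xi>"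
  by (rule fc_eqI[where p = "\<lambda>n. 1"])
     (auto simp: uniform_limit_sequentially_iff ell2_converges_def poly_operator_def)

lemma fc_add:
  assumes f: "continuous_on \<Sigma> f" and g: "continuous_on \<Sigma> g" and \<xi>: "\<xi> \<in> ell2 V"
  shows "fc (\<lambda>z. f z + g z) \<xi> = (\<lambda>v. fc f \<xi> v + fc g \<xi> v)"
proof -
  obtain p where p: "uniform_limit \<Sigma> (\<lambda>n. poly (p n)) f sequentially" using uniform_limit_polys[OF f] .
  obtain q where q: "uniform_limit \<Sigma> (\<lambda>n. poly (q n)) g sequentially" using uniform_limit_polys[OF g] .
  show ?thesis
  proof (rule fc_eqI[where p = "\<lambda>n. p n + q n"])
    show "uniform_limit \<Sigma> (\<lambda>n. poly (p n + q n)) (\<lambda>z. f z + g z) sequentially"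
      using uniform_limit_add[OF p q] by (simp add: uniform_limit_sequentially_iff)
    show "ell2_converges V (\<lambda>n. P (p n + q n) \<xi>) (\<lambda>v. fc f \<xi> v + fc g \<xi> v)"
      unfolding poly_operator_add
      using fc_converges[OF f p \<xi>] fc_converges[OF g q \<xi>] f g \<xi> by (intro ell2_converges_add) auto
  qed (use f g \<xi> in \<open>auto intro: continuous_intros\<close>)
qed

lemma fc_scale:
  assumes f: "continuous_on \<Sigma> f" and \<xi>: "\<xi> \<in> ell2 V"
  shows "fc (\<lambda>z. c * f z) \<xi> = (\<lambda>v. c * fc f \<xi> v)"
proof -
  obtain p where p: "uniform_limit \<Sigma> (\<lambda>n. poly (p n)) f sequentially" using uniform_limit_polys[OF f] .
  show ?thesis
  proof (rule fc_eqI[where p = "\<lambda>n. smult c (p n)"])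
    show "uniform_limit \<Sigma> (\<lambda>n. poly (smult c (p n))) (\<lambda>z. c * f z) sequentially"
      using bounded_linear.uniform_limit[OF bounded_linear_mult_right p, of c]
      by (simp add: uniform_limit_sequentially_iff)
    show "ell2_converges V (\<lambda>n. P (smult c (p n)) \<xi>) (\<lambda>v. c * fc f \<xi> v)"
      unfolding poly_operator_smult using fc_converges[OF f p \<xi>] by (rule ell2_converges_scale)
  qed (use f \<xi> in \<open>auto intro: continuous_intros\<close>)
qed

text \<open>If p_n tends to \<open>g\<close>, then \<open>map_poly cnj (p n) * p n\<close> tends to
  |g|^2 on the spectrum, the products converging uniformly because \<open>g\<close> is bounded
  there. For each n the adjoint formula gives the identity exactly, and both sides pass to the
  limit.\<close>

lemma inner_fc_abs_square:
  assumes g: "continuous_on \<Sigma> g" and \<xi>: "\<xi> \<in> ell2 V"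
  shows "ell2_inner V (fc (\<lambda>z. of_real ((cmod (g z))\<^sup>2)) \<xi>) \<xi> = of_real ((ell2_norm V (fc g \<xi>))\<^sup>2)"
proof -
  let ?f = "\<lambda>z. complex_of_real ((cmod (g z))\<^sup>2)"
  obtain p where p: "uniform_limit \<Sigma> (\<lambda>n. poly (p n)) g sequentially" using uniform_limit_polys[OF g] .
  let ?q = "\<lambda>n. map_poly cnj (p n) * p n"
  have "compact (g ` \<Sigma>)" "compact ((\<lambda>z. cnj (g z)) ` \<Sigma>)"
    by (intro compact_continuous_image compact_spectrum bounded g continuous_intros)+
  then have "uniform_limit \<Sigma> (\<lambda>n z. cnj (poly (p n) z) * poly (p n) z) (\<lambda>z. cnj (g z) * g z) sequentially"
    using p by (intro uniform_lim_mult bounded_linear_uniform_limit_intros compact_imp_bounded)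
  then have q: "uniform_limit \<Sigma> (\<lambda>n. poly (?q n)) ?f sequentially"
    by (rule uniform_limit_cong'[THEN iffD1, rotated 2])
       (simp_all add: poly_map_cnj_spectrum complex_norm_square mult.commute del: poly_map_poly_cnj of_real_power)
  have cont: "continuous_on \<Sigma> ?f" by (intro continuous_intros g)
  have "(\<lambda>n. ell2_inner V (P (?q n) \<xi>) \<xi>) \<longlonglongrightarrow> ell2_inner V (fc ?f \<xi>) \<xi>"
    using fc_converges[OF cont q \<xi>] cont \<xi> by (intro ell2_converges_inner) auto
  moreover have "ell2_inner V (P (?q n) \<xi>) \<xi> = of_real ((ell2_norm V (P (p n) \<xi>))\<^sup>2)" for n
    using \<xi> poly_operator_adjoint[of "P (p n) \<xi>" \<xi> "map_poly cnj (p n)"]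
    by (simp add: poly_operator_mult map_poly_map_poly o_def ell2_inner_self)
  moreover have "(\<lambda>n. complex_of_real ((ell2_norm V (P (p n) \<xi>))\<^sup>2)) \<longlonglongrightarrow> of_real ((ell2_norm V (fc g \<xi>))\<^sup>2)"
    using fc_converges[OF g p \<xi>] g \<xi> by (intro tendsto_intros ell2_converges_norm) auto
  ultimately show ?thesis using LIMSEQ_unique by simp
qed

text \<open>Off the spectrum \<open>h\<close> may be negative, and there the square of
  \<open>cmod (sqrt (h z))\<close> is |h z|. The two functions therefore agree only on the spectrum,
  and their operators are compared through a common approximating sequence.\<close>

lemma inner_fc_nonneg:
  fixes h :: "complex \<Rightarrow> real"
  assumes h: "continuous_on \<Sigma> h" "\<And>z. z \<in> \<Sigma> \<Longrightarrow> 0 \<le> h z" and \<xi>: "\<xi> \<in> ell2 V"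
  shows "ell2_inner V (fc (\<lambda>z. of_real (h z)) \<xi>) \<xi>
    = of_real ((ell2_norm V (fc (\<lambda>z. of_real (sqrt (h z))) \<xi>))\<^sup>2)"
proof -
  let ?g = "\<lambda>z. complex_of_real (sqrt (h z))"
  have g: "continuous_on \<Sigma> ?g" by (intro continuous_intros h)
  have f: "continuous_on \<Sigma> (\<lambda>z. complex_of_real (h z))" by (intro continuous_intros h)
  obtain p where p: "uniform_limit \<Sigma> (\<lambda>n. poly (p n)) (\<lambda>z. complex_of_real (h z)) sequentially"
    using uniform_limit_polys[OF f] .
  have eq: "complex_of_real ((cmod (?g z))\<^sup>2) = of_real (h z)" if "z \<in> \<Sigma>" for z
    using h(2)[OF that] by simp
  have f': "continuous_on \<Sigma> (\<lambda>z. complex_of_real ((cmod (?g z))\<^sup>2))" by (intro continuous_intros g)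
  have "uniform_limit \<Sigma> (\<lambda>n. poly (p n)) (\<lambda>z. complex_of_real ((cmod (?g z))\<^sup>2)) sequentially"
    using p by (rule uniform_limit_cong'[THEN iffD1, rotated 2]) (use eq in auto)
  from fc_eqI[OF f' this \<xi> _ fc_converges[OF f p \<xi>]]
  have "fc (\<lambda>z. complex_of_real ((cmod (?g z))\<^sup>2)) \<xi> = fc (\<lambda>z. of_real (h z)) \<xi>" using f \<xi> by simp
  then show ?thesis using inner_fc_abs_square[OF g \<xi>] by simp
qed

end

section \<open>Finite measures and continuous functions\<close>

text \<open>Off a closed set the distance is positive, so the cut-off is eventually zero.
  Nonemptiness matters because \<open>infdist x {}\<close> is 0.\<close>

lemma LIMSEQ_infdist_cutoff:
  fixes K :: "'a::metric_space set"
  assumes "closed K" "K \<noteq> {}"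
  shows "(\<lambda>n. max 0 (1 - real n * infdist x K)) \<longlonglongrightarrow> indicator K x"
proof (cases "x \<in> K")
  case True
  then show ?thesis by simp
next
  case False
  then have pos: "0 < infdist x K"
    using assms infdist_nonneg[of x K] in_closed_iff_infdist_zero[of K x] by fastforce
  obtain N where N: "1 / infdist x K < real N" using reals_Archimedean2 by blast
  have "max 0 (1 - real n * infdist x K) = 0" if "n \<ge> N" for n
  proof -
    have "1 / infdist x K \<le> real n" using N that by linarith
    then show ?thesis using pos by (simp add: pos_divide_le_eq)
  qed
  then have "\<forall>\<^sub>F n in sequentially. max 0 (1 - real n * infdist x K) = 0"
    unfolding eventually_sequentially by blast
  then show ?thesis using False by (simp add: tendsto_eventually)
qed

text \<open>Continuous cut-off functions give the inequality on compact sets; inner regularity extends it.\<close>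

lemma measure_le_by_continuous:
  fixes M N :: "'a::{second_countable_topology, complete_space} measure"
  assumes S: "closed S"
    and M: "finite_measure M" "sets M = sets (restrict_space borel S)"
    and N: "finite_measure N" "sets N = sets (restrict_space borel S)"
    and C: "0 \<le> C"
    and le: "\<And>f :: 'a \<Rightarrow> real. continuous_on S f \<Longrightarrow> (\<And>x. x \<in> S \<Longrightarrow> 0 \<le> f x \<and> f x \<le> 1) \<Longrightarrow>
      (\<integral>x. f x \<partial>M) \<le> C * (\<integral>x. f x \<partial>N) + d"
    and B: "B \<in> sets M"
  shows "measure M B \<le> C * measure N B + d"
proof -
  interpret M: finite_measure M by fact
  interpret N: finite_measure N by fact
  have space: "space M = S" "space N = S"
    using sets_eq_imp_space_eq[OF M(2)] sets_eq_imp_space_eq[OF N(2)] by (simp_all add: space_restrict_space)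
  have S_borel: "S \<inter> space borel \<in> sets borel" using S by simp
  have sets_iff: "A \<in> sets M \<longleftrightarrow> A \<subseteq> S \<and> A \<in> sets borel" "A \<in> sets N \<longleftrightarrow> A \<subseteq> S \<and> A \<in> sets borel" for A
    unfolding M(2) N(2) sets_restrict_space_iff[OF S_borel] by simp_all
  \<comment> \<open>The zero test function; the sign is what the empty compact set and the passage
    to \<open>ennreal\<close> require.\<close>
  have d: "0 \<le> d" using le[of "\<lambda>x. 0"] by simp
  have compact_le: "measure M K \<le> C * measure N K + d" if K: "compact K" "K \<subseteq> S" for K
  proof (cases "K = {}")
    case True
    then show ?thesis using d by simp
  next
    case False
    have clK: "closed K" using K by (simp add: compact_imp_closed)
    let ?f = "\<lambda>n x. max 0 (1 - real n * infdist x K)"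
    have cont: "continuous_on T (?f n)" for T n by (intro continuous_intros)
    have lim: "(\<lambda>n. \<integral>x. ?f n x \<partial>L) \<longlonglongrightarrow> measure L K"
      if L: "finite_measure L" "sets L = sets (restrict_space borel S)" "K \<in> sets L" for L
    proof -
      interpret L: finite_measure L by fact
      have meas: "g \<in> borel_measurable L" if "g \<in> borel_measurable borel" for g :: "'a \<Rightarrow> real"
        unfolding measurable_cong_sets[OF L(2) refl] using that by (rule measurable_restrict_space1)
      have "(\<lambda>n. \<integral>x. ?f n x \<partial>L) \<longlonglongrightarrow> (\<integral>x. indicator K x \<partial>L)"
      proof (rule integral_dominated_convergence[where w = "\<lambda>x. 1"])
        show "(indicator K :: 'a \<Rightarrow> real) \<in> borel_measurable L" using L(3) by simp
        show "(?f n) \<in> borel_measurable L" for n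
          by (intro meas borel_measurable_continuous_onI cont)
        show "AE x in L. (\<lambda>n. ?f n x) \<longlonglongrightarrow> indicator K x"
          using LIMSEQ_infdist_cutoff[OF clK False] by simp
        show "AE x in L. norm (?f n x) \<le> 1" for n
          by (simp add: infdist_nonneg)
      qed simp
      then show ?thesis using L(3) sets.sets_into_space[OF L(3)] by (simp add: Int_absorb2)
    qed
    have K_sets: "K \<in> sets M" "K \<in> sets N" using K clK by (simp_all add: sets_iff)
    have "measure M K \<le> C * measure N K + d"
    proof (rule LIMSEQ_le)
      show "(\<lambda>n. \<integral>x. ?f n x \<partial>M) \<longlonglongrightarrow> measure M K" using lim M K_sets by blast
      show "(\<lambda>n. C * (\<integral>x. ?f n x \<partial>N) + d) \<longlonglongrightarrow> C * measure N K + d"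
        by (intro tendsto_intros lim N K_sets)
      show "\<exists>m. \<forall>n\<ge>m. (\<integral>x. ?f n x \<partial>M) \<le> C * (\<integral>x. ?f n x \<partial>N) + d"
        using le[OF cont] by (simp add: infdist_nonneg)
    qed
    then show ?thesis .
  qed
  \<comment> \<open>Inner regularity is a statement on measures over the whole Borel algebra, so
    \<open>M\<close> is pushed forward from \<open>S\<close>; on Borel subsets of \<open>S\<close>
    nothing changes.\<close>
  define M' where "M' = distr M borel (\<lambda>x. x)"
  have id: "(\<lambda>x. x) \<in> measurable M borel"
    unfolding measurable_cong_sets[OF M(2) refl] by (rule measurable_restrict_space1) simp
  have M': "emeasure M' A = emeasure M A" if "A \<subseteq> S" "A \<in> sets borel" for A
    using that id by (simp add: M'_def emeasure_distr space Int_absorb2)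
  have B': "B \<subseteq> S" "B \<in> sets borel" using B by (simp_all add: sets_iff)
  have fin: "emeasure M' (space M') \<noteq> \<infinity>"
    using id by (simp add: M'_def emeasure_distr M.emeasure_eq_measure)
  have "ennreal (measure M B) = emeasure M' B"
    using M'[OF B'] by (simp add: M.emeasure_eq_measure)
  also have "\<dots> = (SUP K \<in> {K. K \<subseteq> B \<and> compact K}. emeasure M' K)"
    using B'(2) by (intro inner_regular fin) (simp_all add: M'_def)
  also have "\<dots> \<le> ennreal (C * measure N B + d)"
  proof (rule SUP_least)
    fix K assume "K \<in> {K. K \<subseteq> B \<and> compact K}"
    then have K: "K \<subseteq> B" "compact K" by auto
    then have "emeasure M' K = ennreal (measure M K)"
      using B' M'[of K] by (simp add: compact_imp_closed M.emeasure_eq_measure)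
    also have "\<dots> \<le> ennreal (C * measure N K + d)"
      using compact_le[of K] K B' by (intro ennreal_leI) auto
    also have "\<dots> \<le> ennreal (C * measure N B + d)"
      using K B B' C by (intro ennreal_leI add_right_mono mult_left_mono N.finite_measure_mono)
        (auto simp: sets_iff)
    finally show "emeasure M' K \<le> ennreal (C * measure N B + d)" .
  qed
  finally show ?thesis using C d by (simp del: ennreal_plus)
qed

lemma measure_eq_by_continuous:
  fixes M N :: "'a::{second_countable_topology, complete_space} measure"
  assumes S: "closed S"
    and M: "finite_measure M" "sets M = sets (restrict_space borel S)"
    and N: "finite_measure N" "sets N = sets (restrict_space borel S)"
    and eq: "\<And>f :: 'a \<Rightarrow> real. continuous_on S f \<Longrightarrow> (\<integral>x. f x \<partial>M) = (\<integral>x. f x \<partial>N)"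
  shows "M = N"
proof (rule measure_eqI)
  show "sets M = sets N" using M(2) N(2) by simp
  fix B assume B: "B \<in> sets M"
  have "measure M B \<le> 1 * measure N B + 0"
    using B eq by (intro measure_le_by_continuous[OF S M N]) auto
  moreover have "measure N B \<le> 1 * measure M B + 0"
    using B eq M(2) N(2) by (intro measure_le_by_continuous[OF S N M]) auto
  ultimately show "emeasure M B = emeasure N B"
    by (simp add: finite_measure.emeasure_eq_measure[OF M(1)] finite_measure.emeasure_eq_measure[OF N(1)])
qed

subsection \<open>The Riesz representation theorem on compact sets of reals\<close>

text \<open>A positive functional \<open>L\<close> with \<open>L 1 = 1\<close> sends the Bernstein polynomials of degree \<open>n\<close>, which
  form a partition of unity, to the weights of a discrete probability measure at the nodes \<open>k/n\<close>;
  any weak limit of these measures represents \<open>L\<close>.\<close>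

lemma Riesz_normalized_bounded_continuous:
  fixes L :: "(real \<Rightarrow> real) \<Rightarrow> real"
  assumes K: "K \<subseteq> {a..b}" "a < b"
    and add: "\<And>f g. continuous_on K f \<Longrightarrow> continuous_on K g \<Longrightarrow> L (\<lambda>x. f x + g x) = L f + L g"
    and scale: "\<And>c f. continuous_on K f \<Longrightarrow> L (\<lambda>x. c * f x) = c * L f"
    and nonneg: "\<And>f. continuous_on K f \<Longrightarrow> (\<And>x. x \<in> K \<Longrightarrow> 0 \<le> f x) \<Longrightarrow> 0 \<le> L f"
    and one: "L (\<lambda>x. 1) = 1"
  shows "\<exists>M. real_distribution M \<and>
    (\<forall>g. continuous_on UNIV g \<longrightarrow> (\<exists>B. \<forall>x. \<bar>g x\<bar> \<le> B) \<longrightarrow> (\<integral>x. g x \<partial>M) = L g)"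
proof -
  have mono: "L f \<le> L g" if "continuous_on K f" "continuous_on K g" "\<And>x. x \<in> K \<Longrightarrow> f x \<le> g x" for f g
  proof -
    have "0 \<le> L (\<lambda>x. g x + (-1) * f x)"
      using that by (intro nonneg) (auto intro!: continuous_intros)
    also have "\<dots> = L g + L (\<lambda>x. (-1) * f x)" using that by (intro add continuous_intros) auto
    also have "L (\<lambda>x. (-1) * f x) = (-1) * L f" using that by (intro scale)
    finally show ?thesis by simp
  qed
  have sum: "L (\<lambda>x. \<Sum>i\<in>I. f i x) = (\<Sum>i\<in>I. L (f i))"
    if "finite I" "\<And>i. i \<in> I \<Longrightarrow> continuous_on K (f i)" for I :: "nat set" and f
    using that
  proof (induction I)
    case empty
    then show ?case using scale[of "\<lambda>x. 0" 0] by simp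
  next
    case (insert i I)
    then show ?case using add[of "f i" "\<lambda>x. \<Sum>i\<in>I. f i x"] by (auto intro!: continuous_intros)
  qed
  \<comment> \<open>Mutually inverse affine maps between [a, b] and the unit interval on which
    Bernstein polynomials are defined.\<close>
  define \<phi> where "\<phi> x = (x - a) / (b - a)" for x
  define \<psi> where "\<psi> s = a + (b - a) * s" for s
  have \<psi>\<phi>: "\<psi> (\<phi> x) = x" for x using K(2) by (simp add: \<phi>_def \<psi>_def)
  have \<phi>: "\<phi> x \<in> {0..1}" if "x \<in> K" for x using that K by (auto simp: \<phi>_def divide_simps)
  define w where "w n k = L (\<lambda>x. Bernstein n k (\<phi> x))" for n k
  have Bcont: "continuous_on T (\<lambda>x. Bernstein n k (\<phi> x))" for T n k
    unfolding Bernstein_def \<phi>_def using K(2) by (intro continuous_intros) auto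
  have w: "0 \<le> w n k" for n k
    unfolding w_def using \<phi> by (intro nonneg Bcont Bernstein_nonneg) auto
  have w_sum: "(\<Sum>k\<le>n. w n k) = 1" for n
    unfolding w_def using sum[of "{..n}" "\<lambda>k x. Bernstein n k (\<phi> x)"] Bcont one by simp
  define \<mu> where "\<mu> n = distr (point_measure {..n} (\<lambda>k. ennreal (w n k))) borel (\<lambda>k. \<psi> (k / n))" for n
  have meas: "(\<lambda>k. \<psi> (k / n)) \<in> measurable (point_measure {..n} (\<lambda>k. ennreal (w n k))) borel" for n :: nat
    by (simp add: measurable_def space_point_measure sets_point_measure)
  have \<mu>_integral: "(\<integral>x. g x \<partial>\<mu> n) = (\<Sum>k\<le>n. w n k * g (\<psi> (k / n)))"
    if "g \<in> borel_measurable borel" for g :: "real \<Rightarrow> real" and n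
    unfolding \<mu>_def using that w
    by (subst integral_distr[OF meas]) (simp_all add: lebesgue_integral_point_measure_finite)
  have \<mu>_all: "emeasure (\<mu> n) A = 1" if A: "A \<in> sets borel" "{a..b} \<subseteq> A" for n A
  proof -
    have "\<psi> (k / n) \<in> {a..b}" if "k \<le> n" for k
    proof -
      \<comment> \<open>For \<open>n = 0\<close> division by zero gives the node 0, which still lies
        in the unit interval.\<close>
      have s: "0 \<le> real k / n" "real k / n \<le> 1" using that by (simp_all add: divide_simps)
      then have "(b - a) * (real k / n) \<le> (b - a) * 1" "0 \<le> (b - a) * (real k / n)"
        using K(2) by (intro mult_left_mono mult_nonneg_nonneg; simp)+
      then show ?thesis by (simp add: \<psi>_def)
    qed
    then have "(\<lambda>k. \<psi> (real k / real n)) -` A \<inter> {..n} = {..n}" using A(2) by blast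
    then have "emeasure (\<mu> n) A = (\<Sum>k\<le>n. ennreal (w n k))"
      unfolding \<mu>_def using A(1)
      by (subst emeasure_distr[OF meas]) (simp_all add: space_point_measure emeasure_point_measure_finite)
    also have "\<dots> = 1" using w w_sum[of n] by (simp add: sum_ennreal)
    finally show ?thesis .
  qed
  have \<mu>_dist: "real_distribution (\<mu> n)" for n
  proof -
    have "space (\<mu> n) = UNIV" by (simp add: \<mu>_def)
    then have "prob_space (\<mu> n)" by (intro prob_spaceI) (simp add: \<mu>_all)
    then show ?thesis
      by (simp add: real_distribution_def real_distribution_axioms_def \<mu>_def)
  qed
  have "tight \<mu>"
    unfolding tight_def
  proof (intro conjI allI impI)
    fix e :: real assume "e > 0"
    \<comment> \<open>Tightness is phrased with intervals open on the left, so the interval starts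
      at \<open>a - 1\<close> to contain all of [a, b].\<close>
    have "measure (\<mu> n) {a - 1<..b} = 1" for n
      using \<mu>_all[of "{a - 1<..b}" n] by (simp add: measure_def subset_iff)
    then show "\<exists>a b. a < b \<and> (\<forall>n. 1 - e < measure (\<mu> n) {a<..b})"
      using K(2) \<open>e > 0\<close> by (intro exI[of _ "a - 1"] exI[of _ b]) simp
  qed (rule \<mu>_dist)
  then obtain r M where r: "strict_mono r" and M: "real_distribution M"
    and conv: "weak_conv_m (\<mu> \<circ> id \<circ> r) M"
    using tight_imp_convergent_subsubsequence[of \<mu> id] by (auto simp: strict_mono_def)
  have "(\<integral>x. g x \<partial>M) = L g" if g: "continuous_on UNIV g" and bdd: "\<exists>B. \<forall>x. \<bar>g x\<bar> \<le> B" for g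
  proof -
    obtain B where B: "\<And>x. \<bar>g x\<bar> \<le> B" using bdd by blast
    have g_at: "isCont g x" for x using g by (simp add: continuous_on_eq_continuous_at)
    have gK: "continuous_on K g" using g continuous_on_subset by blast
    have "(\<lambda>n. \<integral>x. g x \<partial>(\<mu> \<circ> id \<circ> r) n) \<longlonglongrightarrow> (\<integral>x. g x \<partial>M)"
      using weak_conv_imp_integral_bdd_continuous_conv[of "\<mu> \<circ> id \<circ> r" M g B] \<mu>_dist M conv g_at B
      by (simp add: o_def)
    moreover have "(\<lambda>n. \<integral>x. g x \<partial>\<mu> n) \<longlonglongrightarrow> L g"
    proof (rule LIMSEQ_I)
      fix e :: real assume e: "e > 0"
      have "continuous_on {0..1} (\<lambda>s. g (\<psi> s))"
        unfolding \<psi>_def by (intro continuous_on_compose2[OF g] continuous_intros) auto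
      from Bernstein_Weierstrass[OF this, of "e / 2"] e obtain N where
        N: "\<And>n s. N \<le> n \<Longrightarrow> s \<in> {0..1} \<Longrightarrow> \<bar>g (\<psi> s) - (\<Sum>k\<le>n. g (\<psi> (k / n)) * Bernstein n k s)\<bar> < e / 2"
        by auto
      have "norm ((\<integral>x. g x \<partial>\<mu> n) - L g) < e" if n: "n \<ge> N" for n
      proof -
        \<comment> \<open>The Bernstein polynomial of \<open>g\<close>. Integrating \<open>g\<close>
          against \<open>\<mu> n\<close> is applying \<open>L\<close> to it, and it lies within
          \<open>e / 2\<close> of \<open>g\<close> on \<open>K\<close>; monotonicity and L 1 = 1
          turn this into the bound for \<open>L\<close>.\<close>
        let ?h = "\<lambda>x. \<Sum>k\<le>n. g (\<psi> (k / n)) * Bernstein n k (\<phi> x)"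
        have h: "continuous_on K ?h" by (intro continuous_intros Bcont)
        have "L ?h = (\<Sum>k\<le>n. L (\<lambda>x. g (\<psi> (k / n)) * Bernstein n k (\<phi> x)))"
          by (intro sum continuous_intros Bcont) simp
        also have "\<dots> = (\<Sum>k\<le>n. w n k * g (\<psi> (k / n)))"
          unfolding scale[OF Bcont] by (simp add: w_def mult.commute)
        also have "\<dots> = (\<integral>x. g x \<partial>\<mu> n)"
          using g by (simp add: \<mu>_integral borel_measurable_continuous_onI)
        finally have "(\<integral>x. g x \<partial>\<mu> n) = L ?h" ..
        moreover have le: "?h x \<le> g x + e / 2 * 1" "g x \<le> ?h x + e / 2 * 1" if "x \<in> K" for x
          using N[OF n \<phi>[OF that]] unfolding \<psi>\<phi> by linarith+
        moreover have shift: "L (\<lambda>x. f x + e / 2 * 1) = L f + e / 2" if "continuous_on K f" for f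
          using add[OF that, of "\<lambda>x. e / 2 * 1"] scale[of "\<lambda>x. 1" "e / 2"] one by simp
        have "L ?h \<le> L (\<lambda>x. g x + e / 2 * 1)"
          by (intro mono le h gK continuous_on_add continuous_on_const)
        moreover have "L g \<le> L (\<lambda>x. ?h x + e / 2 * 1)"
          by (intro mono le h gK continuous_on_add continuous_on_const)
        ultimately show ?thesis using e shift[OF h] shift[OF gK] by simp
      qed
      then show "\<exists>N. \<forall>n\<ge>N. norm ((\<integral>x. g x \<partial>\<mu> n) - L g) < e" by blast
    qed
    then have "(\<lambda>n. \<integral>x. g x \<partial>(\<mu> \<circ> id \<circ> r) n) \<longlonglongrightarrow> L g"
      using LIMSEQ_subseq_LIMSEQ[OF _ r] by (fastforce simp: o_def)
    ultimately show ?thesis by (rule LIMSEQ_unique)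
  qed
  with M show ?thesis by blast
qed

text \<open>If L 1 = 0, monotonicity forces L = 0. Otherwise L / t with t = L 1 is represented by a
  probability measure on the line, which is concentrated on \<open>K\<close> because a function that
  vanishes exactly on \<open>K\<close> has integral zero; restricting to \<open>K\<close> and
  multiplying by \<open>t\<close> gives the measure. The Tietze theorem reaches all continuous
  functions on \<open>K\<close> through bounded continuous ones on the line.\<close>

lemma Riesz_compact_real:
  fixes L :: "(real \<Rightarrow> real) \<Rightarrow> real"
  assumes K: "compact K"
    and add: "\<And>f g. continuous_on K f \<Longrightarrow> continuous_on K g \<Longrightarrow> L (\<lambda>x. f x + g x) = L f + L g"
    and scale: "\<And>c f. continuous_on K f \<Longrightarrow> L (\<lambda>x. c * f x) = c * L f"
    and nonneg: "\<And>f. continuous_on K f \<Longrightarrow> (\<And>x. x \<in> K \<Longrightarrow> 0 \<le> f x) \<Longrightarrow> 0 \<le> L f"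
  shows "\<exists>M. finite_measure M \<and> sets M = sets (restrict_space borel K) \<and>
    (\<forall>f. continuous_on K f \<longrightarrow> (\<integral>x. f x \<partial>M) = L f)"
proof -
  have mono: "L f \<le> L g" if "continuous_on K f" "continuous_on K g" "\<And>x. x \<in> K \<Longrightarrow> f x \<le> g x" for f g
  proof -
    have "0 \<le> L (\<lambda>x. g x + (-1) * f x)"
      using that by (intro nonneg) (auto intro!: continuous_intros)
    also have "\<dots> = L g + L (\<lambda>x. (-1) * f x)" using that by (intro add continuous_intros) auto
    also have "L (\<lambda>x. (-1) * f x) = (-1) * L f" using that by (intro scale)
    finally show ?thesis by simp
  qed
  \<comment> \<open>The argument of \<open>L\<close> is a function on the whole line; positivity
    makes the value depend on its restriction to \<open>K\<close> alone.\<close>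
  have cong: "L f = L g" if "continuous_on K f" "continuous_on K g" "\<And>x. x \<in> K \<Longrightarrow> f x = g x" for f g
    using mono[of f g] mono[of g f] that by force
  define t where "t = L (\<lambda>x. 1)"
  have t: "0 \<le> t" unfolding t_def by (intro nonneg) auto
  have bdd: "\<exists>B\<ge>0. \<forall>x\<in>K. \<bar>f x\<bar> \<le> B" if "continuous_on K f" for f :: "real \<Rightarrow> real"
  proof -
    have "bounded (f ` K)" using compact_continuous_image[OF that K] by (rule compact_imp_bounded)
    then obtain B where "\<forall>x\<in>K. \<bar>f x\<bar> \<le> B" by (auto simp: bounded_iff)
    then show ?thesis by (intro exI[of _ "\<bar>B\<bar>"]) auto
  qed
  show ?thesis
  proof (cases "t = 0")
    case True
    have "L f = 0" if f: "continuous_on K f" for f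
    proof -
      obtain B where B: "\<And>x. x \<in> K \<Longrightarrow> \<bar>f x\<bar> \<le> B" using bdd[OF f] by blast
      have "L f \<le> L (\<lambda>x. B * 1)" "L (\<lambda>x. (-B) * 1) \<le> L f"
        using B f by (auto intro!: mono simp: abs_le_iff minus_le_iff)
      then show ?thesis
        using True scale[of "\<lambda>x. 1" B] scale[of "\<lambda>x. 1" "-B"] by (simp add: t_def)
    qed
    then show ?thesis
      by (intro exI[of _ "null_measure (restrict_space borel K)"]) (auto intro!: finite_measureI)
  next
    case False
    with t have t: "0 < t" by simp
    have K0: "K \<noteq> {}"
    proof
      assume "K = {}"
      then have "L (\<lambda>x. 1) = L (\<lambda>x. 0 * 1)" by (intro cong) auto
      then show False using scale[of "\<lambda>x. 1" 0] t by (simp add: t_def)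
    qed
    have clK: "closed K" using K by (rule compact_imp_closed)
    obtain R where R: "\<And>x. x \<in> K \<Longrightarrow> \<bar>x\<bar> \<le> R" using compact_imp_bounded[OF K] by (auto simp: bounded_iff)
    \<comment> \<open>The margin 1 keeps the interval nondegenerate.\<close>
    have "K \<subseteq> {- \<bar>R\<bar> - 1..\<bar>R\<bar> + 1}" using R by (force simp: abs_le_iff)
    then have "\<exists>M. real_distribution M \<and>
      (\<forall>g. continuous_on UNIV g \<longrightarrow> (\<exists>B. \<forall>x. \<bar>g x\<bar> \<le> B) \<longrightarrow> (\<integral>x. g x \<partial>M) = (\<lambda>f. L f / t) g)"
      by (rule Riesz_normalized_bounded_continuous)
         (use t in \<open>auto simp: add scale add_divide_distrib t_def intro!: nonneg divide_nonneg_pos\<close>)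
    then obtain M where "real_distribution M"
      and M: "\<And>g B. continuous_on UNIV g \<Longrightarrow> (\<And>x. \<bar>g x\<bar> \<le> B) \<Longrightarrow> (\<integral>x. g x \<partial>M) = L g / t" by blast
    interpret M: real_distribution M by fact
    have M_meas: "g \<in> borel_measurable M" if "continuous_on UNIV g" for g :: "real \<Rightarrow> real"
      using that by (simp add: measurable_cong_sets[OF M.events_eq_borel refl] borel_measurable_continuous_onI)
    \<comment> \<open>The distance to \<open>K\<close>, truncated at 1 so that it is a bounded test
      function.\<close>
    let ?\<delta> = "\<lambda>x. min 1 (infdist x K)"
    have \<delta>: "continuous_on T ?\<delta>" for T by (intro continuous_intros)
    have \<delta>_bdd: "\<bar>?\<delta> x\<bar> \<le> 1" for x using infdist_nonneg[of x K] by auto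
    have "L ?\<delta> = L (\<lambda>x. 0 * 1)" using \<delta> by (intro cong) auto
    then have "(\<integral>x. ?\<delta> x \<partial>M) = 0"
      using M[of ?\<delta> 1, OF \<delta> \<delta>_bdd] scale[of "\<lambda>x. 1" 0] by simp
    moreover have "integrable M ?\<delta>"
      using \<delta>_bdd by (intro M.integrable_const_bound[of _ 1] M_meas \<delta>) simp
    ultimately have "AE x in M. ?\<delta> x = 0"
      using integral_nonneg_eq_0_iff_AE[of M ?\<delta>] by (simp add: infdist_nonneg)
    then have AE_K: "AE x in M. x \<in> K"
    proof eventually_elim
      case (elim x)
      then have "infdist x K = 0" by (auto simp: min_def split: if_splits)
      then show ?case using in_closed_iff_infdist_zero[OF clK K0] by blast
    qed
    let ?N = "density (restrict_space M K) (\<lambda>x. ennreal t)"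
    have K_sets: "K \<inter> space M \<in> sets M" using clK by simp
    have K_in: "K \<in> sets (restrict_space M K)" using sets_restrict_space_iff[OF K_sets] clK by simp
    have sets_N: "sets ?N = sets (restrict_space borel K)"
      by (simp add: sets_restrict_space)
    have "finite_measure ?N"
      using K_sets K_in t
      by (intro finite_measureI)
         (simp add: emeasure_density_const emeasure_restrict_space space_restrict_space
           M.emeasure_eq_measure ennreal_mult_eq_top_iff)
    moreover have "(\<integral>x. f x \<partial>?N) = L f" if f: "continuous_on K f" for f
    proof -
      obtain B where B: "0 \<le> B" "\<And>x. x \<in> K \<Longrightarrow> norm (f x) \<le> B" using bdd[OF f] by auto
      obtain g where g: "continuous_on UNIV g" "\<And>x. x \<in> K \<Longrightarrow> g x = f x" "\<And>x. norm (g x) \<le> B"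
        using Tietze[OF f _ B(1,2), of UNIV] clK by auto
      have f_meas: "f \<in> borel_measurable (restrict_space M K)"
        using borel_measurable_continuous_on_restrict[OF f]
        by (simp add: measurable_cong_sets[OF _ refl, of "restrict_space M K" "restrict_space borel K"]
            sets_restrict_space)
      have "(\<integral>x. f x \<partial>?N) = (\<integral>x. t *\<^sub>R f x \<partial>restrict_space M K)"
        using t f_meas by (intro integral_density) auto
      also have "\<dots> = t * (\<integral>x. indicator K x *\<^sub>R f x \<partial>M)"
        using integral_restrict_space[OF K_sets, of f] by simp
      also have "(\<integral>x. indicator K x *\<^sub>R f x \<partial>M) = (\<integral>x. indicator K x *\<^sub>R g x \<partial>M)"
        using g(2) by (intro Bochner_Integration.integral_cong) (auto simp: indicator_def)
      also have "\<dots> = (\<integral>x. g x \<partial>M)"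
        using AE_K clK g(1)
        by (intro integral_cong_AE borel_measurable_scaleR borel_measurable_indicator M_meas) auto
      also have "t * \<dots> = L g" using M[OF g(1), of B] g(3) t by simp
      also have "L g = L f" using g f by (intro cong) (auto intro: continuous_on_subset)
      finally show ?thesis .
    qed
    ultimately show ?thesis using sets_N by blast
  qed
qed

section \<open>Local spectral measures\<close>

lemma integrable_continuous_on_compact:
  fixes f :: "'a::{metric_space, second_countable_topology} \<Rightarrow> 'b::{banach, second_countable_topology}"
  assumes S: "compact S" and M: "finite_measure M" "sets M = sets (restrict_space borel S)"
    and f: "continuous_on S f"
  shows "integrable M f"
proof -
  interpret finite_measure M by fact
  have space: "space M = S" using sets_eq_imp_space_eq[OF M(2)] by (simp add: space_restrict_space)
  obtain B where "\<And>x. x \<in> S \<Longrightarrow> norm (f x) \<le> B"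
    using compact_imp_bounded[OF compact_continuous_image[OF f S]] by (auto simp: bounded_iff)
  then have "AE x in M. norm (f x) \<le> B" using space by (intro AE_I2) simp
  moreover have "f \<in> borel_measurable M"
    unfolding measurable_cong_sets[OF M(2) refl] using f by (rule borel_measurable_continuous_on_restrict)
  ultimately show ?thesis by (rule integrable_const_bound)
qed

context self_adjoint_operator
begin

text \<open>Taking \<open>Re\<close> yields a real functional, as the Riesz theorem requires; by
  \<open>inner_fc_of_real\<close> no imaginary part is lost.\<close>

definition spectral_functional :: "('a \<Rightarrow> complex) \<Rightarrow> (complex \<Rightarrow> real) \<Rightarrow> real" where
  "spectral_functional \<xi> h = Re (ell2_inner V (fc (\<lambda>z. of_real (h z)) \<xi>) \<xi>)"

lemma inner_fc_add:
  assumes "continuous_on \<Sigma> f" "continuous_on \<Sigma> g" "\<xi> \<in> ell2 V"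
  shows "ell2_inner V (fc (\<lambda>z. f z + g z) \<xi>) \<xi> = ell2_inner V (fc f \<xi>) \<xi> + ell2_inner V (fc g \<xi>) \<xi>"
  using assms by (simp add: fc_add ell2_inner_add_left)

lemma inner_fc_scale:
  assumes "continuous_on \<Sigma> f" "\<xi> \<in> ell2 V"
  shows "ell2_inner V (fc (\<lambda>z. c * f z) \<xi>) \<xi> = c * ell2_inner V (fc f \<xi>) \<xi>"
  using assms by (simp add: fc_scale ell2_inner_scale_left)

lemma spectral_functional_nonneg_eq:
  assumes "continuous_on \<Sigma> h" "\<And>z. z \<in> \<Sigma> \<Longrightarrow> 0 \<le> h z" "\<xi> \<in> ell2 V"
  shows "spectral_functional \<xi> h = (ell2_norm V (fc (\<lambda>z. of_real (sqrt (h z))) \<xi>))\<^sup>2"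
  using inner_fc_nonneg[of h \<xi>] assms by (simp add: spectral_functional_def del: of_real_power)

lemma spectral_functional_nonneg:
  assumes "continuous_on \<Sigma> h" "\<And>z. z \<in> \<Sigma> \<Longrightarrow> 0 \<le> h z" "\<xi> \<in> ell2 V"
  shows "0 \<le> spectral_functional \<xi> h"
  using spectral_functional_nonneg_eq[of h \<xi>] assms by simp

lemma spectral_functional_add:
  assumes "continuous_on \<Sigma> h" "continuous_on \<Sigma> k" "\<xi> \<in> ell2 V"
  shows "spectral_functional \<xi> (\<lambda>z. h z + k z) = spectral_functional \<xi> h + spectral_functional \<xi> k"
  unfolding spectral_functional_def using assms by (simp add: inner_fc_add continuous_on_of_real)

lemma spectral_functional_scale:
  assumes "continuous_on \<Sigma> h" "\<xi> \<in> ell2 V"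
  shows "spectral_functional \<xi> (\<lambda>z. c * h z) = c * spectral_functional \<xi> h"
  unfolding spectral_functional_def using assms by (simp add: inner_fc_scale continuous_on_of_real)

text \<open>Split \<open>h\<close> into positive and negative parts: on each the value is a squared
  norm, hence real.\<close>

lemma inner_fc_of_real:
  assumes h: "continuous_on \<Sigma> h" and \<xi>: "\<xi> \<in> ell2 V"
  shows "ell2_inner V (fc (\<lambda>z. of_real (h z)) \<xi>) \<xi> = of_real (spectral_functional \<xi> h)"
proof -
  have cont: "continuous_on \<Sigma> (\<lambda>z. complex_of_real (max (h z) 0))"
    "continuous_on \<Sigma> (\<lambda>z. complex_of_real (max (- h z) 0))"
    by (intro continuous_intros h)+
  have "(\<lambda>z. complex_of_real (h z))
    = (\<lambda>z. of_real (max (h z) 0) + (-1) * of_real (max (- h z) 0))"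
    by (auto simp: max_def)
  then have "ell2_inner V (fc (\<lambda>z. of_real (h z)) \<xi>) \<xi>
    = ell2_inner V (fc (\<lambda>z. of_real (max (h z) 0) + (-1) * of_real (max (- h z) 0)) \<xi>) \<xi>" by simp
  also have "\<dots> = ell2_inner V (fc (\<lambda>z. of_real (max (h z) 0)) \<xi>) \<xi>
      + (-1) * ell2_inner V (fc (\<lambda>z. of_real (max (- h z) 0)) \<xi>) \<xi>"
    using cont \<xi> by (subst inner_fc_add) (auto simp only: inner_fc_scale intro!: continuous_intros)
  finally have "Im (ell2_inner V (fc (\<lambda>z. of_real (h z)) \<xi>) \<xi>) = 0"
    using h \<xi> by (simp add: inner_fc_nonneg continuous_intros del: of_real_power)
  then show ?thesis by (simp add: spectral_functional_def complex_eq_iff)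
qed

lemma inner_fc_eq:
  assumes f: "continuous_on \<Sigma> f" and \<xi>: "\<xi> \<in> ell2 V"
  shows "ell2_inner V (fc f \<xi>) \<xi>
    = Complex (spectral_functional \<xi> (\<lambda>z. Re (f z))) (spectral_functional \<xi> (\<lambda>z. Im (f z)))"
proof -
  have cont: "continuous_on \<Sigma> (\<lambda>z. Re (f z))" "continuous_on \<Sigma> (\<lambda>z. Im (f z))"
    by (intro continuous_intros f)+
  have "f = (\<lambda>z. of_real (Re (f z)) + \<i> * of_real (Im (f z)))"
    by (rule ext) (rule complex_eq)
  then have "ell2_inner V (fc f \<xi>) \<xi>
    = ell2_inner V (fc (\<lambda>z. of_real (Re (f z)) + \<i> * of_real (Im (f z))) \<xi>) \<xi>"
    by (rule arg_cong)
  also have "\<dots> = of_real (spectral_functional \<xi> (\<lambda>z. Re (f z)))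
      + \<i> * of_real (spectral_functional \<xi> (\<lambda>z. Im (f z)))"
    using cont \<xi>
    by (simp add: inner_fc_add inner_fc_scale inner_fc_of_real continuous_on_of_real
        continuous_on_mult_left)
  finally show ?thesis by (simp add: Complex_eq)
qed

text \<open>The Riesz theorem above is for sets of reals, whereas the spectrum is a set of complex
  numbers. The functional is carried to the image of the spectrum under \<open>Re\<close>, and the
  measure found there is pushed back by \<open>complex_of_real\<close>.\<close>

lemma spectral_measure_exists:
  assumes \<xi>: "\<xi> \<in> ell2 V"
  shows "\<exists>\<mu>. sets \<mu> = sets (restrict_space borel \<Sigma>) \<and> finite_measure \<mu> \<and>
    (\<forall>f. continuous_on \<Sigma> f \<longrightarrow> (\<integral>x. f x \<partial>\<mu>) = ell2_inner V (fc f \<xi>) \<xi>)"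
proof -
  let ?K = "Re ` \<Sigma>"
  have K: "compact ?K"
    by (intro compact_continuous_image compact_spectrum bounded continuous_intros)
  have cont: "continuous_on \<Sigma> (\<lambda>z. g (Re z))" if "continuous_on ?K g" for g :: "real \<Rightarrow> real"
    by (rule continuous_on_compose2[OF that]) (auto intro: continuous_intros)
  have "\<exists>M. finite_measure M \<and> sets M = sets (restrict_space borel ?K) \<and>
    (\<forall>g. continuous_on ?K g \<longrightarrow> (\<integral>x. g x \<partial>M) = (\<lambda>g. spectral_functional \<xi> (\<lambda>z. g (Re z))) g)"
    by (rule Riesz_compact_real[OF K])
       (use \<xi> in \<open>auto simp: spectral_functional_add spectral_functional_scale cont
          intro!: spectral_functional_nonneg\<close>)
  then obtain M where M: "finite_measure M" "sets M = sets (restrict_space borel ?K)"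
    and int: "\<And>g. continuous_on ?K g \<Longrightarrow> (\<integral>x. g x \<partial>M) = spectral_functional \<xi> (\<lambda>z. g (Re z))"
    by blast
  have range: "complex_of_real \<in> ?K \<rightarrow> \<Sigma>" using of_real_Re_spectrum by auto
  have meas: "complex_of_real \<in> measurable M (restrict_space borel \<Sigma>)"
    unfolding measurable_cong_sets[OF M(2) refl]
    by (rule measurable_restrict_space3[OF _ range]) simp
  let ?\<mu> = "distr M (restrict_space borel \<Sigma>) complex_of_real"
  have "(\<integral>x. f x \<partial>?\<mu>) = ell2_inner V (fc f \<xi>) \<xi>" if f: "continuous_on \<Sigma> f" for f
  proof -
    have cont': "continuous_on ?K (\<lambda>x. f (of_real x))"
      using range by (intro continuous_on_compose2[OF f] continuous_intros) auto
    have integrable: "integrable M (\<lambda>x. f (of_real x))"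
      by (rule integrable_continuous_on_compact[OF K M cont'])
    have "(\<integral>x. f x \<partial>?\<mu>) = (\<integral>x. f (of_real x) \<partial>M)"
      using f by (intro integral_distr meas borel_measurable_continuous_on_restrict)
    also have "\<dots> = Complex (\<integral>x. Re (f (of_real x)) \<partial>M) (\<integral>x. Im (f (of_real x)) \<partial>M)"
      using integrable by (simp add: complex_eq_iff)
    also have "(\<integral>x. Re (f (of_real x)) \<partial>M) = spectral_functional \<xi> (\<lambda>z. Re (f (of_real (Re z))))"
      by (intro int continuous_intros cont')
    also have "(\<integral>x. Im (f (of_real x)) \<partial>M) = spectral_functional \<xi> (\<lambda>z. Im (f (of_real (Re z))))"
      by (intro int continuous_intros cont')
    also have "Complex (spectral_functional \<xi> (\<lambda>z. Re (f (of_real (Re z)))))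
        (spectral_functional \<xi> (\<lambda>z. Im (f (of_real (Re z)))))
      = ell2_inner V (fc (\<lambda>z. f (of_real (Re z))) \<xi>) \<xi>"
      using \<xi> range by (intro inner_fc_eq[symmetric] continuous_on_compose2[OF f] continuous_intros) auto
    \<comment> \<open>The two functions agree on the real spectrum but possibly not elsewhere, so
      their operators are compared through a common approximating sequence.\<close>
    also have "fc (\<lambda>z. f (of_real (Re z))) \<xi> = fc f \<xi>"
    proof -
      obtain p where p: "uniform_limit \<Sigma> (\<lambda>n. poly (p n)) f sequentially" using uniform_limit_polys[OF f] .
      then have "uniform_limit \<Sigma> (\<lambda>n. poly (p n)) (\<lambda>z. f (of_real (Re z))) sequentially"
        by (rule uniform_limit_cong'[THEN iffD1, rotated 2]) (auto simp: of_real_Re_spectrum)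
      moreover have "continuous_on \<Sigma> (\<lambda>z. f (of_real (Re z)))"
        using range by (intro continuous_on_compose2[OF f] continuous_intros) auto
      ultimately show ?thesis using fc_converges[OF f p \<xi>] f \<xi> by (intro fc_eqI) auto
    qed
    finally show ?thesis .
  qed
  then show ?thesis
    using finite_measure.finite_measure_distr[OF M(1) meas] by (intro exI[of _ ?\<mu>]) simp
qed

section \<open>The measures, their total mass and absolute continuity\<close>

abbreviation "\<mu> \<equiv> local_spectral_measure V A"

text \<open>Justifies the description in \<open>local_spectral_measure\<close>: uniqueness holds
  because continuous functions determine a finite measure on a closed set.\<close>

lemma
  assumes \<xi>: "\<xi> \<in> ell2 V"
  shows sets_spectral_measure: "sets (\<mu> \<xi>) = sets (restrict_space borel \<Sigma>)"
    and finite_spectral_measure: "finite_measure (\<mu> \<xi>)"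
    and integral_spectral_measure:
      "\<And>f. continuous_on \<Sigma> f \<Longrightarrow> (\<integral>x. f x \<partial>\<mu> \<xi>) = ell2_inner V (fc f \<xi>) \<xi>"
proof -
  let ?Q = "\<lambda>\<nu>. sets \<nu> = sets (restrict_space borel \<Sigma>) \<and> finite_measure \<nu> \<and>
    (\<forall>f. continuous_on \<Sigma> f \<longrightarrow> (\<integral>x. f x \<partial>\<nu>) = ell2_inner V (fc f \<xi>) \<xi>)"
  have "M = N" if M: "?Q M" and N: "?Q N" for M N
  proof (rule measure_eq_by_continuous[of \<Sigma>])
    show "closed \<Sigma>" using compact_spectrum[OF bounded] by (rule compact_imp_closed)
    fix h :: "complex \<Rightarrow> real" assume "continuous_on \<Sigma> h"
    then have "continuous_on \<Sigma> (\<lambda>z. complex_of_real (h z))" by (intro continuous_intros)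
    then have "(\<integral>x. complex_of_real (h x) \<partial>M) = (\<integral>x. complex_of_real (h x) \<partial>N)" using M N by metis
    then show "(\<integral>x. h x \<partial>M) = (\<integral>x. h x \<partial>N)" by simp
  qed (use M N in auto)
  then have "\<exists>!\<nu>. ?Q \<nu>" using spectral_measure_exists[OF \<xi>] by blast
  then have "?Q (THE \<nu>. ?Q \<nu>)" by (rule theI')
  then have "?Q (\<mu> \<xi>)" unfolding local_spectral_measure_def .
  then show "sets (\<mu> \<xi>) = sets (restrict_space borel \<Sigma>)" "finite_measure (\<mu> \<xi>)"
    "\<And>f. continuous_on \<Sigma> f \<Longrightarrow> (\<integral>x. f x \<partial>\<mu> \<xi>) = ell2_inner V (fc f \<xi>) \<xi>" by auto
qed

lemma integral_spectral_measure_real: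
  fixes h :: "complex \<Rightarrow> real"
  assumes h: "continuous_on \<Sigma> h" and \<xi>: "\<xi> \<in> ell2 V"
  shows "(\<integral>x. h x \<partial>\<mu> \<xi>) = spectral_functional \<xi> h"
proof -
  have "complex_of_real (\<integral>x. h x \<partial>\<mu> \<xi>) = (\<integral>x. complex_of_real (h x) \<partial>\<mu> \<xi>)" by simp
  also have "\<dots> = of_real (spectral_functional \<xi> h)"
    using h \<xi> by (subst integral_spectral_measure) (auto intro: continuous_intros inner_fc_of_real)
  finally show ?thesis by (simp only: of_real_eq_iff)
qed

text \<open>Positivity applied to 1 - h, the constant 1 giving the squared norm. A vector of small
  norm thus has a measure of small mass.\<close>

lemma spectral_functional_le_norm:
  assumes h: "continuous_on \<Sigma> h" "\<And>z. z \<in> \<Sigma> \<Longrightarrow> h z \<le> 1" and \<xi>: "\<xi> \<in> ell2 V"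
  shows "spectral_functional \<xi> h \<le> (ell2_norm V \<xi>)\<^sup>2"
proof -
  have cont: "continuous_on \<Sigma> (\<lambda>z. 1 + (-1) * h z)" by (intro continuous_intros h)
  have "0 \<le> spectral_functional \<xi> (\<lambda>z. 1 + (-1) * h z)"
    using h by (intro spectral_functional_nonneg cont \<xi>) simp
  also have "\<dots> = spectral_functional \<xi> (\<lambda>z. 1) + (-1) * spectral_functional \<xi> h"
    using h(1) \<xi> by (simp only: spectral_functional_add spectral_functional_scale continuous_on_const
        continuous_on_mult_left)
  also have "spectral_functional \<xi> (\<lambda>z. 1) = (ell2_norm V \<xi>)\<^sup>2"
    using \<xi> by (simp add: spectral_functional_def fc_one ell2_inner_self del: of_real_power)
  finally show ?thesis by simp
qed

text \<open>With \<open>\<eta>\<^sub>F\<close> a finitely supported approximation of \<open>\<eta>\<close> and \<open>\<rho> = \<eta> - \<eta>\<^sub>F\<close>, the parallelogram bound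
  gives \<open>\<mu>\<^sub>\<eta> \<le> 2\<mu>\<^bsub>\<eta>\<^sub>F\<^esub> + 2\<mu>\<^sub>\<rho>\<close>, where \<open>\<mu>\<^bsub>\<eta>\<^sub>F\<^esub>\<close> is at most a multiple of the common vertex measure
  and \<open>\<mu>\<^sub>\<rho>\<close> has small mass.\<close>

lemma absolutely_continuous_if_delta_equal:
  assumes v: "v \<in> V"
    and eq: "\<And>u f. u \<in> V \<Longrightarrow> continuous_on \<Sigma> f \<Longrightarrow>
      ell2_inner V (fc f (delta u)) (delta u) = ell2_inner V (fc f (delta v)) (delta v)"
    and \<eta>: "\<eta> \<in> ell2 V"
  shows "absolutely_continuous (\<mu> (delta v)) (\<mu> \<eta>)"
  unfolding absolutely_continuous_def
proof
  have \<delta>v: "delta v \<in> ell2 V" using v by simp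
  interpret Mv: finite_measure "\<mu> (delta v)" by (rule finite_spectral_measure[OF \<delta>v])
  interpret M: finite_measure "\<mu> \<eta>" by (rule finite_spectral_measure[OF \<eta>])
  fix B assume "B \<in> null_sets (\<mu> (delta v))"
  then have B: "B \<in> sets (\<mu> \<eta>)" "measure (\<mu> (delta v)) B = 0"
    by (auto simp: null_sets_def measure_def sets_spectral_measure[OF \<delta>v] sets_spectral_measure[OF \<eta>])
  have "measure (\<mu> \<eta>) B \<le> e" if e: "e > 0" for e
  proof -
    \<comment> \<open>The tolerance makes the squared norm of the remainder at most
      \<open>e / 2\<close>, and the factor 2 of the parallelogram bound turns this into
      \<open>e\<close>.\<close>
    obtain F where F: "finite F" "F \<subseteq> V"
      and near: "ell2_norm V (\<lambda>w. \<eta> w - (\<Sum>u\<in>F. \<eta> u * delta u w)) < sqrt (e / 2)"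
      using ell2_finite_support_dense[OF \<eta>, of "sqrt (e / 2)"] e by auto
    define \<zeta> where "\<zeta> = (\<lambda>w. \<Sum>u\<in>F. \<eta> u * delta u w)"
    define \<rho> where "\<rho> = (\<lambda>w. \<eta> w - \<zeta> w)"
    have \<zeta>: "\<zeta> \<in> ell2 V" unfolding \<zeta>_def using F by (intro ell2_sum ell2_scale delta_in_ell2) auto
    have \<rho>: "\<rho> \<in> ell2 V" unfolding \<rho>_def using \<eta> \<zeta> by simp
    have \<rho>_small: "(ell2_norm V \<rho>)\<^sup>2 \<le> e / 2"
      using near e power_mono[of "ell2_norm V \<rho>" "sqrt (e / 2)" 2] by (simp add: \<rho>_def \<zeta>_def)
    \<comment> \<open>The triangle inequality over \<open>F\<close> produces this constant, since
      all g(A) delta_u have the same norm.\<close>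
    define c where "c = (\<Sum>u\<in>F. cmod (\<eta> u))"
    have "measure (\<mu> \<eta>) B \<le> (2 * c\<^sup>2) * measure (\<mu> (delta v)) B + e"
    proof (rule measure_le_by_continuous[of \<Sigma>])
      show "closed \<Sigma>" using compact_spectrum[OF bounded] by (rule compact_imp_closed)
      fix h :: "complex \<Rightarrow> real"
      assume h: "continuous_on \<Sigma> h" and h01: "\<And>z. z \<in> \<Sigma> \<Longrightarrow> 0 \<le> h z \<and> h z \<le> 1"
      let ?g = "\<lambda>z. complex_of_real (sqrt (h z))"
      have g: "continuous_on \<Sigma> ?g" by (intro continuous_intros h)
      \<comment> \<open>With g the square root of \<open>h\<close>, the functional becomes a squared
        norm of g(A) xi, which is linear in xi before squaring.\<close>
      have L: "spectral_functional \<xi> h = (ell2_norm V (fc ?g \<xi>))\<^sup>2" if "\<xi> \<in> ell2 V" for \<xi>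
        using h h01 that by (intro spectral_functional_nonneg_eq) auto
      have \<delta>: "ell2_norm V (fc ?g (delta u)) = ell2_norm V (fc ?g (delta v))" if "u \<in> V" for u
      proof -
        have "spectral_functional (delta u) h = spectral_functional (delta v) h"
          unfolding spectral_functional_def using eq[OF that, of "\<lambda>z. of_real (h z)"] h
          by (simp add: continuous_on_of_real)
        then show ?thesis using L[of "delta u"] L[OF \<delta>v] that by (simp add: power2_eq_iff_nonneg)
      qed
      have "fc ?g \<zeta> = (\<lambda>w. \<Sum>u\<in>F. \<eta> u * fc ?g (delta u) w)"
        unfolding \<zeta>_def using F
        by (subst bounded_operator_sum[OF bounded_fc[OF g]])
           (auto simp: bounded_operator_scale[OF bounded_fc[OF g]] subset_iff)
      moreover have "ell2_norm V (\<lambda>w. \<Sum>u\<in>F. \<eta> u * fc ?g (delta u) w)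
        \<le> (\<Sum>u\<in>F. ell2_norm V (\<lambda>w. \<eta> u * fc ?g (delta u) w))"
        using F g by (intro ell2_sum ell2_scale fc_in delta_in_ell2) auto
      moreover have "\<dots> = c * ell2_norm V (fc ?g (delta v))"
        unfolding c_def sum_distrib_right using F \<delta> by (intro sum.cong) auto
      ultimately have "ell2_norm V (fc ?g \<zeta>) \<le> c * ell2_norm V (fc ?g (delta v))" by simp
      from power_mono[OF this, of 2]
      have L\<zeta>: "spectral_functional \<zeta> h \<le> c\<^sup>2 * spectral_functional (delta v) h"
        by (simp add: L[OF \<zeta>] L[OF \<delta>v] power_mult_distrib)
      have L\<rho>: "spectral_functional \<rho> h \<le> e / 2"
        using spectral_functional_le_norm[OF h _ \<rho>] h01 \<rho>_small by fastforce
      have "\<eta> = (\<lambda>w. \<zeta> w + \<rho> w)" by (simp add: \<rho>_def)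
      then have "fc ?g \<eta> = (\<lambda>w. fc ?g \<zeta> w + fc ?g \<rho> w)"
        using bounded_operator_add[OF bounded_fc[OF g] \<zeta> \<rho>] by metis
      then have "ell2_norm V (fc ?g \<eta>) \<le> ell2_norm V (fc ?g \<zeta>) + ell2_norm V (fc ?g \<rho>)"
        using ell2_add(2)[OF fc_in[OF g \<zeta>] fc_in[OF g \<rho>]] by simp
      then have "(ell2_norm V (fc ?g \<eta>))\<^sup>2 \<le> (ell2_norm V (fc ?g \<zeta>) + ell2_norm V (fc ?g \<rho>))\<^sup>2"
        by (intro power_mono) auto
      also have "\<dots> \<le> 2 * (ell2_norm V (fc ?g \<zeta>))\<^sup>2 + 2 * (ell2_norm V (fc ?g \<rho>))\<^sup>2"
        using sum_squares_bound[of "ell2_norm V (fc ?g \<zeta>)" "ell2_norm V (fc ?g \<rho>)"]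
        by (simp add: power2_sum)
      finally have "spectral_functional \<eta> h \<le> 2 * spectral_functional \<zeta> h + 2 * spectral_functional \<rho> h"
        by (simp add: L[OF \<eta>] L[OF \<zeta>] L[OF \<rho>])
      then show "(\<integral>x. h x \<partial>\<mu> \<eta>) \<le> (2 * c\<^sup>2) * (\<integral>x. h x \<partial>\<mu> (delta v)) + e"
        unfolding integral_spectral_measure_real[OF h \<eta>] integral_spectral_measure_real[OF h \<delta>v]
        using L\<zeta> L\<rho> by simp
    qed (use B M.finite_measure_axioms Mv.finite_measure_axioms sets_spectral_measure \<eta> \<delta>v in auto)
    then show ?thesis using B(2) by simp
  qed
  then have "measure (\<mu> \<eta>) B \<le> 0" by (rule field_le_epsilon[of _ 0, simplified])
  then have "measure (\<mu> \<eta>) B = 0" by (simp add: measure_le_0_iff)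
  then show "B \<in> null_sets (\<mu> \<eta>)" using B(1) by (simp add: null_sets_def M.emeasure_eq_measure)
qed

end

section \<open>The adjacency operator\<close>

lemma edge_in_vertices:
  assumes "countable_graph V E" "{v, w} \<in> E"
  shows "v \<in> V" "w \<in> V"
proof -
  have "{v, w} \<in> {{x, y} |x y. x \<in> V \<and> y \<in> V \<and> x \<noteq> y}"
    using assms unfolding countable_graph_def by (meson subsetD)
  then show "v \<in> V" "w \<in> V" by (auto simp: doubleton_eq_iff)
qed

text \<open>The degree counts edges while the operator sums over neighbours; sending w to {v, w} is
  injective. Points outside \<open>V\<close> have no neighbours, so the bounds hold at every
  v.\<close>

lemma finite_neighbours:
  assumes G: "countable_graph V E" and deg: "bounded_degree V E"
  obtains d :: nat where "\<And>v. finite {w. {v, w} \<in> E}" "\<And>v. card {w. {v, w} \<in> E} \<le> d"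
proof -
  obtain d where d: "\<And>v. v \<in> V \<Longrightarrow> finite {e \<in> E. v \<in> e}" "\<And>v. v \<in> V \<Longrightarrow> card {e \<in> E. v \<in> e} \<le> d"
    using deg unfolding bounded_degree_def by blast
  have "finite {w. {v, w} \<in> E} \<and> card {w. {v, w} \<in> E} \<le> d" for v
  proof (cases "v \<in> V")
    case True
    have inj: "inj_on (\<lambda>w. {v, w}) {w. {v, w} \<in> E}" by (auto simp: inj_on_def doubleton_eq_iff)
    have sub: "(\<lambda>w. {v, w}) ` {w. {v, w} \<in> E} \<subseteq> {e \<in> E. v \<in> e}" by auto
    have "finite {w. {v, w} \<in> E}" using finite_subset[OF sub d(1)[OF True]] inj by (rule finite_imageD)
    moreover have "card {w. {v, w} \<in> E} \<le> card {e \<in> E. v \<in> e}"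
      using card_inj_on_le[OF inj sub d(1)[OF True]] .
    ultimately show ?thesis using d(2)[OF True] by simp
  next
    case False
    then have "{w. {v, w} \<in> E} = {}" using edge_in_vertices[OF G] by blast
    then show ?thesis by simp
  qed
  then show ?thesis using that by blast
qed

text \<open>Cauchy-Schwarz over the neighbours of a vertex costs one factor \<open>d\<close>. After
  exchanging the sums, each |xi(w)|^2 is counted at most \<open>d\<close> times, the second factor,
  so the norm is at most \<open>d\<close>. Over a finite \<open>F\<close> only the finite set
  \<open>H\<close> of its neighbours is involved.\<close>

lemma bounded_adjacency_operator:
  assumes G: "countable_graph V E" and deg: "bounded_degree V E"
  shows "bounded_operator V (adjacency_operator E)"
proof -
  let ?A = "adjacency_operator E"
  obtain d :: nat where d: "\<And>v. finite {w. {v, w} \<in> E}" "\<And>v. card {w. {v, w} \<in> E} \<le> d"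
    using finite_neighbours[OF G deg] by blast
  have bound: "L2_set (\<lambda>v. cmod (?A \<xi> v)) F \<le> d * ell2_norm V \<xi>"
    if \<xi>: "\<xi> \<in> ell2 V" and F: "finite F" "F \<subseteq> V" for \<xi> F
  proof -
    define H where "H = (\<Union>v\<in>F. {w. {v, w} \<in> E})"
    have H: "finite H" "H \<subseteq> V" unfolding H_def using F d(1) edge_in_vertices[OF G] by auto
    have "(\<Sum>v\<in>F. (cmod (?A \<xi> v))\<^sup>2) \<le> (\<Sum>v\<in>F. real d * (\<Sum>w | w \<in> H \<and> {v, w} \<in> E. (cmod (\<xi> w))\<^sup>2))"
    proof (rule sum_mono)
      fix v assume v: "v \<in> F"
      have "(cmod (?A \<xi> v))\<^sup>2 \<le> (\<Sum>w | {v, w} \<in> E. cmod (\<xi> w))\<^sup>2"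
        unfolding adjacency_operator_def by (intro power_mono norm_sum) auto
      also have "\<dots> \<le> (\<Sum>w | {v, w} \<in> E. (cmod (\<xi> w))\<^sup>2) * card {w. {v, w} \<in> E}"
        by (rule sum_squared_le_sum_of_squares)
      also have "\<dots> \<le> (\<Sum>w | {v, w} \<in> E. (cmod (\<xi> w))\<^sup>2) * d"
        using d(2)[of v] by (intro mult_left_mono sum_nonneg) auto
      also have "{w. {v, w} \<in> E} = {w. w \<in> H \<and> {v, w} \<in> E}" using v by (auto simp: H_def)
      finally show "(cmod (?A \<xi> v))\<^sup>2 \<le> d * (\<Sum>w | w \<in> H \<and> {v, w} \<in> E. (cmod (\<xi> w))\<^sup>2)"
        by (simp add: mult.commute)
    qed
    also have "\<dots> = d * (\<Sum>w\<in>H. \<Sum>v | v \<in> F \<and> {v, w} \<in> E. (cmod (\<xi> w))\<^sup>2)"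
      using sum.swap_restrict[OF F(1) H(1), of "\<lambda>v w. (cmod (\<xi> w))\<^sup>2" "\<lambda>v w. {v, w} \<in> E"]
      by (simp flip: sum_distrib_left)
    also have "\<dots> \<le> d * (\<Sum>w\<in>H. d * (cmod (\<xi> w))\<^sup>2)"
    proof (intro mult_left_mono sum_mono)
      fix w
      have "{v. v \<in> F \<and> {v, w} \<in> E} \<subseteq> {v. {w, v} \<in> E}" by (auto simp: insert_commute)
      from card_mono[OF d(1) this]
      have "card {v. v \<in> F \<and> {v, w} \<in> E} \<le> card {v. {w, v} \<in> E}" .
      also have "\<dots> \<le> d" by (rule d(2))
      finally show "(\<Sum>v | v \<in> F \<and> {v, w} \<in> E. (cmod (\<xi> w))\<^sup>2) \<le> d * (cmod (\<xi> w))\<^sup>2"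
        by (simp add: mult_right_mono)
    qed simp
    also have "\<dots> = (d * L2_set (\<lambda>w. cmod (\<xi> w)) H)\<^sup>2"
      by (simp add: L2_set_def power_mult_distrib sum_nonneg flip: sum_distrib_left)
         (simp add: power2_eq_square)
    also have "\<dots> \<le> (d * ell2_norm V \<xi>)\<^sup>2"
      using L2_set_le_ell2_norm[OF \<xi> H] by (intro power_mono mult_left_mono) auto
    finally show ?thesis unfolding L2_set_def by (intro real_le_lsqrt) (auto simp: sum_nonneg)
  qed
  have off: "?A \<xi> v = 0" if "v \<notin> V" for \<xi> v
  proof -
    have "{w. {v, w} \<in> E} = {}" using edge_in_vertices[OF G] that by blast
    then show ?thesis by (simp add: adjacency_operator_def)
  qed
  show ?thesis
    unfolding bounded_operator_def
  proof (intro conjI ballI allI exI[of _ "real d"])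
    fix \<xi> assume \<xi>: "\<xi> \<in> ell2 V"
    show "?A \<xi> \<in> ell2 V" "ell2_norm V (?A \<xi>) \<le> real d * ell2_norm V \<xi>"
      using ell2_bounded_partial_sums[of V "?A \<xi>", OF off bound[OF \<xi>]] by auto
    show "?A (\<lambda>v. c * \<xi> v) = (\<lambda>v. c * ?A \<xi> v)" for c
      by (simp add: adjacency_operator_def sum_distrib_left)
    show "?A (\<lambda>v. \<xi> v + \<eta> v) = (\<lambda>v. ?A \<xi> v + ?A \<eta> v)" for \<eta>
      by (simp add: adjacency_operator_def sum.distrib)
  qed
qed

text \<open>Against delta_u both sides are the sum of xi over the neighbours of u, as edges are
  unordered. The defect \<open>D\<close> is conjugate-linear and bounded, so vanishing on finitely
  supported vectors makes it vanish everywhere.\<close>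

lemma self_adjoint_adjacency_operator:
  assumes G: "countable_graph V E" and deg: "bounded_degree V E"
  shows "self_adjoint_operator V (adjacency_operator E)"
proof
  let ?A = "adjacency_operator E"
  show "V \<noteq> {}" using G by (simp add: countable_graph_def)
  show A: "bounded_operator V ?A" by (rule bounded_adjacency_operator[OF G deg])
  obtain d :: nat where fin: "\<And>v. finite {w. {v, w} \<in> E}" using finite_neighbours[OF G deg] by blast
  fix \<xi> \<eta> assume \<xi>: "\<xi> \<in> ell2 V" and \<eta>: "\<eta> \<in> ell2 V"
  have A\<xi>: "?A \<xi> \<in> ell2 V" using bounded_operator_in[OF A \<xi>] .
  have \<delta>: "ell2_inner V (?A \<xi>) (delta u) = ell2_inner V \<xi> (?A (delta u))" if u: "u \<in> V" for u
  proof -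
    have "?A (delta u) = (\<lambda>v. \<Sum>w | {u, w} \<in> E. delta w v)"
    proof
      fix v
      have "{v, u} = {u, v}" by blast
      then show "?A (delta u) v = (\<Sum>w | {u, w} \<in> E. delta w v)"
        using fin by (simp add: adjacency_operator_def delta_def)
    qed
    moreover have "ell2_inner V \<xi> (\<lambda>v. \<Sum>w | {u, w} \<in> E. delta w v) = (\<Sum>w | {u, w} \<in> E. \<xi> w)"
      using edge_in_vertices[OF G] by (subst ell2_inner_sum_right[OF \<xi>]) (auto simp: ell2_inner_delta)
    ultimately show ?thesis using u by (simp add: ell2_inner_delta adjacency_operator_def)
  qed
  define D where "D \<zeta> = ell2_inner V (?A \<xi>) \<zeta> - ell2_inner V \<xi> (?A \<zeta>)" for \<zeta>
  \<comment> \<open>Each of the two inner products in \<open>D\<close> contributes the operator norm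
    times the norm of xi.\<close>
  define c where "c = 2 * operator_norm V ?A * ell2_norm V \<xi>"
  have c: "0 \<le> c" using operator_norm_nonneg[OF A] by (simp add: c_def)
  have "cmod (D \<eta>) \<le> c * e" if e: "e > 0" for e
  proof -
    obtain F where F: "finite F" "F \<subseteq> V"
      and near: "ell2_norm V (\<lambda>v. \<eta> v - (\<Sum>u\<in>F. \<eta> u * delta u v)) < e"
      using ell2_finite_support_dense[OF \<eta> e] .
    define \<zeta> where "\<zeta> = (\<lambda>v. \<Sum>u\<in>F. \<eta> u * delta u v)"
    define \<rho> where "\<rho> = (\<lambda>v. \<eta> v - \<zeta> v)"
    have \<delta>_in: "(\<lambda>v. \<eta> u * delta u v) \<in> ell2 V" "?A (delta u) \<in> ell2 V" if "u \<in> F" for u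
      using that F bounded_operator_in[OF A] by auto
    have \<zeta>: "\<zeta> \<in> ell2 V" unfolding \<zeta>_def using \<delta>_in by (intro ell2_sum) auto
    have \<rho>: "\<rho> \<in> ell2 V" "?A \<rho> \<in> ell2 V" unfolding \<rho>_def using \<eta> \<zeta> bounded_operator_in[OF A] by auto
    have "?A \<zeta> = (\<lambda>v. \<Sum>u\<in>F. \<eta> u * ?A (delta u) v)"
      unfolding \<zeta>_def using F
      by (subst bounded_operator_sum[OF A \<delta>_in(1)]) (auto simp: bounded_operator_scale[OF A] subset_iff)
    then have "ell2_inner V \<xi> (?A \<zeta>) = (\<Sum>u\<in>F. cnj (\<eta> u) * ell2_inner V \<xi> (?A (delta u)))"
      using \<xi> \<delta>_in by (simp add: ell2_inner_sum_right ell2_inner_scale_right)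
    moreover have "ell2_inner V (?A \<xi>) \<zeta> = (\<Sum>u\<in>F. cnj (\<eta> u) * ell2_inner V (?A \<xi>) (delta u))"
      unfolding \<zeta>_def using A\<xi> \<delta>_in by (simp add: ell2_inner_sum_right ell2_inner_scale_right)
    ultimately have "D \<zeta> = 0"
      using \<delta> F by (simp add: D_def subset_iff)
    moreover have "D \<rho> = D \<eta> - D \<zeta>"
      unfolding D_def \<rho>_def using \<xi> A\<xi> \<eta> \<zeta> bounded_operator_in[OF A]
      by (simp add: bounded_operator_diff[OF A] ell2_inner_diff_right)
    ultimately have "cmod (D \<eta>) \<le> cmod (ell2_inner V (?A \<xi>) \<rho>) + cmod (ell2_inner V \<xi> (?A \<rho>))"
      unfolding D_def[of \<rho>] by (metis diff_zero norm_triangle_ineq4)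
    also have "\<dots> \<le> ell2_norm V (?A \<xi>) * ell2_norm V \<rho> + ell2_norm V \<xi> * ell2_norm V (?A \<rho>)"
      using \<xi> A\<xi> \<rho> by (intro add_mono ell2_Cauchy_Schwarz)
    also have "\<dots> \<le> (operator_norm V ?A * ell2_norm V \<xi>) * ell2_norm V \<rho>
        + ell2_norm V \<xi> * (operator_norm V ?A * ell2_norm V \<rho>)"
      using operator_norm_bound[OF A] \<xi> \<rho> by (intro add_mono mult_left_mono mult_right_mono) auto
    also have "\<dots> = c * ell2_norm V \<rho>" by (simp add: c_def)
    also have "\<dots> \<le> c * e" using near c unfolding \<rho>_def \<zeta>_def by (intro mult_left_mono) auto
    finally show ?thesis .
  qed
  note small = this
  have "cmod (D \<eta>) \<le> 0"
  proof (rule field_le_epsilon)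
    fix e :: real assume e: "e > 0"
    \<comment> \<open>The denominator \<open>c + 1\<close> covers the case
      \<open>c = 0\<close>.\<close>
    have "cmod (D \<eta>) \<le> c * (e / (c + 1))" using e c by (intro small) simp
    also have "\<dots> \<le> e" using e c by (simp add: field_simps)
    finally show "cmod (D \<eta>) \<le> 0 + e" by simp
  qed
  then show "ell2_inner V (?A \<xi>) \<eta> = ell2_inner V \<xi> (?A \<eta>)" by (simp add: D_def)
qed

section \<open>Automorphisms\<close>

text \<open>These entries count the walks of length i between two vertices, and an automorphism maps
  the neighbours of u bijectively to those of its image. The case u = v is the one used later;
  general u is needed for the induction.\<close>

lemma automorphism_adjacency_power:
  assumes G: "countable_graph V E" and \<phi>: "graph_automorphism V E \<phi>"
    and v: "v \<in> V" and u: "u \<in> V"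
  shows "(adjacency_operator E ^^ i) (delta (\<phi> v)) (\<phi> u) = (adjacency_operator E ^^ i) (delta v) u"
  using u
proof (induction i arbitrary: u)
  case 0
  then show ?case
    using \<phi> v by (auto simp: delta_def graph_automorphism_def bij_betw_def inj_on_eq_iff)
next
  case (Suc i)
  have bij: "inj_on \<phi> V" "\<phi> ` V = V" using \<phi> by (auto simp: graph_automorphism_def bij_betw_def)
  have edge: "{\<phi> x, \<phi> y} \<in> E \<longleftrightarrow> {x, y} \<in> E" if "x \<in> V" "y \<in> V" for x y
    using \<phi> that by (auto simp: graph_automorphism_def)
  let ?N = "\<lambda>u. {w. {u, w} \<in> E}"
  have N: "?N u \<subseteq> V" using edge_in_vertices[OF G] by blast
  have "?N (\<phi> u) = \<phi> ` ?N u"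
  proof
    show "?N (\<phi> u) \<subseteq> \<phi> ` ?N u"
    proof
      fix w assume w: "w \<in> ?N (\<phi> u)"
      then have "w \<in> V" using edge_in_vertices[OF G] by blast
      then obtain x where "x \<in> V" "w = \<phi> x" using bij(2) by blast
      then show "w \<in> \<phi> ` ?N u" using w edge Suc.prems by auto
    qed
    show "\<phi> ` ?N u \<subseteq> ?N (\<phi> u)" using N edge Suc.prems by auto
  qed
  moreover have "inj_on \<phi> (?N u)" using bij(1) N by (rule inj_on_subset)
  ultimately show ?case
    using Suc.IH N by (simp add: adjacency_operator_def[of E] sum.reindex subset_iff)
qed

text \<open>One approximating sequence serves both vertices, so equality of the polynomial
  coefficients passes to the limit.\<close>

lemma automorphism_inner_fc:
  assumes G: "countable_graph V E" "bounded_degree V E" and \<phi>: "graph_automorphism V E \<phi>"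
    and v: "v \<in> V" and f: "continuous_on (spectrum V (adjacency_operator E)) f"
  shows "ell2_inner V (functional_calculus V (adjacency_operator E) f (delta (\<phi> v))) (delta (\<phi> v))
       = ell2_inner V (functional_calculus V (adjacency_operator E) f (delta v)) (delta v)"
proof -
  interpret self_adjoint_operator V "adjacency_operator E"
    by (rule self_adjoint_adjacency_operator[OF G])
  have \<phi>v: "\<phi> v \<in> V" using \<phi> v by (auto simp: graph_automorphism_def bij_betw_def)
  obtain p where p: "uniform_limit \<Sigma> (\<lambda>n. poly (p n)) f sequentially" using uniform_limit_polys[OF f] .
  have lim: "(\<lambda>n. ell2_inner V (P (p n) (delta u)) (delta u)) \<longlonglongrightarrow> ell2_inner V (fc f (delta u)) (delta u)"
    if "u \<in> V" for u
    using that f by (intro ell2_converges_inner fc_converges p) auto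
  have "ell2_inner V (P q (delta (\<phi> v))) (delta (\<phi> v)) = ell2_inner V (P q (delta v)) (delta v)" for q
    using v \<phi>v automorphism_adjacency_power[OF G(1) \<phi> v v]
    by (simp add: ell2_inner_delta poly_operator_def)
  then show ?thesis using LIMSEQ_unique[OF lim[OF \<phi>v]] lim[OF v] by simp
qed

text \<open>The conditions that describe the two measures are equivalent, so the two descriptions
  denote the same measure.\<close>

lemma automorphism_vertex_spectral_measure:
  assumes G: "countable_graph V E" "bounded_degree V E" and \<phi>: "graph_automorphism V E \<phi>" and v: "v \<in> V"
  shows "vertex_spectral_measure V E (\<phi> v) = vertex_spectral_measure V E v"
proof -
  let ?A = "adjacency_operator E"
  have "(\<forall>f. continuous_on (spectrum V ?A) f \<longrightarrow>
        (\<integral>x. f x \<partial>\<nu>) = ell2_inner V (functional_calculus V ?A f (delta (\<phi> v))) (delta (\<phi> v)))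
    \<longleftrightarrow> (\<forall>f. continuous_on (spectrum V ?A) f \<longrightarrow>
        (\<integral>x. f x \<partial>\<nu>) = ell2_inner V (functional_calculus V ?A f (delta v)) (delta v))" for \<nu>
    using automorphism_inner_fc[OF G \<phi> v] by (intro all_cong1 imp_cong refl) simp
  then show ?thesis unfolding vertex_spectral_measure_def local_spectral_measure_def by (simp only:)
qed

theorem proposition3p4:
  fixes V :: "'a set" and E :: "'a set set"
  assumes "countable_graph V E" and "bounded_degree V E"
  shows "(\<forall>v\<in>V. \<forall>w\<in>V. (\<exists>\<phi>. graph_automorphism V E \<phi> \<and> \<phi> v = w) \<longrightarrow>
             vertex_spectral_measure V E v = vertex_spectral_measure V E w) \<and>
         (vertex_transitive V E \<longrightarrow>
             (\<forall>v\<in>V. \<forall>w\<in>V. vertex_spectral_measure V E v = vertex_spectral_measure V E w) \<and>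
             (\<forall>v\<in>V. dominant V E v))"
proof -
  interpret self_adjoint_operator V "adjacency_operator E"
    by (rule self_adjoint_adjacency_operator[OF assms])
  have eq: "vertex_spectral_measure V E v = vertex_spectral_measure V E w"
    if "v \<in> V" "graph_automorphism V E \<phi>" "\<phi> v = w" for v w \<phi>
    using automorphism_vertex_spectral_measure[OF assms that(2,1)] that(3) by simp
  have "dominant V E v" if trans: "vertex_transitive V E" and v: "v \<in> V" for v
    unfolding dominant_def vertex_spectral_measure_def
  proof
    fix \<eta> assume \<eta>: "\<eta> \<in> ell2 V"
    show "absolutely_continuous (\<mu> (delta v)) (\<mu> \<eta>)"
    proof (rule absolutely_continuous_if_delta_equal[OF v _ \<eta>])
      fix u and f :: "complex \<Rightarrow> complex" assume "u \<in> V" "continuous_on \<Sigma> f"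
      moreover obtain \<phi> where "graph_automorphism V E \<phi>" "\<phi> v = u"
        using trans v \<open>u \<in> V\<close> unfolding vertex_transitive_def by blast
      ultimately show "ell2_inner V (fc f (delta u)) (delta u) = ell2_inner V (fc f (delta v)) (delta v)"
        using automorphism_inner_fc[OF assms _ v] by blast
    qed
  qed
  moreover have "vertex_spectral_measure V E v = vertex_spectral_measure V E w"
    if trans: "vertex_transitive V E" and v: "v \<in> V" and w: "w \<in> V" for v w
  proof -
    obtain \<phi> where "graph_automorphism V E \<phi>" "\<phi> v = w"
      using trans v w unfolding vertex_transitive_def by blast
    then show ?thesis by (rule eq[OF v])
  qed
  ultimately show ?thesis
    by (intro conjI ballI impI) (erule exE, erule conjE, rule eq, assumption+)
qed

end
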